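(* Let $\lambda\ge0$, $T>0$, let $g$ and $u_0$ satisfy hypotheses (H) of the context, and let $u$ be a constructed weak solution (as defined in the context) of $$\partial_t u=\rho_\lambda u\,\partial_x^2u+\rho_\lambda g u\ \text{ in }(0,T)\times\Omega,\qquad u(t,0)=0,\qquad u(0,\cdot)=u_0 .$$ Then $u$ admits a representative (not relabeled) that is locally H\"older continuous in $(0,T]\times\Omega$ and locally Lipschitz in $x$: for every $0<t_0<T$ and every $D\Subset\Omega$, $$\|u\|_{C^{1/4,1/2}((t_0,T)\times D)}<\infty\quad\text{and}\quad\|\partial_xu\|_{L^\infty((t_0,T)\times D)}<\infty .$$
   Context: $\Omega=(0,\infty)$, $Q_T=(0,T)\times\Omega$, $\rho_\lambda(x)=x^{1/2}(x+\lambda)(x+2\lambda)^{1/2}$ (so $\rho_0(x)=x^2$), $d\nu_\lambda=\rho_\lambda(x)^{-1}dx$. For $\alpha\in(0,1)$, $\|\cdot\|_{C^{\alpha/2,\alpha}}$ is the sup norm plus the seminorm $\sup|f(t_1,x_1)-f(t_2,x_2)|/(|x_1-x_2|^{\alpha}+|t_1-t_2|^{\alpha/2})$ over distinct pairs of points. (H): $\rho_\lambda g\in L^\infty(\Omega)$; $u_0\ge0$; if $\lambda=0$, $u_0\in L^\delta(\Omega;d\nu_0)\cap L^3(\Omega;d\nu_0)$ for some $\delta\in(0,1)$; if $\lambda>0$, $u_0\in L^1(\Omega;d\nu_\lambda)\cap L^3(\Omega;d\nu_\lambda)$ (then $\nu_\lambda$ is finite, $u_0\in L^\delta(d\nu_\lambda)$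 for all $\delta\in(0,1)$, and any such $\delta$ may be fixed). Weak solution: a nonnegative $u:Q_T\to\mathbb R$ with $u^2\in L^{3/2}(0,T;V_0^{3/2}(\Omega))$, $\partial_xu^2\in L^2(Q_T)$, $\partial_xu\in L^2_{loc}(Q_T)$, such that for all $\phi\in C_c^\infty([0,T)\times\Omega)$ $$-\int_{Q_T}u\,\partial_t\phi\,dt\,d\nu_\lambda+\int_{Q_T}\partial_x\Big(\frac{u^2}{2}\Big)\partial_x\phi+\int_{Q_T}|\partial_xu|^2\phi=\int_\Omega u_0\,\phi(0,\cdot)\,d\nu_\lambda+\int_{Q_T}\phi u g ,$$ where $V_0^p(\Omega)$ is the closure of $C_c^\infty(\Omega)$ under $\|f\|_{L^p(\Omega;d\nu_\lambda)}+\|\partial_xf\|_{L^2(\Omega)}$. Regularized solutions: for each $n\in\mathbb N$ choose $\Omega_n=(a_n,b_n)$ with $a_{n+1}<a_n$, $b_n<b_{n+1}$, $a_n\to0$, $b_n\to\infty$, $\frac1n\nu_\lambda(\Omega_n)\to0$; $r_n>0$ with $r_n\to0$, $r_nn^\delta\to\infty$; and data with $\rho_\lambda g_n\in C_c^\infty(\Omega_n)$, $0\le u_{0,n}\in C_c^{2+\beta}(\Omega_n)$ for some $\beta\in(0,1)$, $u_{0,n}\to u_0$ in $L^p(\Omega;d\nu_\lambda)$ for $p\in[\delta,3]$, $\rho_\lambda g_n\to\rho_\lambda g$ in $L^p_{loc}(\Omega)$ and a.e., $\operatorname{ess\,inf}_{\Omega_n}\rho_\lambda g_n\ge\min(\operatorname{ess\,inf}_\Omega\rho_\lambda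 g,0)$, $\|\rho_\lambda g_n\|_{L^\infty}\le\|\rho_\lambda g\|_{L^\infty}$, and $\operatorname{supp}u_{0,n}\cup\operatorname{supp}(\rho_\lambda g_n)\subset[a_n+r_n,b_n-r_n]$; any such choice of $(\Omega_n,r_n,u_{0,n},g_n)_{n\in\mathbb N}$ is called admissible regularized data. Let $u_n\in C^{1+\beta/2,2+\beta}([0,T]\times\overline{\Omega_n})$ be the unique classical solution of $\partial_tu_n=\rho_\lambda(u_n+\frac1n)\partial_x^2u_n+\rho_\lambda g_n(u_n+\frac1n)$ on $(0,T)\times\Omega_n$, $u_n(0,\cdot)=u_{0,n}$, $u_n(t,a_n)=u_n(t,b_n)=0$, extended by zero to $Q_T$. Constructed weak solution: a weak solution $u$ with $\partial_xu\in L^2(Q_T)$, $u\in L^\infty(0,T;L^p(\Omega;d\nu_\lambda))$ for $p\in[1,3]$ (and $p=\delta$ if $\lambda=0$), which, for some choice of admissible regularized data $(\Omega_n,r_n,u_{0,n},g_n)_{n\in\mathbb N}$, is the limit of a subsequence of the corresponding regularized solutions $(u_n)$ in the senses: $u_n\to u$ in $L^q_{loc}(Q_T;dt\times d\nu_\lambda)$ for all $q\in(\delta,3)$ and a.e.; $\partial_xu_n\rightharpoonup\partial_xu$ and $\partial_xu_n^2\rightharpoonup\partial_xu^2$ weakly in $L^2(Q_T)$; $\partial_xu_n\to\partial_xu$ in $L^2_{loc}(Q_T)$ and a.e. *)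

theory Defs
  imports "HOL-Analysis.Analysis" "HOL-Probability.Essential_Supremum"
begin

text \<open>
  Conventions. Points of the time-space domain are pairs \<open>(t, x)\<close> of type \<^typ>\<open>real \<times> real\<close>.
  Elements of Lebesgue spaces are rendered as functions that are measurable with respect to
  (restrictions of) the completed measure \<^const>\<open>lebesgue\<close>; identities and inequalities between
  them are understood almost everywhere. Sequences indexed by \<open>n = 1, 2, 3, \<dots>\<close> are
  functions on \<^typ>\<open>nat\<close> whose value at 0 is irrelevant.
\<close>

section \<open>Lebesgue spaces\<close>

definition Lp :: "'a measure \<Rightarrow> real \<Rightarrow> ('a \<Rightarrow> real) \<Rightarrow> bool" where
  "Lp M p f \<longleftrightarrow> f \<in> borel_measurable M \<and> integrable M (\<lambda>x. \<bar>f x\<bar> powr p)"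

definition Lp_norm :: "'a measure \<Rightarrow> real \<Rightarrow> ('a \<Rightarrow> real) \<Rightarrow> real" where
  "Lp_norm M p f = (LINT x|M. \<bar>f x\<bar> powr p) powr (1 / p)"

text \<open>Convergence in \<open>L\<^sup>p\<close> is stated without the outer power \<open>1 / p\<close>, so that it also has its
  usual meaning for \<open>0 < p < 1\<close>.\<close>

definition Lp_tendsto :: "'a measure \<Rightarrow> real \<Rightarrow> (nat \<Rightarrow> 'a \<Rightarrow> real) \<Rightarrow> ('a \<Rightarrow> real) \<Rightarrow> bool" where
  "Lp_tendsto M p F f \<longleftrightarrow>
     (\<forall>\<^sub>F n in sequentially. Lp M p (\<lambda>x. F n x - f x)) \<and>
     (\<lambda>n. LINT x|M. \<bar>F n x - f x\<bar> powr p) \<longlonglongrightarrow> 0"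

definition Lp_loc :: "'a::topological_space measure \<Rightarrow> 'a set \<Rightarrow> real \<Rightarrow> ('a \<Rightarrow> real) \<Rightarrow> bool" where
  "Lp_loc M U p f \<longleftrightarrow> (\<forall>K. compact K \<and> K \<subseteq> U \<longrightarrow> Lp (restrict_space M K) p f)"

definition Lp_loc_tendsto ::
  "'a::topological_space measure \<Rightarrow> 'a set \<Rightarrow> real \<Rightarrow> (nat \<Rightarrow> 'a \<Rightarrow> real) \<Rightarrow> ('a \<Rightarrow> real) \<Rightarrow> bool" where
  "Lp_loc_tendsto M U p F f \<longleftrightarrow>
     (\<forall>K. compact K \<and> K \<subseteq> U \<longrightarrow> Lp_tendsto (restrict_space M K) p F f)"

definition weak_L2_tendsto :: "'a measure \<Rightarrow> (nat \<Rightarrow> 'a \<Rightarrow> real) \<Rightarrow> ('a \<Rightarrow> real) \<Rightarrow> bool" where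
  "weak_L2_tendsto M F f \<longleftrightarrow>
     (\<forall>n. Lp M 2 (F n)) \<and> Lp M 2 f \<and>
     (\<forall>h. Lp M 2 h \<longrightarrow> (\<lambda>n. LINT x|M. F n x * h x) \<longlonglongrightarrow> (LINT x|M. f x * h x))"

definition Linf_norm :: "'a measure \<Rightarrow> ('a \<Rightarrow> real) \<Rightarrow> ereal" where
  "Linf_norm M f = esssup M (\<lambda>x. ereal \<bar>f x\<bar>)"

definition Linf :: "'a measure \<Rightarrow> ('a \<Rightarrow> real) \<Rightarrow> bool" where
  "Linf M f \<longleftrightarrow> f \<in> borel_measurable M \<and> Linf_norm M f < \<infinity>"

definition essinf :: "'a measure \<Rightarrow> ('a \<Rightarrow> real) \<Rightarrow> ereal" where
  "essinf M f = - esssup M (\<lambda>x. - ereal (f x))"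


section \<open>Test functions and weak derivatives\<close>

definition pd :: "'a::euclidean_space \<Rightarrow> ('a \<Rightarrow> real) \<Rightarrow> 'a \<Rightarrow> real" where
  "pd b f x = frechet_derivative f (at x) b"

primrec Ck :: "nat \<Rightarrow> ('a::euclidean_space \<Rightarrow> real) \<Rightarrow> bool" where
  "Ck 0 f \<longleftrightarrow> continuous_on UNIV f"
| "Ck (Suc k) f \<longleftrightarrow> (\<forall>x. f differentiable (at x)) \<and> (\<forall>b\<in>Basis. Ck k (pd b f))"

definition supp :: "('a::topological_space \<Rightarrow> real) \<Rightarrow> 'a set" where
  "supp f = closure {x. f x \<noteq> 0}"

text \<open>Elements of \<open>C\<^sub>c\<^sup>\<infinity>(U)\<close>, identified with their extension by zero to the whole space.\<close>

definition test_function :: "'a::euclidean_space set \<Rightarrow> ('a \<Rightarrow> real) \<Rightarrow> bool" where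
  "test_function U \<phi> \<longleftrightarrow> (\<forall>k. Ck k \<phi>) \<and> compact (supp \<phi>) \<and> supp \<phi> \<subseteq> U"

definition weak_pd ::
  "'a::euclidean_space \<Rightarrow> 'a set \<Rightarrow> ('a \<Rightarrow> real) \<Rightarrow> ('a \<Rightarrow> real) \<Rightarrow> bool" where
  "weak_pd b U f w \<longleftrightarrow>
     Lp_loc lebesgue U 1 f \<and> Lp_loc lebesgue U 1 w \<and>
     (\<forall>\<phi>. test_function U \<phi> \<longrightarrow>
        (LINT x|lebesgue_on U. f x * pd b \<phi> x) = - (LINT x|lebesgue_on U. w x * \<phi> x))"

definition weakly_diff :: "'a::euclidean_space \<Rightarrow> 'a set \<Rightarrow> ('a \<Rightarrow> real) \<Rightarrow> bool" where
  "weakly_diff b U f \<longleftrightarrow> (\<exists>w. weak_pd b U f w)"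

text \<open>A representative of the weak derivative (unique almost everywhere in an open \<open>U\<close>);
  meaningful only under \<^const>\<open>weakly_diff\<close>.\<close>

definition wpd :: "'a::euclidean_space \<Rightarrow> 'a set \<Rightarrow> ('a \<Rightarrow> real) \<Rightarrow> 'a \<Rightarrow> real" where
  "wpd b U f = (SOME w. weak_pd b U f w)"


section \<open>Hoelder spaces\<close>

definition holder_norm :: "real \<Rightarrow> (real \<times> real) set \<Rightarrow> (real \<times> real \<Rightarrow> real) \<Rightarrow> ennreal" where
  "holder_norm \<alpha> S f =
     (SUP z\<in>S. ennreal \<bar>f z\<bar>) +
     (SUP (z, w)\<in>{(z, w). z \<in> S \<and> w \<in> S \<and> z \<noteq> w}.
        ennreal (\<bar>f z - f w\<bar> / (\<bar>snd z - snd w\<bar> powr \<alpha> + \<bar>fst z - fst w\<bar> powr (\<alpha> / 2))))"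

definition locally_holder :: "real \<Rightarrow> (real \<times> real) set \<Rightarrow> (real \<times> real \<Rightarrow> real) \<Rightarrow> bool" where
  "locally_holder \<alpha> S f \<longleftrightarrow> (\<forall>K. compact K \<and> K \<subseteq> S \<longrightarrow> holder_norm \<alpha> K f < \<infinity>)"

definition locally_lipschitz_x :: "(real \<times> real) set \<Rightarrow> (real \<times> real \<Rightarrow> real) \<Rightarrow> bool" where
  "locally_lipschitz_x S f \<longleftrightarrow>
     (\<forall>K. compact K \<and> K \<subseteq> S \<longrightarrow>
        (\<exists>L. \<forall>t x y. (t, x) \<in> K \<and> (t, y) \<in> K \<longrightarrow> \<bar>f (t, x) - f (t, y)\<bar> \<le> L * \<bar>x - y\<bar>))"

definition Cc_2_beta :: "real \<Rightarrow> real set \<Rightarrow> (real \<Rightarrow> real) \<Rightarrow> bool" where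
  "Cc_2_beta \<beta> U f \<longleftrightarrow>
     Ck 2 f \<and> compact (supp f) \<and> supp f \<subseteq> U \<and>
     (\<exists>C. \<forall>x y. \<bar>pd 1 (pd 1 f) x - pd 1 (pd 1 f) y\<bar> \<le> C * \<bar>x - y\<bar> powr \<beta>)"


section \<open>The weighted spaces of the problem\<close>

definition Omega :: "real set" where
  "Omega = {0<..}"

definition Q :: "real \<Rightarrow> (real \<times> real) set" where
  "Q T = {0<..<T} \<times> Omega"

definition rho :: "real \<Rightarrow> real \<Rightarrow> real" where
  "rho l x = sqrt x * (x + l) * sqrt (x + 2 * l)"

definition nu :: "real \<Rightarrow> real measure" where
  "nu l = density (lebesgue_on Omega) (\<lambda>x. ennreal (1 / rho l x))"

text \<open>The measure \<open>dt \<times> d\<nu>\<^sub>\<lambda>\<close> on \<open>Q\<^sub>T\<close>.\<close>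

definition dt_nu :: "real \<Rightarrow> real \<Rightarrow> (real \<times> real) measure" where
  "dt_nu l T = density (lebesgue_on (Q T)) (\<lambda>z. ennreal (1 / rho l (snd z)))"

abbreviation wdx :: "real \<Rightarrow> (real \<times> real \<Rightarrow> real) \<Rightarrow> real \<times> real \<Rightarrow> real" where
  "wdx T \<equiv> wpd (0, 1) (Q T)"

abbreviation has_wdx :: "real \<Rightarrow> (real \<times> real \<Rightarrow> real) \<Rightarrow> bool" where
  "has_wdx T \<equiv> weakly_diff (0, 1) (Q T)"

definition V_norm :: "real \<Rightarrow> real \<Rightarrow> (real \<Rightarrow> real) \<Rightarrow> real" where
  "V_norm l p f = Lp_norm (nu l) p f + Lp_norm (lebesgue_on Omega) 2 (wpd 1 Omega f)"

text \<open>The closure of \<open>C\<^sub>c\<^sup>\<infinity>(\<Omega>)\<close> is taken inside the space of all functions with finite norm.\<close>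

definition V0 :: "real \<Rightarrow> real \<Rightarrow> (real \<Rightarrow> real) \<Rightarrow> bool" where
  "V0 l p f \<longleftrightarrow>
     Lp (nu l) p f \<and> weakly_diff 1 Omega f \<and> Lp (lebesgue_on Omega) 2 (wpd 1 Omega f) \<and>
     (\<exists>\<phi>. (\<forall>k::nat. test_function Omega (\<phi> k)) \<and> (\<lambda>k. V_norm l p (\<lambda>x. f x - \<phi> k x)) \<longlonglongrightarrow> 0)"

text \<open>The Bochner space \<open>L\<^sup>q(0,T; V\<^sub>0\<^sup>p(\<Omega>))\<close>; strong measurability is approximability, for almost
  every \<open>t\<close>, by simple functions \<open>s k\<close> with values in \<open>V\<^sub>0\<^sup>p(\<Omega>)\<close>.\<close>

definition bochner_V0 :: "real \<Rightarrow> real \<Rightarrow> real \<Rightarrow> real \<Rightarrow> (real \<times> real \<Rightarrow> real) \<Rightarrow> bool" where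
  "bochner_V0 l T q p w \<longleftrightarrow>
     (AE t in lebesgue_on {0<..<T}. V0 l p (\<lambda>x. w (t, x))) \<and>
     (\<exists>s :: nat \<Rightarrow> real \<Rightarrow> real \<Rightarrow> real.
        (\<forall>k. finite (range (s k)) \<and> (\<forall>t. V0 l p (s k t)) \<and>
             (\<forall>h. {t \<in> {0<..<T}. s k t = h} \<in> sets lebesgue)) \<and>
        (AE t in lebesgue_on {0<..<T}. (\<lambda>k. V_norm l p (\<lambda>x. w (t, x) - s k t x)) \<longlonglongrightarrow> 0)) \<and>
     integrable (lebesgue_on {0<..<T}) (\<lambda>t. V_norm l p (\<lambda>x. w (t, x)) powr q)"

text \<open>\<open>u \<in> L\<^sup>\<infinity>(0,T; L\<^sup>p(\<Omega>; d\<nu>\<^sub>\<lambda>))\<close> for a measurable \<open>u\<close> on \<open>Q\<^sub>T\<close>, with the bound put on the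
  \<open>p\<close>-th power of the norm.\<close>

definition Linf_Lp :: "real \<Rightarrow> real \<Rightarrow> real \<Rightarrow> (real \<times> real \<Rightarrow> real) \<Rightarrow> bool" where
  "Linf_Lp l T p u \<longleftrightarrow>
     u \<in> borel_measurable (lebesgue_on (Q T)) \<and>
     (\<exists>C. AE t in lebesgue_on {0<..<T}.
        Lp (nu l) p (\<lambda>x. u (t, x)) \<and> (LINT x|nu l. \<bar>u (t, x)\<bar> powr p) \<le> C)"


section \<open>Hypotheses and weak solutions\<close>

definition hypothesis_H :: "real \<Rightarrow> real \<Rightarrow> (real \<Rightarrow> real) \<Rightarrow> (real \<Rightarrow> real) \<Rightarrow> bool" where
  "hypothesis_H l \<delta> g u0 \<longleftrightarrow>
     0 < \<delta> \<and> \<delta> < 1 \<and>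
     Linf (lebesgue_on Omega) (\<lambda>x. rho l x * g x) \<and>
     (AE x in lebesgue_on Omega. 0 \<le> u0 x) \<and>
     (l = 0 \<longrightarrow> Lp (nu l) \<delta> u0 \<and> Lp (nu l) 3 u0) \<and>
     (l > 0 \<longrightarrow> Lp (nu l) 1 u0 \<and> Lp (nu l) 3 u0)"

text \<open>\<open>C\<^sub>c\<^sup>\<infinity>([0,T) \<times> \<Omega>)\<close> consists of the restrictions to \<open>[0,T) \<times> \<Omega>\<close> of the elements of
  \<open>C\<^sub>c\<^sup>\<infinity>((-\<infinity>,T) \<times> \<Omega>)\<close>. The integrability clause expresses that the third integral exists: it is
  not implied by the local integrability of \<open>(\<partial>\<^sub>x u)\<^sup>2\<close> in \<open>Q\<^sub>T\<close>, since the support of \<open>\<phi>\<close> may meet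
  \<open>{t = 0}\<close>.\<close>

definition weak_solution ::
  "real \<Rightarrow> real \<Rightarrow> (real \<Rightarrow> real) \<Rightarrow> (real \<Rightarrow> real) \<Rightarrow> (real \<times> real \<Rightarrow> real) \<Rightarrow> bool" where
  "weak_solution l T g u0 u \<longleftrightarrow>
     u \<in> borel_measurable (lebesgue_on (Q T)) \<and>
     (AE z in lebesgue_on (Q T). 0 \<le> u z) \<and>
     bochner_V0 l T (3/2) (3/2) (\<lambda>z. (u z)\<^sup>2) \<and>
     has_wdx T (\<lambda>z. (u z)\<^sup>2) \<and> Lp (lebesgue_on (Q T)) 2 (wdx T (\<lambda>z. (u z)\<^sup>2)) \<and>
     has_wdx T u \<and> Lp_loc lebesgue (Q T) 2 (wdx T u) \<and>
     (\<forall>\<phi>. test_function ({..<T} \<times> Omega) \<phi> \<longrightarrow>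
        integrable (lebesgue_on (Q T)) (\<lambda>z. \<bar>wdx T u z\<bar>\<^sup>2 * \<phi> z) \<and>
        - (LINT z|dt_nu l T. u z * pd (1, 0) \<phi> z)
        + (LINT z|lebesgue_on (Q T). wdx T (\<lambda>z. (u z)\<^sup>2 / 2) z * pd (0, 1) \<phi> z)
        + (LINT z|lebesgue_on (Q T). \<bar>wdx T u z\<bar>\<^sup>2 * \<phi> z)
        = (LINT x|nu l. u0 x * \<phi> (0, x))
        + (LINT z|lebesgue_on (Q T). \<phi> z * u z * g (snd z)))"


section \<open>Regularized problems and constructed weak solutions\<close>

text \<open>Smoothness and support of \<open>\<rho>\<^sub>\<lambda> g\<^sub>n\<close> and \<open>u\<^sub>0\<^sub>,\<^sub>n\<close> are conditions on functions on the whole line,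
  which thereby vanish outside \<open>\<Omega>\<^sub>n\<close>. The exponent \<open>\<beta>\<close> may depend on \<open>n\<close>.\<close>

definition admissible_data ::
  "real \<Rightarrow> real \<Rightarrow> (real \<Rightarrow> real) \<Rightarrow> (real \<Rightarrow> real) \<Rightarrow> (nat \<Rightarrow> real) \<Rightarrow> (nat \<Rightarrow> real) \<Rightarrow> (nat \<Rightarrow> real)
   \<Rightarrow> (nat \<Rightarrow> real) \<Rightarrow> (nat \<Rightarrow> real \<Rightarrow> real) \<Rightarrow> (nat \<Rightarrow> real \<Rightarrow> real) \<Rightarrow> bool" where
  "admissible_data l \<delta> g u0 a b r \<beta> u0n gn \<longleftrightarrow>
     (\<forall>n\<ge>1. a n < b n \<and> a (Suc n) < a n \<and> b n < b (Suc n)) \<and>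
     a \<longlonglongrightarrow> 0 \<and> filterlim b at_top sequentially \<and>
     (\<lambda>n. 1 / real n * measure (nu l) {a n<..<b n}) \<longlonglongrightarrow> 0 \<and>
     (\<forall>n\<ge>1. 0 < r n) \<and> r \<longlonglongrightarrow> 0 \<and>
     filterlim (\<lambda>n. r n * real n powr \<delta>) at_top sequentially \<and>
     (\<forall>n\<ge>1. test_function {a n<..<b n} (\<lambda>x. rho l x * gn n x)) \<and>
     (\<forall>n\<ge>1. 0 < \<beta> n \<and> \<beta> n < 1 \<and> (\<forall>x. 0 \<le> u0n n x) \<and> Cc_2_beta (\<beta> n) {a n<..<b n} (u0n n)) \<and>
     (\<forall>p\<in>{\<delta>..3}. Lp_tendsto (nu l) p u0n u0) \<and>
     (\<forall>p\<ge>1. Lp_loc_tendsto lebesgue Omega p (\<lambda>n x. rho l x * gn n x) (\<lambda>x. rho l x * g x)) \<and>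
     (AE x in lebesgue_on Omega. (\<lambda>n. rho l x * gn n x) \<longlonglongrightarrow> rho l x * g x) \<and>
     (\<forall>n\<ge>1. essinf (lebesgue_on {a n<..<b n}) (\<lambda>x. rho l x * gn n x)
              \<ge> min (essinf (lebesgue_on Omega) (\<lambda>x. rho l x * g x)) 0) \<and>
     (\<forall>n\<ge>1. Linf_norm (lebesgue_on Omega) (\<lambda>x. rho l x * gn n x)
              \<le> Linf_norm (lebesgue_on Omega) (\<lambda>x. rho l x * g x)) \<and>
     (\<forall>n\<ge>1. supp (u0n n) \<union> supp (\<lambda>x. rho l x * gn n x) \<subseteq> {a n + r n..b n - r n})"

text \<open>\<open>v\<close> belongs to \<open>C\<^sup>1\<^sup>+\<^sup>\<beta>\<^sup>/\<^sup>2\<^sup>,\<^sup>2\<^sup>+\<^sup>\<beta>([0,T] \<times> [a,b])\<close> with classical derivatives \<open>vt\<close>, \<open>vx\<close>, \<open>vxx\<close>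
  (one-sided on the boundary).\<close>

definition parabolic_C2_beta ::
  "real \<Rightarrow> real \<Rightarrow> real \<Rightarrow> real \<Rightarrow> (real \<times> real \<Rightarrow> real) \<Rightarrow> (real \<times> real \<Rightarrow> real) \<Rightarrow>
   (real \<times> real \<Rightarrow> real) \<Rightarrow> (real \<times> real \<Rightarrow> real) \<Rightarrow> bool" where
  "parabolic_C2_beta \<beta> T a b v vt vx vxx \<longleftrightarrow>
     continuous_on ({0..T} \<times> {a..b}) v \<and> continuous_on ({0..T} \<times> {a..b}) vx \<and>
     holder_norm \<beta> ({0..T} \<times> {a..b}) vt < \<infinity> \<and> holder_norm \<beta> ({0..T} \<times> {a..b}) vxx < \<infinity> \<and>
     (\<forall>t\<in>{0..T}. \<forall>x\<in>{a..b}.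
        ((\<lambda>s. v (s, x)) has_real_derivative vt (t, x)) (at t within {0..T}) \<and>
        ((\<lambda>y. v (t, y)) has_real_derivative vx (t, x)) (at x within {a..b}) \<and>
        ((\<lambda>y. vx (t, y)) has_real_derivative vxx (t, x)) (at x within {a..b}))"

text \<open>The classical solution on \<open>[0,T] \<times> [a,b]\<close>, extended by zero. Its uniqueness is a consequence
  of the defining conditions (comparison principle).\<close>

definition regularized_solution ::
  "real \<Rightarrow> real \<Rightarrow> nat \<Rightarrow> real \<Rightarrow> real \<Rightarrow> real \<Rightarrow> (real \<Rightarrow> real) \<Rightarrow> (real \<Rightarrow> real) \<Rightarrow>
   (real \<times> real \<Rightarrow> real) \<Rightarrow> bool" where
  "regularized_solution l T n a b \<beta> v0 h v \<longleftrightarrow>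
     (\<exists>vt vx vxx. parabolic_C2_beta \<beta> T a b v vt vx vxx \<and>
        (\<forall>t\<in>{0<..<T}. \<forall>x\<in>{a<..<b}.
           vt (t, x) = rho l x * (v (t, x) + 1 / real n) * vxx (t, x)
                     + rho l x * h x * (v (t, x) + 1 / real n))) \<and>
     (\<forall>x\<in>{a..b}. v (0, x) = v0 x) \<and>
     (\<forall>t\<in>{0..T}. v (t, a) = 0 \<and> v (t, b) = 0) \<and>
     (\<forall>t\<in>{0<..<T}. \<forall>x\<in>Omega - {a<..<b}. v (t, x) = 0)"

definition constructed_weak_solution ::
  "real \<Rightarrow> real \<Rightarrow> real \<Rightarrow> (real \<Rightarrow> real) \<Rightarrow> (real \<Rightarrow> real) \<Rightarrow> (real \<times> real \<Rightarrow> real) \<Rightarrow> bool" where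
  "constructed_weak_solution l T \<delta> g u0 u \<longleftrightarrow>
     weak_solution l T g u0 u \<and>
     Lp (lebesgue_on (Q T)) 2 (wdx T u) \<and>
     (\<forall>p\<in>{1..3}. Linf_Lp l T p u) \<and> (l = 0 \<longrightarrow> Linf_Lp l T \<delta> u) \<and>
     (\<exists>a b r \<beta> u0n gn un \<sigma>.
        admissible_data l \<delta> g u0 a b r \<beta> u0n gn \<and>
        (\<forall>n\<ge>1. regularized_solution l T n (a n) (b n) (\<beta> n) (u0n n) (gn n) (un n)) \<and>
        strict_mono \<sigma> \<and> (\<forall>k. 1 \<le> \<sigma> k) \<and>
        (\<forall>k. has_wdx T (un (\<sigma> k)) \<and> has_wdx T (\<lambda>z. (un (\<sigma> k) z)\<^sup>2)) \<and>
        (\<forall>q\<in>{\<delta><..<3}. Lp_loc_tendsto (dt_nu l T) (Q T) q (\<lambda>k. un (\<sigma> k)) u) \<and>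
        (AE z in lebesgue_on (Q T). (\<lambda>k. un (\<sigma> k) z) \<longlonglongrightarrow> u z) \<and>
        weak_L2_tendsto (lebesgue_on (Q T)) (\<lambda>k. wdx T (un (\<sigma> k))) (wdx T u) \<and>
        weak_L2_tendsto (lebesgue_on (Q T))
          (\<lambda>k. wdx T (\<lambda>z. (un (\<sigma> k) z)\<^sup>2)) (wdx T (\<lambda>z. (u z)\<^sup>2)) \<and>
        Lp_loc_tendsto lebesgue (Q T) 2 (\<lambda>k. wdx T (un (\<sigma> k))) (wdx T u) \<and>
        (AE z in lebesgue_on (Q T). (\<lambda>k. wdx T (un (\<sigma> k)) z) \<longlonglongrightarrow> wdx T u z))"

end

theory Submission
  imports Defs
begin

text \<open>
  For \<open>w = u\<^sub>n + 1/n\<close> the equation reads \<open>w\<^sub>t = \<rho> w (w\<^sub>x\<^sub>x + g\<^sub>n)\<close> with \<open>\<bar>\<rho> g\<^sub>n\<bar> < M\<close>. Its scaling in time, combined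
  with a maximum principle, yields \<open>w\<^sub>t \<ge> - (M + 1/t) w\<close> (an estimate of Benilan-Crandall type) without
  any bound on derivatives of \<open>g\<^sub>n\<close>. Hence \<open>w\<close> is almost increasing in \<open>t\<close> and locally uniformly
  semiconvex in \<open>x\<close>. A bound at two points \<open>(s, p)\<close> and \<open>(s, q)\<close> therefore propagates to all earlier
  times and to \<open>[p, q]\<close>, where semiconvexity then bounds \<open>w\<^sub>x\<close>; a quadratic barrier turns this into
  Hoelder continuity of order \<open>1/2\<close> in time. Such points, with bounds uniform up to \<open>t = T\<close>, exist by the
  a.e. convergence of \<open>u\<^sub>n\<close> and the bound of \<open>u\<close> in \<open>L\<^sup>\<infinity>(0,T; L\<^sup>1(d\<nu>))\<close>.
\<close>


section \<open>Comparison by first touching points\<close>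

text \<open>Formally the bound on \<open>w_t\<close> comes from differentiating the equation in
  time, but \<open>w_t\<close> is known to be only Hoelder continuous, so finite rescalings are
  compared instead. For a constant \<open>c\<close>, the function \<open>c * w(c * t, x)\<close>
  solves the same equation with the source multiplied by \<open>c\<close>; the mismatch is of order
  \<open>(1 - c) * M\<close> and is absorbed by letting \<open>c\<close> decrease in time. Since
  \<open>w\<close> then decreases at most linearly in time, Hoelder continuity in time is a question
  of bounding the increase. A second obstacle sits at \<open>t = T\<close>: the equation is given
  for \<open>t < T\<close> only, and bounds on \<open>u\<close> hold for almost every time. Each
  \<open>s < T\<close> therefore borrows a later good time. The index from which the bounds hold
  depends on \<open>s\<close>, but the constants do not, and this lets the limit be continued to
  \<open>t = T\<close>.\<close>

lemma interior_min_second_derivative: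
  fixes f f' :: "real \<Rightarrow> real"
  assumes x: "x \<in> {a<..<b}"
    and f: "\<And>y. y \<in> {a<..<b} \<Longrightarrow> (f has_real_derivative f' y) (at y)"
    and f': "(f' has_real_derivative f'') (at x)"
    and min: "\<And>y. y \<in> {a<..<b} \<Longrightarrow> f x \<le> f y"
  shows "0 \<le> f''"
proof (rule ccontr)
  assume "\<not> 0 \<le> f''"
  have "f' x = 0"
  proof (rule DERIV_local_min[OF f[OF x]])
    show "0 < min (x - a) (b - x)" using x by auto
    show "\<forall>y. \<bar>x - y\<bar> < min (x - a) (b - x) \<longrightarrow> f x \<le> f y" using min by (auto simp: abs_if split: if_splits)
  qed
  from DERIV_neg_dec_right[OF f'] \<open>\<not> 0 \<le> f''\<close> obtain d where d: "0 < d"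
    and dec: "\<And>h. 0 < h \<Longrightarrow> h < d \<Longrightarrow> f' (x + h) < 0" using \<open>f' x = 0\<close> by auto
  define h where "h = min (d / 2) ((b - x) / 2)"
  have h: "0 < h" "h < d" "x + h < b" using x d by (auto simp: h_def min_def field_simps)
  obtain z where z: "x < z" "z < x + h" "f (x + h) - f x = (x + h - x) * f' z"
    using MVT2[of x "x + h" f f'] h f x by auto
  have "f' (x + (z - x)) < 0" using z h by (intro dec) auto
  then have "(x + h - x) * f' z < 0" using z h by (intro mult_pos_neg) auto
  then have "f (x + h) < f x" using z by linarith
  moreover have "f x \<le> f (x + h)" using min[of "x + h"] h x by auto
  ultimately show False by simp
qed

text \<open>If positivity failed, the compact set \<open>D \<le> 0\<close> would have an earliest
  point. Continuity in time gives \<open>D \<ge> 0\<close> on that whole time slice, so the point is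
  a zero and a spatial minimum, hence \<open>Dt \<le> 0\<close> and \<open>Dxx \<ge> 0\<close>. The
  hypothesis \<open>touch\<close> is where each application inserts its equation.\<close>

lemma first_touching_point:
  fixes D Dt Dx Dxx :: "real \<times> real \<Rightarrow> real"
  assumes cont: "continuous_on ({t1..t2} \<times> {a..b}) D"
    and init: "\<And>x. x \<in> {a..b} \<Longrightarrow> 0 < D (t1, x)"
    and lateral: "\<And>t. t \<in> {t1..t2} \<Longrightarrow> 0 < D (t, a)" "\<And>t. t \<in> {t1..t2} \<Longrightarrow> 0 < D (t, b)"
    and Dt: "\<And>t x. t \<in> {t1<..t2} \<Longrightarrow> x \<in> {a<..<b} \<Longrightarrow>
      ((\<lambda>s. D (s, x)) has_real_derivative Dt (t, x)) (at t)"
    and Dx: "\<And>t x. t \<in> {t1<..t2} \<Longrightarrow> x \<in> {a<..<b} \<Longrightarrow>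
      ((\<lambda>y. D (t, y)) has_real_derivative Dx (t, x)) (at x)"
    and Dxx: "\<And>t x. t \<in> {t1<..t2} \<Longrightarrow> x \<in> {a<..<b} \<Longrightarrow>
      ((\<lambda>y. Dx (t, y)) has_real_derivative Dxx (t, x)) (at x)"
    and touch: "\<And>t x. t \<in> {t1<..t2} \<Longrightarrow> x \<in> {a<..<b} \<Longrightarrow> D (t, x) = 0 \<Longrightarrow>
      Dt (t, x) \<le> 0 \<Longrightarrow> 0 \<le> Dxx (t, x) \<Longrightarrow> False"
    and tx: "t \<in> {t1..t2}" "x \<in> {a..b}"
  shows "0 < D (t, x)"
proof (rule ccontr)
  assume neg: "\<not> 0 < D (t, x)"
  define S where "S = {z \<in> {t1..t2} \<times> {a..b}. D z \<le> 0}"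
  have "closed S" unfolding S_def
    by (intro continuous_closed_preimage_constant continuous_on_closed_Collect_le cont continuous_on_const
        closed_Times closed_atLeastAtMost)
  moreover have "S \<subseteq> {t1..t2} \<times> {a..b}" by (auto simp: S_def)
  ultimately have "compact S"
    by (metis compact_Icc compact_Int_closed compact_Times inf.absorb2)
  moreover have "(t, x) \<in> S" using neg tx by (auto simp: S_def)
  ultimately obtain z where z: "z \<in> S" and zmin: "\<And>y. y \<in> S \<Longrightarrow> fst z \<le> fst y"
    using continuous_attains_inf[of S fst] continuous_on_fst[OF continuous_on_id] by (metis empty_iff)
  obtain s y where [simp]: "z = (s, y)" by fastforce
  have sy: "s \<in> {t1..t2}" "y \<in> {a..b}" "D (s, y) \<le> 0" using z by (auto simp: S_def)
  have "s \<noteq> t1" using init[of y] sy by auto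
  then have s: "s \<in> {t1<..t2}" using sy by auto
  have "y \<noteq> a" "y \<noteq> b" using lateral sy by fastforce+
  then have y: "y \<in> {a<..<b}" using sy by auto
  have before: "0 < D (s', y')" if "s' \<in> {t1..<s}" "y' \<in> {a..b}" for s' y'
    using zmin[of "(s', y')"] that sy by (force simp: S_def)
  have at_s: "0 \<le> D (s, y')" if y': "y' \<in> {a..b}" for y'
  proof -
    have "continuous_on {t1..s} (\<lambda>r. D (r, y'))"
      by (rule continuous_on_compose2[OF cont]) (use y' sy in \<open>auto intro!: continuous_intros\<close>)
    then have "continuous_on (closure {t1..<s}) (\<lambda>r. D (r, y'))"
      using s by (simp add: closure_atLeastLessThan)
    then show ?thesis
      by (rule continuous_ge_on_closure) (use s y' before in \<open>force simp: closure_atLeastLessThan\<close>)+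
  qed
  have zero: "D (s, y) = 0" using at_s[of y] sy by auto
  show False
  proof (rule touch[OF s y zero])
    show "Dt (s, y) \<le> 0"
    proof (rule ccontr)
      assume "\<not> Dt (s, y) \<le> 0"
      then obtain d where d: "0 < d" "\<And>h. 0 < h \<Longrightarrow> h < d \<Longrightarrow> D (s - h, y) < D (s, y)"
        using DERIV_pos_inc_left[OF Dt[OF s y]] by auto
      \<comment> \<open>Capping by \<open>s - t1\<close> keeps \<open>s - h\<close> in the range
        where \<open>before\<close> applies.\<close>
      define h where "h = min (d / 2) (s - t1)"
      have h: "0 < h" "h < d" "t1 \<le> s - h" using d s by (auto simp: h_def)
      then have "0 < D (s - h, y)" using before[of "s - h" y] y by auto
      then show False using d(2)[of h] h zero by simp
    qed
    show "0 \<le> Dxx (s, y)"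
      by (rule interior_min_second_derivative[OF y Dx[OF s] Dxx[OF s y]])
        (use zero at_s y in auto)
  qed
qed


section \<open>One-sided estimates for the regularized equation\<close>

lemma rho_pos: "0 \<le> l \<Longrightarrow> 0 < x \<Longrightarrow> 0 < rho l x"
  unfolding rho_def by (intro mult_pos_pos) auto

lemma rho_mono: "0 \<le> l \<Longrightarrow> 0 < x \<Longrightarrow> x \<le> y \<Longrightarrow> rho l x \<le> rho l y"
  unfolding rho_def by (intro mult_mono mult_nonneg_nonneg) auto

text \<open>Here \<open>w\<close> stands for \<open>u_n + 1/n\<close> and \<open>eps\<close> for
  \<open>1/n\<close>. Derivatives and equation are given in the open parabolic interior, so the
  estimates below stay at times before \<open>T\<close>. The bound on \<open>rho l x * h x\<close>
  is strict so that touching arguments end in a strict inequality.\<close>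

locale positive_classical_solution =
  fixes l M T eps a b :: real and h :: "real \<Rightarrow> real" and w wt wx wxx :: "real \<times> real \<Rightarrow> real"
  assumes l: "0 \<le> l" and M: "0 < M" and eps: "0 < eps" and a: "0 < a"
    and h: "\<And>x. x \<in> {a<..<b} \<Longrightarrow> \<bar>rho l x * h x\<bar> < M"
    and cont: "continuous_on ({0..T} \<times> {a..b}) w"
    and wt: "\<And>t x. t \<in> {0<..<T} \<Longrightarrow> x \<in> {a<..<b} \<Longrightarrow>
      ((\<lambda>s. w (s, x)) has_real_derivative wt (t, x)) (at t)"
    and wx: "\<And>t x. t \<in> {0<..<T} \<Longrightarrow> x \<in> {a<..<b} \<Longrightarrow>
      ((\<lambda>y. w (t, y)) has_real_derivative wx (t, x)) (at x)"
    and wxx: "\<And>t x. t \<in> {0<..<T} \<Longrightarrow> x \<in> {a<..<b} \<Longrightarrow>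
      ((\<lambda>y. wx (t, y)) has_real_derivative wxx (t, x)) (at x)"
    and pde: "\<And>t x. t \<in> {0<..<T} \<Longrightarrow> x \<in> {a<..<b} \<Longrightarrow>
      wt (t, x) = rho l x * w (t, x) * wxx (t, x) + rho l x * h x * w (t, x)"
    and init: "\<And>x. x \<in> {a..b} \<Longrightarrow> eps \<le> w (0, x)"
    and lateral: "\<And>t. t \<in> {0..T} \<Longrightarrow> w (t, a) = eps" "\<And>t. t \<in> {0..T} \<Longrightarrow> w (t, b) = eps"
begin

text \<open>The spatially constant barrier \<open>z t = eps / 2 * exp (- M * t)\<close> lies
  strictly below \<open>w\<close> initially and laterally. At a first contact
  \<open>wxx \<ge> 0\<close>, so the equation forces \<open>wt > - M * z\<close>, against
  \<open>wt \<le> - M * z\<close>.\<close>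

lemma pos:
  assumes "t \<in> {0..<T}" "x \<in> {a..b}"
  shows "0 < w (t, x)"
proof -
  define z where "z t = eps / 2 * exp (- M * t)" for t
  have z: "0 < z t" for t using eps by (simp add: z_def)
  have z_less: "z t < eps" if "0 \<le> t" for t
  proof -
    have "exp (- M * t) \<le> 1" using M that by simp
    then have "z t \<le> eps / 2 * 1" unfolding z_def using eps by (intro mult_left_mono) auto
    then show ?thesis using eps by simp
  qed
  have "0 < (case (t, x) of (t, x) \<Rightarrow> w (t, x) - z t)"
  proof (rule first_touching_point[where ?t1.0=0 and ?t2.0=t and a=a and b=b
        and Dt="\<lambda>(t, x). wt (t, x) + M * z t" and Dx=wx and Dxx=wxx])
    show "continuous_on ({0..t} \<times> {a..b}) (\<lambda>(t, x). w (t, x) - z t)"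
      unfolding z_def case_prod_beta prod.collapse
      by (intro continuous_intros continuous_on_subset[OF cont]) (use assms in auto)
    fix s y assume sy: "s \<in> {0<..t}" "y \<in> {a<..<b}"
    then have s: "s \<in> {0<..<T}" using assms by auto
    show "((\<lambda>s. case (s, y) of (t, x) \<Rightarrow> w (t, x) - z t) has_real_derivative
        (case (s, y) of (t, x) \<Rightarrow> wt (t, x) + M * z t)) (at s)"
      unfolding z_def by (auto intro!: derivative_eq_intros wt[OF s sy(2)])
    show "((\<lambda>y. case (s, y) of (t, x) \<Rightarrow> w (t, x) - z t) has_real_derivative wx (s, y)) (at y)"
      by (auto intro!: derivative_eq_intros wx[OF s sy(2)])
    show "((\<lambda>y. wx (s, y)) has_real_derivative wxx (s, y)) (at y)"
      by (rule wxx[OF s sy(2)])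
    assume 0: "(case (s, y) of (t, x) \<Rightarrow> w (t, x) - z t) = 0"
      and 1: "(case (s, y) of (t, x) \<Rightarrow> wt (t, x) + M * z t) \<le> 0" and 2: "0 \<le> wxx (s, y)"
    have w: "w (s, y) = z s" using 0 by simp
    have "0 \<le> rho l y * w (s, y) * wxx (s, y)"
      using 2 z[of s] w rho_pos[OF l, of y] sy a by simp
    moreover have "- M * z s < rho l y * h y * z s"
      using h[OF sy(2)] z[of s] by (intro mult_strict_right_mono) auto
    ultimately show False using 1 pde[OF s sy(2)] w by simp
  next
    show "0 < (case (0, x) of (t, x) \<Rightarrow> w (t, x) - z t)" if "x \<in> {a..b}" for x
      using init[OF that] z_less[of 0] by simp
    show "0 < (case (s, a) of (t, x) \<Rightarrow> w (t, x) - z t)" "0 < (case (s, b) of (t, x) \<Rightarrow> w (t, x) - z t)"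
      if "s \<in> {0..t}" for s
      using lateral[of s] that z_less[of s] assms by auto
  qed (use assms in auto)
  then show ?thesis using z[of t] by simp
qed

text \<open>\<open>(t, x) \<mapsto> \<lambda>(t) w(\<tau>(t), x)\<close> with \<open>\<tau>' = \<lambda> < 1\<close> is a strict subsolution; dividing by
  \<open>\<eta> \<rightarrow> 0\<close> yields the one-sided bound on \<open>w\<^sub>t\<close> without differentiating the equation.\<close>

lemma time_scaling_comparison:
  fixes \<eta> :: real
  defines "lam \<equiv> (\<lambda>t. 1 - \<eta> * exp (M * t))"
    and "tau \<equiv> (\<lambda>t. t - \<eta> * ((exp (M * t) - 1) / M))"
  assumes \<eta>: "0 < \<eta>" "\<eta> * exp (M * T) < 1"
    and tx: "t \<in> {0..<T}" "x \<in> {a..b}"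
  shows "lam t * w (tau t, x) < w (t, x)"
proof -
  \<comment> \<open>\<open>lam\<close> solves \<open>lam' = - M * (1 - lam)\<close>: its decay is
    tuned to the mismatch \<open>1 - lam\<close> of the source terms. The smallness of
    \<open>\<eta>\<close> keeps it positive up to \<open>T\<close>, which makes \<open>tau\<close>
    increasing.\<close>
  have lam: "0 < lam s" "lam s < 1" if "s \<in> {0..<T}" for s
  proof -
    have "\<eta> * exp (M * s) \<le> \<eta> * exp (M * T)" using \<eta> M that by (intro mult_left_mono) auto
    then show "0 < lam s" using \<eta>(2) unfolding lam_def by linarith
    show "lam s < 1" using \<eta> by (simp add: lam_def)
  qed
  have tau': "(tau has_real_derivative lam s) (at s)" for s
    unfolding tau_def lam_def using M by (auto intro!: derivative_eq_intros)
  have tau_le: "tau s \<le> s" if "0 \<le> s" for s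
    using \<eta> M that by (simp add: tau_def)
  have tau_pos: "0 < tau s" if s: "s \<in> {0<..<T}" for s
  proof -
    have "tau 0 < tau s"
      by (rule DERIV_pos_imp_increasing_open) (use s tau' lam in \<open>auto intro!: exI continuous_at_imp_continuous_on intro: DERIV_isCont[OF tau']\<close>)
    then show ?thesis by (simp add: tau_def)
  qed
  have tau0: "tau 0 = 0" by (simp add: tau_def)
  have tau_range: "tau s \<in> {0..<T}" if "s \<in> {0..<T}" for s
    using tau_pos[of s] tau_le[of s] tau0 that by (cases "s = 0") auto
  have "0 < (case (t, x) of (t, x) \<Rightarrow> w (t, x) - lam t * w (tau t, x))"
  proof (rule first_touching_point[where ?t1.0=0 and ?t2.0=t and a=a and b=b
        and Dt="\<lambda>(t, x). wt (t, x) - (- M * (\<eta> * exp (M * t)) * w (tau t, x) + lam t * (lam t * wt (tau t, x)))"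
        and Dx="\<lambda>(t, x). wx (t, x) - lam t * wx (tau t, x)"
        and Dxx="\<lambda>(t, x). wxx (t, x) - lam t * wxx (tau t, x)"])
    have "continuous_on {0..t} tau" by (intro continuous_at_imp_continuous_on ballI DERIV_isCont[OF tau'])
    then have "continuous_on ({0..t} \<times> {a..b}) (\<lambda>z. tau (fst z))"
      by (rule continuous_on_compose2) (auto intro!: continuous_intros)
    then have "continuous_on ({0..t} \<times> {a..b}) (\<lambda>z. w (tau (fst z), snd z))"
      by (intro continuous_on_compose2[OF cont] continuous_intros)
        (use tau_range tx in \<open>force simp: less_imp_le\<close>)+
    then show "continuous_on ({0..t} \<times> {a..b}) (\<lambda>(t, x). w (t, x) - lam t * w (tau t, x))"
      unfolding lam_def case_prod_beta prod.collapse
      by (intro continuous_intros continuous_on_subset[OF cont]) (use tx in auto)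
    fix s y assume sy: "s \<in> {0<..t}" "y \<in> {a<..<b}"
    then have s: "s \<in> {0<..<T}" using tx by auto
    then have ts: "tau s \<in> {0<..<T}" using tau_pos[of s] tau_le[of s] by auto
    have wtau: "((\<lambda>s. w (tau s, y)) has_real_derivative wt (tau s, y) * lam s) (at s)"
      using DERIV_chain[OF wt[OF ts sy(2)] tau'] by (simp add: o_def)
    have lam': "(lam has_real_derivative - M * (\<eta> * exp (M * s))) (at s)"
      unfolding lam_def by (auto intro!: derivative_eq_intros)
    show "((\<lambda>s. case (s, y) of (t, x) \<Rightarrow> w (t, x) - lam t * w (tau t, x)) has_real_derivative
        (case (s, y) of (t, x) \<Rightarrow> wt (t, x) -
          (- M * (\<eta> * exp (M * t)) * w (tau t, x) + lam t * (lam t * wt (tau t, x))))) (at s)"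
      by (auto intro!: derivative_eq_intros wt[OF s sy(2)] wtau lam' simp: algebra_simps)
    show "((\<lambda>y. case (s, y) of (t, x) \<Rightarrow> w (t, x) - lam t * w (tau t, x)) has_real_derivative
        (case (s, y) of (t, x) \<Rightarrow> wx (t, x) - lam t * wx (tau t, x))) (at y)"
      by (auto intro!: derivative_eq_intros wx[OF s sy(2)] wx[OF ts sy(2)])
    show "((\<lambda>y. case (s, y) of (t, x) \<Rightarrow> wx (t, x) - lam t * wx (tau t, x)) has_real_derivative
        (case (s, y) of (t, x) \<Rightarrow> wxx (t, x) - lam t * wxx (tau t, x))) (at y)"
      by (auto intro!: derivative_eq_intros wxx[OF s sy(2)] wxx[OF ts sy(2)])
    assume 0: "(case (s, y) of (t, x) \<Rightarrow> w (t, x) - lam t * w (tau t, x)) = 0"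
      and 1: "(case (s, y) of (t, x) \<Rightarrow> wt (t, x) -
          (- M * (\<eta> * exp (M * t)) * w (tau t, x) + lam t * (lam t * wt (tau t, x)))) \<le> 0"
      and 2: "0 \<le> (case (s, y) of (t, x) \<Rightarrow> wxx (t, x) - lam t * wxx (tau t, x))"
    define e where "e = \<eta> * exp (M * s)"
    define R where "R = rho l y"
    define W where "W = w (tau s, y)"
    have e: "0 < e" "lam s = 1 - e" using \<eta> by (auto simp: e_def lam_def)
    have R: "0 < R" using rho_pos[OF l, of y] sy a by (auto simp: R_def)
    have W: "0 < W" using pos[of "tau s" y] ts sy by (auto simp: W_def)
    have wW: "w (s, y) = lam s * W" using 0 by (simp add: W_def)
    \<comment> \<open>The source enters \<open>wt\<close> with factor \<open>lam\<close> and the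
      scaled term with factor \<open>lam * lam\<close>. The difference, with
      \<open>e = 1 - lam\<close>, exceeds \<open>- M * (lam * W * e)\<close> and is outweighed by
      the \<open>M * W * e\<close> coming from the derivative of \<open>lam\<close>.\<close>
    have "0 \<le> R * (lam s * W) * (wxx (s, y) - lam s * wxx (tau s, y))"
      using R W lam[of s] s 2 by (intro mult_nonneg_nonneg) auto
    moreover have "- M * (lam s * W * e) < R * h y * (lam s * W * e)"
      using h[OF sy(2)] lam[of s] s e W unfolding R_def by (intro mult_strict_right_mono) auto
    moreover have "M * (lam s * W * e) \<le> M * (1 * W * e)"
      using M lam[of s] s e W by (intro mult_left_mono mult_right_mono) auto
    moreover have "wt (s, y) - (- M * e * W + lam s * (lam s * wt (tau s, y))) =
        R * (lam s * W) * (wxx (s, y) - lam s * wxx (tau s, y)) + R * h y * (lam s * W * e) + M * (1 * W * e)"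
      unfolding pde[OF s sy(2)] pde[OF ts sy(2)] wW W_def[symmetric] R_def[symmetric] e(2)
      by (simp add: algebra_simps)
    ultimately show False using 1 unfolding prod.case e_def[symmetric] W_def[symmetric] by linarith
  next
    \<comment> \<open>Since \<open>tau 0 = 0\<close>, and since \<open>w\<close> equals
      \<open>eps\<close> laterally at both times, strictness on the parabolic boundary comes from
      \<open>lam < 1\<close> and positivity.\<close>
    show "0 < (case (0, x) of (t, x) \<Rightarrow> w (t, x) - lam t * w (tau t, x))" if "x \<in> {a..b}" for x
      using pos[of 0 x] that tx lam[of 0] tau0 by simp
    show "0 < (case (s, a) of (t, x) \<Rightarrow> w (t, x) - lam t * w (tau t, x))"
      "0 < (case (s, b) of (t, x) \<Rightarrow> w (t, x) - lam t * w (tau t, x))"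
      if "s \<in> {0..t}" for s
      using lateral[of s] lateral[of "tau s"] that tx lam[of s] tau_range[of s] eps by auto
  qed (use tx in auto)
  then show ?thesis by simp
qed

text \<open>The difference \<open>f\<close> in the scaling comparison vanishes at
  \<open>\<eta> = 0\<close> and is positive for small \<open>\<eta> > 0\<close>, so its derivative
  \<open>E * w + G * wt\<close> at 0 is nonnegative. Then \<open>E / G = M + 1 / G\<close> and
  \<open>G \<ge> t\<close>, a consequence of \<open>exp (M * t) \<ge> 1 + M * t\<close>, give the
  constant.\<close>

lemma time_derivative_ge:
  assumes t: "t \<in> {0<..<T}" and x: "x \<in> {a<..<b}"
  shows "- (M + 1 / t) * w (t, x) \<le> wt (t, x)"
proof -
  define E where "E = exp (M * t)"
  define G where "G = (E - 1) / M"
  have "1 + M * t \<le> E" unfolding E_def by (rule exp_ge_add_one_self)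
  then have G: "t \<le> G" using M by (simp add: G_def field_simps)
  define f where "f \<eta> = w (t, x) - (1 - \<eta> * E) * w (t - \<eta> * G, x)" for \<eta>
  have "((\<lambda>\<eta>. w (t - \<eta> * G, x)) has_real_derivative wt (t, x) * (- G)) (at 0)"
    by (rule DERIV_chain2[where g="\<lambda>\<eta>. t - \<eta> * G"]) (use wt[OF t x] in \<open>auto intro!: derivative_eq_intros\<close>)
  then have f': "(f has_real_derivative E * w (t, x) + G * wt (t, x)) (at 0)"
    unfolding f_def by (auto intro!: derivative_eq_intros)
  have "0 \<le> E * w (t, x) + G * wt (t, x)"
  proof (rule ccontr)
    assume "\<not> ?thesis"
    then obtain d where d: "0 < d" "\<And>\<eta>. 0 < \<eta> \<Longrightarrow> \<eta> < d \<Longrightarrow> f (0 + \<eta>) < f 0"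
      using DERIV_neg_dec_right[OF f'] by auto
    \<comment> \<open>The cap by \<open>exp (- M * T) / 2\<close> enforces the smallness condition
      of the comparison.\<close>
    define \<eta> where "\<eta> = min (d / 2) (exp (- M * T) / 2)"
    have \<eta>: "0 < \<eta>" "\<eta> < d" "\<eta> < exp (- M * T)" using d by (auto simp: \<eta>_def min_def)
    have "\<eta> * exp (M * T) < exp (- M * T) * exp (M * T)" using \<eta> by (intro mult_strict_right_mono) auto
    also have "\<dots> = 1" by (simp add: mult_exp_exp)
    finally have "0 < f \<eta>"
      using time_scaling_comparison[of \<eta> t x] \<eta> t x by (simp add: f_def E_def G_def)
    then show False using d(2)[of \<eta>] \<eta> by (simp add: f_def)
  qed
  then have "0 \<le> (E * w (t, x) + G * wt (t, x)) / G" using G t by auto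
  also have "\<dots> = E / G * w (t, x) + wt (t, x)" using G t by (simp add: field_simps)
  also have "E / G = M + 1 / G"
  proof -
    have "E = M * G + 1" using M by (simp add: G_def)
    then show ?thesis using G t by (simp add: field_simps)
  qed
  also have "(M + 1 / G) * w (t, x) \<le> (M + 1 / t) * w (t, x)"
    using G t x pos[of t x] by (intro mult_right_mono add_left_mono divide_left_mono) auto
  finally show ?thesis by (simp add: algebra_simps)
qed

text \<open>Dividing the equation by \<open>w > 0\<close> turns the bound on \<open>wt\<close> into
  one on \<open>rho l x * wxx\<close> that is independent of the size of \<open>w\<close>; the
  source term accounts for the second \<open>M\<close>.\<close>

lemma semiconvex:
  assumes t: "t \<in> {0<..<T}" and x: "x \<in> {a<..<b}"
  shows "- (2 * M + 1 / t) \<le> rho l x * wxx (t, x)"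
proof -
  have w: "0 < w (t, x)" using pos[of t x] t x by auto
  have "- (M + 1 / t) * w (t, x) \<le> (rho l x * wxx (t, x) + rho l x * h x) * w (t, x)"
    using time_derivative_ge[OF t x] pde[OF t x] by (simp add: algebra_simps)
  then have "- (M + 1 / t) \<le> rho l x * wxx (t, x) + rho l x * h x" using w by (simp only: mult_le_cancel_right_pos)
  then show ?thesis using h[OF x] by linarith
qed

text \<open>By the bound on \<open>wt\<close>, \<open>exp ((M + 1 / t0) * r) * w (r, x)\<close> is
  nondecreasing in \<open>r \<ge> t0\<close>. Read backwards, a bound at time \<open>s\<close>
  controls all earlier times down to \<open>t0\<close>.\<close>

lemma almost_monotone:
  assumes "0 < t0" "t0 \<le> t" "t \<le> s" "s < T" and x: "x \<in> {a<..<b}"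
  shows "w (t, x) \<le> exp ((M + 1 / t0) * (s - t)) * w (s, x)"
proof -
  define K where "K = M + 1 / t0"
  have "exp (K * t) * w (t, x) \<le> exp (K * s) * w (s, x)"
  proof (rule DERIV_nonneg_imp_nondecreasing[of t s "\<lambda>r. exp (K * r) * w (r, x)"])
    fix r assume r: "t \<le> r" "r \<le> s"
    then have r': "r \<in> {0<..<T}" using assms by auto
    have "((\<lambda>r. exp (K * r) * w (r, x)) has_real_derivative exp (K * r) * (K * w (r, x) + wt (r, x))) (at r)"
      by (auto intro!: derivative_eq_intros wt[OF r' x] simp: algebra_simps)
    moreover have "(M + 1 / r) * w (r, x) \<le> K * w (r, x)"
      unfolding K_def using assms r r' x pos[of r x]
      by (intro mult_right_mono add_left_mono divide_left_mono) auto
    then have "0 \<le> exp (K * r) * (K * w (r, x) + wt (r, x))"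
      using time_derivative_ge[OF r' x] by (intro mult_nonneg_nonneg exp_ge_zero) linarith
    ultimately show "\<exists>d. ((\<lambda>r. exp (K * r) * w (r, x)) has_real_derivative d) (at r) \<and> 0 \<le> d"
      by blast
  qed (use assms in auto)
  then have "exp (- (K * t)) * (exp (K * t) * w (t, x)) \<le> exp (- (K * t)) * (exp (K * s) * w (s, x))"
    by (intro mult_left_mono) auto
  moreover have "exp (- (K * t)) * exp (K * t) = 1" "exp (- (K * t)) * exp (K * s) = exp (K * (s - t))"
    by (simp_all add: mult_exp_exp algebra_simps)
  ultimately show ?thesis unfolding K_def[symmetric] mult.assoc[symmetric] by simp
qed

end

section \<open>Bounds in space from semiconvexity, and a barrier for the growth in time\<close>

context positive_classical_solution
begin

text \<open>\<open>C\<close> is the semiconvexity constant at its worst: \<open>rho l\<close>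
  increases in \<open>x\<close>, so the smallest weight on \<open>[p, q]\<close> sits at
  \<open>p\<close>, and \<open>1 / t\<close> is largest at \<open>t0\<close>.\<close>

lemma convex_perturbation:
  fixes p q t0 t :: real
  defines "C \<equiv> (2 * M + 1 / t0) / rho l p"
  assumes t: "0 < t0" "t0 \<le> t" "t < T" and pq: "a < p" "q < b"
  shows "convex_on {p..q} (\<lambda>x. w (t, x) + C / 2 * x\<^sup>2)"
    and "x \<in> {p..q} \<Longrightarrow> ((\<lambda>x. w (t, x) + C / 2 * x\<^sup>2) has_real_derivative wx (t, x) + C * x) (at x)"
proof -
  have t': "t \<in> {0<..<T}" using t by auto
  have x': "x \<in> {a<..<b}" if "x \<in> {p..q}" for x using that pq by auto
  show *: "((\<lambda>x. w (t, x) + C / 2 * x\<^sup>2) has_real_derivative wx (t, x) + C * x) (at x)" if "x \<in> {p..q}" for x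
    by (auto intro!: derivative_eq_intros wx[OF t' x'[OF that]])
  show "convex_on {p..q} (\<lambda>x. w (t, x) + C / 2 * x\<^sup>2)"
  proof (rule f''_ge0_imp_convex[OF _ *])
    fix x assume x: "x \<in> {p..q}"
    show "((\<lambda>x. wx (t, x) + C * x) has_real_derivative wxx (t, x) + C) (at x)"
      by (auto intro!: derivative_eq_intros wxx[OF t' x'[OF x]])
    have rho: "0 < rho l p" "rho l p \<le> rho l x" using rho_pos[OF l] rho_mono[OF l] x pq a by auto
    have "- (2 * M + 1 / t0) \<le> - (2 * M + 1 / t)" using t by (simp add: field_simps)
    also have "\<dots> \<le> rho l x * wxx (t, x)" by (rule semiconvex[OF t' x'[OF x]])
    finally have "- (2 * M + 1 / t0) / rho l x \<le> wxx (t, x)"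
      using rho by (simp add: pos_divide_le_eq mult.commute)
    moreover have "(2 * M + 1 / t0) / rho l x \<le> C"
      unfolding C_def using rho M t by (intro divide_left_mono) auto
    ultimately show "0 \<le> wxx (t, x) + C" by (simp add: minus_divide_left[symmetric] del: minus_add_distrib)
  qed auto
qed

text \<open>A convex function is bounded by its end values, and undoing the quadratic perturbation
  costs a multiple of \<open>q\<^sup>2\<close>; two values thus control the whole interval.\<close>

lemma upper_bound_from_endpoints:
  assumes t: "0 < t0" "t0 \<le> t" "t < T" and pq: "a < p" "q < b"
    and x: "x \<in> {p..q}" and B: "w (t, p) \<le> B" "w (t, q) \<le> B"
  shows "w (t, x) \<le> B + (2 * M + 1 / t0) / rho l p * q\<^sup>2"
proof -
  define C where "C = (2 * M + 1 / t0) / rho l p"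
  have C: "0 \<le> C" unfolding C_def using M t rho_pos[OF l, of p] a pq by auto
  let ?F = "\<lambda>x. w (t, x) + C / 2 * x\<^sup>2"
  have "p\<^sup>2 \<le> q\<^sup>2" using x pq a by (intro power_mono) auto
  then have "C / 2 * p\<^sup>2 \<le> C / 2 * q\<^sup>2" using C by (intro mult_left_mono) auto
  moreover have "?F x \<le> max (?F p) (?F q)"
    by (rule convex_on_le_max[OF convex_perturbation(1)[OF t pq, folded C_def] x])
  then have "?F x \<le> ?F p \<or> ?F x \<le> ?F q" by (simp only: le_max_iff_disj)
  moreover have "0 \<le> C / 2 * x\<^sup>2" "0 \<le> C / 2 * q\<^sup>2" using C by auto
  moreover have "C / 2 * q\<^sup>2 + C / 2 * q\<^sup>2 = C * q\<^sup>2" by simp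
  ultimately show ?thesis using B unfolding C_def[symmetric] by linarith
qed

text \<open>The tangent at \<open>x\<close> of the perturbed convex function lies below the graph at
  \<open>p\<close> and at \<open>q\<close>. Since \<open>w > 0\<close> bounds that function below at
  \<open>x\<close> and \<open>B\<close> bounds it above at the ends, each at distance at least
  \<open>d\<close>, the slope is bounded on both sides.\<close>

lemma gradient_bound:
  assumes t: "0 < t0" "t0 \<le> t" "t < T" and pq: "a < p" "q < b" and d: "0 < d"
    and x: "p + d \<le> x" "x \<le> q - d" and B: "w (t, p) \<le> B" "w (t, q) \<le> B"
  defines "C \<equiv> (2 * M + 1 / t0) / rho l p"
  shows "\<bar>wx (t, x)\<bar> \<le> (B + C * q\<^sup>2) / d + C * q"
proof -
  have C: "0 \<le> C" unfolding C_def using M t rho_pos[OF l, of p] a pq by auto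
  let ?F = "\<lambda>x. w (t, x) + C / 2 * x\<^sup>2"
  have tangent: "(wx (t, x) + C * x) * (y - x) \<le> B + C * q\<^sup>2" if y: "y \<in> {p, q}" for y
  proof -
    have "(wx (t, x) + C * x) * (y - x) \<le> ?F y - ?F x"
    proof (rule convex_on_imp_above_tangent[OF convex_perturbation(1)[OF t pq, folded C_def]])
      show "(?F has_real_derivative wx (t, x) + C * x) (at x within {p..q})"
        by (rule has_field_derivative_at_within, rule convex_perturbation(2)[OF t pq, folded C_def]) (use x d in auto)
      show "x \<in> interior {p..q}" using x d by simp
    qed (use y x d in auto)
    moreover have "0 < w (t, x)" using pos[of t x] x pq d t by auto
    moreover have "y\<^sup>2 \<le> q\<^sup>2" using x pq a y d by (intro power_mono) auto
    then have "C / 2 * y\<^sup>2 \<le> C / 2 * q\<^sup>2" using C by (intro mult_left_mono) auto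
    moreover have "0 \<le> C / 2 * x\<^sup>2" "0 \<le> C / 2 * q\<^sup>2" using C by auto
    moreover have "w (t, y) \<le> B" using B y by auto
    moreover have "C / 2 * q\<^sup>2 + C / 2 * q\<^sup>2 = C * q\<^sup>2" by simp
    ultimately show ?thesis by linarith
  qed
  \<comment> \<open>A nonnegative slope is tested at \<open>q\<close>, a negative one at
    \<open>p\<close>.\<close>
  have "\<bar>wx (t, x) + C * x\<bar> * d \<le> B + C * q\<^sup>2"
  proof (cases "0 \<le> wx (t, x) + C * x")
    case True
    then have "(wx (t, x) + C * x) * d \<le> (wx (t, x) + C * x) * (q - x)"
      using x by (intro mult_left_mono) auto
    then show ?thesis using tangent[of q] True by simp
  next
    case False
    then have "- (wx (t, x) + C * x) * d \<le> - (wx (t, x) + C * x) * (x - p)"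
      using x by (intro mult_left_mono) auto
    then show ?thesis using tangent[of p] False by (simp add: algebra_simps abs_if)
  qed
  then have "\<bar>wx (t, x) + C * x\<bar> \<le> (B + C * q\<^sup>2) / d" using d by (simp add: pos_le_divide_eq)
  moreover have "0 \<le> C * x" "C * x \<le> C * q" using C x d pq a by (auto intro!: mult_left_mono)
  ultimately show ?thesis by linarith
qed

text \<open>Comparison with the quadratic barrier \<open>w(t\<^sub>1, x\<^sub>0) + \<eta> + N (x - x\<^sub>0)\<^sup>2 + rate (t - t\<^sub>1)\<close>.\<close>

lemma increase_in_time:
  assumes t: "0 < t1" "t1 \<le> t2" "t2 < T" and R: "0 < R" "a < x0 - R" "x0 + R < b" and \<eta>: "0 < \<eta>"
    and B: "\<And>t x. t \<in> {t1..t2} \<Longrightarrow> x \<in> {x0 - R..x0 + R} \<Longrightarrow> w (t, x) \<le> B"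
    and L: "\<And>x. x \<in> {x0 - R..x0 + R} \<Longrightarrow> \<bar>w (t1, x) - w (t1, x0)\<bar> \<le> L * \<bar>x - x0\<bar>"
  defines "rate \<equiv> B * (2 * rho l (x0 + R) * (L\<^sup>2 / \<eta> + B / R\<^sup>2) + M) + 1"
  shows "w (t2, x0) \<le> w (t1, x0) + \<eta> + rate * (t2 - t1)"
proof -
  \<comment> \<open>\<open>L\<^sup>2 / \<eta>\<close> lets the barrier dominate the Lipschitz
    profile at time \<open>t1\<close>, and \<open>B / R\<^sup>2\<close> lifts it above
    \<open>B\<close> at distance \<open>R\<close>. At a contact point
    \<open>wxx \<le> 2 * N\<close>, so the equation bounds \<open>wt\<close> by
    \<open>rate - 1\<close>; the summand 1 gives the contradiction.\<close>
  define N where "N = L\<^sup>2 / \<eta> + B / R\<^sup>2"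
  have wpos: "0 < w (t, x)" if "t \<in> {t1..t2}" "x \<in> {x0 - R..x0 + R}" for t x
    using pos[of t x] that t R by auto
  have B0: "0 < B" using wpos[of t1 x0] B[of t1 x0] t R by auto
  have N0: "0 \<le> N" unfolding N_def using B0 \<eta> by auto
  have rate0: "0 < rate"
  proof -
    have "0 < rho l (x0 + R)" using rho_pos[OF l, of "x0 + R"] R a by auto
    then have "0 \<le> B * (2 * rho l (x0 + R) * N + M)"
      using B0 N0 M by (intro mult_nonneg_nonneg add_nonneg_nonneg) auto
    then show ?thesis unfolding rate_def N_def by linarith
  qed
  let ?D = "\<lambda>(t, x). w (t1, x0) + \<eta> + N * (x - x0)\<^sup>2 + rate * (t - t1) - w (t, x)"
  have "0 < ?D (t2, x0)"
  proof (rule first_touching_point[where ?t1.0=t1 and ?t2.0=t2 and a="x0 - R" and b="x0 + R"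
        and Dt="\<lambda>(t, x). rate - wt (t, x)" and Dx="\<lambda>(t, x). 2 * N * (x - x0) - wx (t, x)"
        and Dxx="\<lambda>(t, x). 2 * N - wxx (t, x)"])
    show "continuous_on ({t1..t2} \<times> {x0 - R..x0 + R}) ?D"
      unfolding case_prod_beta prod.collapse
      by (intro continuous_intros continuous_on_subset[OF cont]) (use t R in auto)
  next
    fix x assume x: "x \<in> {x0 - R..x0 + R}"
    define r where "r = L * \<bar>x - x0\<bar>"
    \<comment> \<open>Young's inequality by completing the square.\<close>
    have "\<eta> * (\<eta> + L\<^sup>2 / \<eta> * (x - x0)\<^sup>2 - r) = (r - \<eta> / 2)\<^sup>2 + 3 / 4 * \<eta>\<^sup>2"
      unfolding r_def using \<eta> by (simp add: field_simps power2_eq_square)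
    moreover have "0 < (r - \<eta> / 2)\<^sup>2 + 3 / 4 * \<eta>\<^sup>2" using \<eta> by (intro add_nonneg_pos) auto
    ultimately have "0 < \<eta> + L\<^sup>2 / \<eta> * (x - x0)\<^sup>2 - r" using \<eta> by (metis zero_less_mult_pos)
    moreover have "L\<^sup>2 / \<eta> * (x - x0)\<^sup>2 \<le> N * (x - x0)\<^sup>2"
      unfolding N_def using B0 by (intro mult_right_mono) auto
    ultimately show "0 < ?D (t1, x)" using L[OF x] unfolding r_def by simp
  next
    fix s assume s: "s \<in> {t1..t2}"
    have "B / R\<^sup>2 * R\<^sup>2 \<le> N * R\<^sup>2" unfolding N_def using \<eta> by (intro mult_right_mono) auto
    then have N: "B \<le> N * R\<^sup>2" using R by simp
    have "0 \<le> rate * (s - t1)" using rate0 s by simp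
    then show "0 < ?D (s, x0 - R)" "0 < ?D (s, x0 + R)"
      using N B[OF s, of "x0 - R"] B[OF s, of "x0 + R"] \<eta> wpos[of t1 x0] R t by auto
  next
    fix s y assume sy: "s \<in> {t1<..t2}" "y \<in> {x0 - R<..<x0 + R}"
    then have s: "s \<in> {0<..<T}" and y: "y \<in> {a<..<b}" using t R by auto
    show "((\<lambda>s. ?D (s, y)) has_real_derivative (case (s, y) of (t, x) \<Rightarrow> rate - wt (t, x))) (at s)"
      by (auto intro!: derivative_eq_intros wt[OF s y])
    show "((\<lambda>y. ?D (s, y)) has_real_derivative (case (s, y) of (t, x) \<Rightarrow> 2 * N * (x - x0) - wx (t, x))) (at y)"
      by (auto intro!: derivative_eq_intros wx[OF s y])
    show "((\<lambda>y. case (s, y) of (t, x) \<Rightarrow> 2 * N * (x - x0) - wx (t, x)) has_real_derivative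
        (case (s, y) of (t, x) \<Rightarrow> 2 * N - wxx (t, x))) (at y)"
      by (auto intro!: derivative_eq_intros wxx[OF s y])
    assume "(case (s, y) of (t, x) \<Rightarrow> rate - wt (t, x)) \<le> 0" "0 \<le> (case (s, y) of (t, x) \<Rightarrow> 2 * N - wxx (t, x))"
    then have Dt: "rate \<le> wt (s, y)" and Dxx: "wxx (s, y) \<le> 2 * N" by auto
    have w: "0 < w (s, y)" "w (s, y) \<le> B" using wpos[of s y] B[of s y] sy by auto
    have rho: "0 < rho l y" "rho l y \<le> rho l (x0 + R)"
      using rho_pos[OF l, of y] rho_mono[OF l, of y "x0 + R"] y sy a by auto
    have "wt (s, y) = w (s, y) * (rho l y * wxx (s, y) + rho l y * h y)"
      unfolding pde[OF s y] by (simp add: algebra_simps)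
    also have "\<dots> \<le> w (s, y) * (rho l y * (2 * N) + M)"
      using w rho Dxx h[OF y] by (intro mult_left_mono add_mono) auto
    also have "\<dots> \<le> B * (rho l (x0 + R) * (2 * N) + M)"
      using w rho N0 M by (intro mult_mono add_mono mult_right_mono) auto
    also have "\<dots> < rate" unfolding rate_def N_def by (simp add: algebra_simps)
    finally show False using Dt by simp
  qed (use t R in auto)
  then show ?thesis by simp
qed

text \<open>The choice \<open>\<eta> = sqrt (t2 - t1)\<close> balances \<open>\<eta>\<close> against
  \<open>L\<^sup>2 / \<eta> * (t2 - t1)\<close>; this is the origin of the time exponent 1/2. The
  terms linear in \<open>t2 - t1\<close> are absorbed by
  \<open>sqrt (t2 - t1) \<le> sqrt T\<close>.\<close>

lemma increase_in_time_sqrt: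
  assumes t: "0 < t1" "t1 \<le> t2" "t2 < T" and R: "0 < R" "a < x0 - R" "x0 + R \<le> q" "q < b"
    and B: "\<And>t x. t \<in> {t1..t2} \<Longrightarrow> x \<in> {x0 - R..x0 + R} \<Longrightarrow> w (t, x) \<le> B"
    and L: "\<And>x. x \<in> {x0 - R..x0 + R} \<Longrightarrow> \<bar>w (t1, x) - w (t1, x0)\<bar> \<le> L * \<bar>x - x0\<bar>"
  shows "w (t2, x0) - w (t1, x0) \<le>
    (1 + 2 * B * rho l q * L\<^sup>2 + (2 * B * rho l q * (B / R\<^sup>2) + B * M + 1) * sqrt T) * sqrt (t2 - t1)"
proof (cases "t1 = t2")
  case False
  define r where "r = sqrt (t2 - t1)"
  have r: "0 < r" "t2 - t1 = r * r" "r \<le> sqrt T" using t False by (auto simp: r_def)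
  have B0: "0 < B" using pos[of t1 x0] B[of t1 x0] t R by auto
  have rho: "0 \<le> rho l (x0 + R)" "rho l (x0 + R) \<le> rho l q"
    using rho_pos[OF l, of "x0 + R"] rho_mono[OF l, of "x0 + R" q] R a by auto
  have "w (t2, x0) - w (t1, x0) \<le> r + (B * (2 * rho l (x0 + R) * (L\<^sup>2 / r + B / R\<^sup>2) + M) + 1) * (r * r)"
    using increase_in_time[OF t R(1,2) _ r(1) B L] R r by simp
  also have "\<dots> \<le> r + (B * (2 * rho l q * (L\<^sup>2 / r + B / R\<^sup>2) + M) + 1) * (r * r)"
  proof -
    have "0 \<le> L\<^sup>2 / r + B / R\<^sup>2" using B0 r by auto
    then have "2 * rho l (x0 + R) * (L\<^sup>2 / r + B / R\<^sup>2) \<le> 2 * rho l q * (L\<^sup>2 / r + B / R\<^sup>2)"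
      using rho by (intro mult_right_mono) auto
    then have "B * (2 * rho l (x0 + R) * (L\<^sup>2 / r + B / R\<^sup>2) + M) \<le> B * (2 * rho l q * (L\<^sup>2 / r + B / R\<^sup>2) + M)"
      using B0 by (intro mult_left_mono) auto
    then show ?thesis by (simp add: mult_right_mono)
  qed
  also have "\<dots> = (1 + 2 * B * rho l q * L\<^sup>2) * r + (2 * B * rho l q * (B / R\<^sup>2) + B * M + 1) * r * r"
    using r by (simp add: field_simps)
  also have "\<dots> \<le> (1 + 2 * B * rho l q * L\<^sup>2) * r + (2 * B * rho l q * (B / R\<^sup>2) + B * M + 1) * sqrt T * r"
  proof -
    have "0 \<le> 2 * B * rho l q * (B / R\<^sup>2) + B * M + 1" using rho B0 M by simp
    then have "(2 * B * rho l q * (B / R\<^sup>2) + B * M + 1) * r \<le> (2 * B * rho l q * (B / R\<^sup>2) + B * M + 1) * sqrt T"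
      using r by (intro mult_left_mono) auto
    then have "(2 * B * rho l q * (B / R\<^sup>2) + B * M + 1) * r * r \<le> (2 * B * rho l q * (B / R\<^sup>2) + B * M + 1) * sqrt T * r"
      using r by (intro mult_right_mono) auto
    then show ?thesis by simp
  qed
  finally show ?thesis unfolding r_def by (simp add: algebra_simps)
qed (use t in auto)

end

text \<open>The constant is fixed before any solution is named: \<open>eps\<close>,
  \<open>a\<close>, \<open>b\<close>, \<open>h\<close>, \<open>w\<close> and \<open>s\<close> are
  quantified afterwards, so one \<open>C\<close> serves the whole approximating sequence and all
  \<open>s < T\<close> that share the same \<open>B\<close>. The outer interval carries the endpoint
  bounds, the inner one the conclusions.\<close>

lemma interior_estimate:
  fixes l M T t0 p p' q' q B :: real
  assumes l: "0 \<le> l" and M: "0 < M" and t0: "0 < t0" and pq: "0 < p" "p < p'" "p' \<le> q'" "q' < q"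
  obtains C where "0 \<le> C"
    and "\<And>eps a b h w wt wx wxx s t x. positive_classical_solution l M T eps a b h w wt wx wxx \<Longrightarrow>
      a < p \<Longrightarrow> q < b \<Longrightarrow> s < T \<Longrightarrow> w (s, p) \<le> B \<Longrightarrow> w (s, q) \<le> B \<Longrightarrow>
      t \<in> {t0..s} \<Longrightarrow> x \<in> {p'..q'} \<Longrightarrow> \<bar>w (t, x)\<bar> \<le> C \<and> \<bar>wx (t, x)\<bar> \<le> C"
    and "\<And>eps a b h w wt wx wxx s t1 t2 x y. positive_classical_solution l M T eps a b h w wt wx wxx \<Longrightarrow>
      a < p \<Longrightarrow> q < b \<Longrightarrow> s < T \<Longrightarrow> w (s, p) \<le> B \<Longrightarrow> w (s, q) \<le> B \<Longrightarrow>
      t1 \<in> {t0..s} \<Longrightarrow> t2 \<in> {t0..s} \<Longrightarrow> x \<in> {p'..q'} \<Longrightarrow> y \<in> {p'..q'} \<Longrightarrow>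
      \<bar>w (t1, x) - w (t2, y)\<bar> \<le> C * (\<bar>x - y\<bar> + sqrt \<bar>t1 - t2\<bar>)"
proof -
  \<comment> \<open>\<open>B0\<close> bounds \<open>w\<close> at \<open>p\<close> and
    \<open>q\<close> for all times in \<open>{t0..s}\<close>, \<open>C0\<close> is the semiconvexity
    constant, \<open>B1\<close> and \<open>L\<close> bound \<open>w\<close> and \<open>wx\<close>,
    and \<open>H1\<close>, \<open>H2\<close> control increase and decrease in time.\<close>
  define K where "K = M + 1 / t0"
  define B0 where "B0 = exp (K * T) * B"
  define C0 where "C0 = (2 * M + 1 / t0) / rho l p"
  define B1 where "B1 = B0 + C0 * q\<^sup>2"
  \<comment> \<open>Half the gap: the gradient bound holds on \<open>{p + d..q - d}\<close>, which
    still contains the interval of radius \<open>d\<close> about each point of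
    \<open>[p', q']\<close> that the barrier needs.\<close>
  define d where "d = min (p' - p) (q - q') / 2"
  define L where "L = (B0 + C0 * q\<^sup>2) / d + C0 * q"
  define H1 where "H1 = 1 + 2 * B1 * rho l q * L\<^sup>2 + (2 * B1 * rho l q * (B1 / d\<^sup>2) + B1 * M + 1) * sqrt T"
  define H2 where "H2 = K * B1 * sqrt T"
  define C where "C = \<bar>B1\<bar> + \<bar>L\<bar> + \<bar>H1\<bar> + \<bar>H2\<bar>"
  have d: "0 < d" "p + 2 * d \<le> p'" "q' \<le> q - 2 * d" using pq by (auto simp: d_def)
  have K: "0 < K" using M t0 by (simp add: K_def add_pos_pos)
  have bounds: "\<bar>w (t, x)\<bar> \<le> B1 \<and> \<bar>wx (t, x)\<bar> \<le> L"
    if sol: "positive_classical_solution l M T eps a b h w wt wx wxx"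
      and ab: "a < p" "q < b" and s: "s < T" and B: "w (s, p) \<le> B" "w (s, q) \<le> B"
      and t: "t \<in> {t0..s}" and x: "x \<in> {p + d..q - d}"
    for eps a b h w wt wx wxx s t x
  proof -
    interpret positive_classical_solution l M T eps a b h w wt wx wxx by fact
    have end_bound: "w (t, z) \<le> B0" if z: "z \<in> {p, q}" for z
    proof -
      have zab: "z \<in> {a<..<b}" using z ab pq by auto
      then have wz: "0 < w (s, z)" using pos[of s z] s t t0 by auto
      have "w (t, z) \<le> exp (K * (s - t)) * w (s, z)"
        unfolding K_def using almost_monotone[of t0 t s z] t t0 s zab by auto
      also have "\<dots> \<le> exp (K * T) * B"
        using wz B z K s t t0 by (intro mult_mono) auto
      finally show ?thesis by (simp add: B0_def)
    qed
    have "w (t, x) \<le> B1"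
      unfolding B1_def C0_def
      by (rule upper_bound_from_endpoints) (use t t0 s ab x d end_bound in auto)
    moreover have "0 < w (t, x)" using pos[of t x] t t0 s ab x d by auto
    moreover have "\<bar>wx (t, x)\<bar> \<le> L"
      unfolding L_def C0_def
      by (rule gradient_bound) (use t t0 s ab x d end_bound in auto)
    ultimately show ?thesis by simp
  qed
  show thesis
  proof (rule that[of C])
    show "0 \<le> C" by (simp add: C_def)
  next
    fix eps a b h w wt wx wxx s t x
    assume *: "positive_classical_solution l M T eps a b h w wt wx wxx"
      "a < p" "q < b" "s < T" "w (s, p) \<le> B" "w (s, q) \<le> B" "t \<in> {t0..s}" and x: "x \<in> {p'..q'}"
    show "\<bar>w (t, x)\<bar> \<le> C \<and> \<bar>wx (t, x)\<bar> \<le> C"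
      using bounds[OF *, of x] x d by (auto simp: C_def)
  next
    fix eps a b h w wt wx wxx s t1 t2 x y
    assume *: "positive_classical_solution l M T eps a b h w wt wx wxx"
      "a < p" "q < b" "s < T" "w (s, p) \<le> B" "w (s, q) \<le> B"
      and t: "t1 \<in> {t0..s}" "t2 \<in> {t0..s}" and x: "x \<in> {p'..q'}" and y: "y \<in> {p'..q'}"
    interpret positive_classical_solution l M T eps a b h w wt wx wxx by fact
    have lip: "\<bar>w (t, x) - w (t, y)\<bar> \<le> L * \<bar>x - y\<bar>"
      if t: "t \<in> {t0..s}" and xy: "x \<in> {p + d..q - d}" "y \<in> {p + d..q - d}" for t x y
    proof -
      have "norm (w (t, x) - w (t, y)) \<le> L * norm (x - y)"
      proof (rule field_differentiable_bound[where S="{p + d..q - d}" and f'="\<lambda>x. wx (t, x)"])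
        fix z assume z: "z \<in> {p + d..q - d}"
        show "((\<lambda>x. w (t, x)) has_field_derivative wx (t, z)) (at z within {p + d..q - d})"
          by (rule has_field_derivative_at_within, rule wx) (use t z d *(2-4) t0 in auto)
        show "norm (wx (t, z)) \<le> L" using bounds[OF * t z] by simp
      qed (use xy in auto)
      then show ?thesis by simp
    qed
    have time: "\<bar>w (r2, x) - w (r1, x)\<bar> \<le> (\<bar>H1\<bar> + \<bar>H2\<bar>) * sqrt (r2 - r1)"
      if r: "t0 \<le> r1" "r1 \<le> r2" "r2 \<le> s" for r1 r2
    proof -
      have box: "z \<in> {p + d..q - d}" if "z \<in> {x - d..x + d}" for z using that x d by auto
      have up: "w (r2, x) - w (r1, x) \<le> H1 * sqrt (r2 - r1)"
        unfolding H1_def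
      proof (rule increase_in_time_sqrt)
        fix t z assume "t \<in> {r1..r2}" "z \<in> {x - d..x + d}"
        then show "w (t, z) \<le> B1" using bounds[OF *, of t z] box r by auto
      next
        fix z assume "z \<in> {x - d..x + d}"
        then show "\<bar>w (r1, z) - w (r1, x)\<bar> \<le> L * \<bar>z - x\<bar>" using lip[of r1 z x] box r d by auto
      qed (use r t0 *(2-4) x d in auto)
      have xab: "x \<in> {a<..<b}" using x d *(2-3) by auto
      have w: "0 < w (r1, x)" "w (r1, x) \<le> B1"
        using pos[of r1 x] xab r t0 *(4) bounds[OF *, of r1 x] x d by auto
      \<comment> \<open>The decrease is at most linear in time; it is weakened to order 1/2 to match
        the bound on the increase.\<close>
      have "exp (- (K * (r2 - r1))) * w (r1, x) \<le>
          exp (- (K * (r2 - r1))) * (exp (K * (r2 - r1)) * w (r2, x))"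
        unfolding K_def using almost_monotone[of t0 r1 r2 x] r t0 *(4) xab by (intro mult_left_mono) auto
      also have "\<dots> = w (r2, x)" by (simp add: mult_exp_exp flip: mult.assoc)
      finally have "exp (- (K * (r2 - r1))) * w (r1, x) \<le> w (r2, x)" .
      moreover have "1 - K * (r2 - r1) \<le> exp (- (K * (r2 - r1)))"
        using exp_ge_add_one_self[of "- (K * (r2 - r1))"] by simp
      then have "(1 - K * (r2 - r1)) * w (r1, x) \<le> exp (- (K * (r2 - r1))) * w (r1, x)"
        using w by (intro mult_right_mono) auto
      ultimately have "w (r1, x) - w (r2, x) \<le> K * (r2 - r1) * w (r1, x)" by (simp add: algebra_simps)
      also have "\<dots> \<le> K * (r2 - r1) * B1" using w K r by (intro mult_left_mono) auto
      also have "\<dots> = K * B1 * sqrt (r2 - r1) * sqrt (r2 - r1)" using r by simp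
      also have "\<dots> \<le> K * B1 * sqrt (r2 - r1) * sqrt T"
        using K w r t0 *(4) by (intro mult_left_mono) auto
      finally have down: "w (r1, x) - w (r2, x) \<le> H2 * sqrt (r2 - r1)" by (simp add: H2_def algebra_simps)
      have "H1 * sqrt (r2 - r1) \<le> (\<bar>H1\<bar> + \<bar>H2\<bar>) * sqrt (r2 - r1)" "H2 * sqrt (r2 - r1) \<le> (\<bar>H1\<bar> + \<bar>H2\<bar>) * sqrt (r2 - r1)"
        using r by (auto intro!: mult_right_mono)
      then show ?thesis using up down by linarith
    qed
    have "\<bar>w (t1, x) - w (t2, x)\<bar> \<le> (\<bar>H1\<bar> + \<bar>H2\<bar>) * sqrt \<bar>t1 - t2\<bar>"
    proof (cases "t1 \<le> t2")
      case True
      then show ?thesis using time[of t1 t2] t by (simp add: abs_minus_commute)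
    next
      case False
      then show ?thesis using time[of t2 t1] t by simp
    qed
    moreover have "\<bar>w (t2, x) - w (t2, y)\<bar> \<le> L * \<bar>x - y\<bar>" using lip[OF t(2)] x y d by auto
    moreover have "(\<bar>H1\<bar> + \<bar>H2\<bar>) * sqrt \<bar>t1 - t2\<bar> \<le> C * sqrt \<bar>t1 - t2\<bar>" "L * \<bar>x - y\<bar> \<le> C * \<bar>x - y\<bar>"
      unfolding C_def by (intro mult_right_mono; simp)+
    ultimately show "\<bar>w (t1, x) - w (t2, y)\<bar> \<le> C * (\<bar>x - y\<bar> + sqrt \<bar>t1 - t2\<bar>)"
      unfolding distrib_left by linarith
  qed
qed


section \<open>Test functions and classical weak derivatives\<close>

text \<open>All derivatives of \<open>exp (- A / y)\<close>, extended by 0, are combinations of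
  these functions. \<open>A\<close> stays a parameter because letting it tend to 0 turns the bumps
  built from them into indicators.\<close>

definition flat :: "real \<Rightarrow> nat \<Rightarrow> real \<Rightarrow> real" where
  "flat A i y = (if 0 < y then exp (- A / y) / y ^ i else 0)"

text \<open>With \<open>s = A / y\<close> this is the decay of \<open>s ^ i * exp (- s)\<close> at
  infinity; on the left of 0 the function vanishes.\<close>

lemma flat_tendsto_0:
  assumes A: "0 < A"
  shows "(flat A i \<longlongrightarrow> 0) (at 0)"
proof -
  have lim: "((\<lambda>y. (1 / A) ^ i * ((A / y) ^ i / exp (A / y))) \<longlongrightarrow> (1 / A) ^ i * 0) (at_right 0)"
  proof (intro tendsto_mult tendsto_const)
    have "filterlim (\<lambda>y. A / y) at_top (at_right 0)"
      by (intro filterlim_tendsto_pos_mult_at_top[OF tendsto_const A, of inverse, folded divide_inverse]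
          filterlim_inverse_at_top_right)
    then show "((\<lambda>y. (A / y) ^ i / exp (A / y)) \<longlongrightarrow> 0) (at_right 0)"
      by (rule filterlim_compose[OF tendsto_power_div_exp_0])
  qed
  have "(flat A i \<longlongrightarrow> 0) (at_right 0)"
  proof (rule Lim_transform_eventually)
    show "((\<lambda>y. (1 / A) ^ i * ((A / y) ^ i / exp (A / y))) \<longlongrightarrow> 0) (at_right 0)" using lim by simp
    have "eventually (\<lambda>y. (0::real) < y) (at_right 0)" by (simp add: eventually_at_right_less)
    then show "\<forall>\<^sub>F y in at_right 0. (1 / A) ^ i * ((A / y) ^ i / exp (A / y)) = flat A i y"
      by eventually_elim (use A in \<open>simp add: flat_def power_divide exp_minus field_simps\<close>)
  qed
  moreover have "(flat A i \<longlongrightarrow> 0) (at_left 0)"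
  proof (rule Lim_transform_eventually[OF tendsto_const])
    have "eventually (\<lambda>y. y < (0::real)) (at_left 0)" by (rule eventually_at_leftI[of "- 1"]) auto
    then show "\<forall>\<^sub>F y in at_left 0. 0 = flat A i y" by eventually_elim (simp add: flat_def)
  qed
  ultimately show ?thesis by (simp add: filterlim_split_at)
qed

lemma flat_Suc: "y * flat A (Suc i) y = flat A i y"
  by (simp add: flat_def)

lemma flat_has_derivative:
  assumes A: "0 < A"
  shows "(flat A i has_real_derivative A * flat A (i + 2) y - i * flat A (i + 1) y) (at y)"
proof (cases "y = 0")
  case True
  \<comment> \<open>At 0 the difference quotient of \<open>flat A i\<close> is
    \<open>flat A (Suc i)\<close>.\<close>
  have "((\<lambda>h. (flat A i (0 + h) - flat A i 0) / h) \<longlongrightarrow> 0) (at 0)"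
    by (rule Lim_transform_eventually[OF flat_tendsto_0[OF A, of "Suc i"]])
      (simp add: eventually_at_filter, rule always_eventually, auto simp: flat_def)
  then show ?thesis using True by (simp add: DERIV_def flat_def)
next
  case False
  show ?thesis
  proof (cases "0 < y")
    case True
    have "((\<lambda>y. exp (- A / y) / y ^ i) has_real_derivative A * flat A (i + 2) y - i * flat A (i + 1) y) (at y)"
      using True
      by (auto intro!: derivative_eq_intros simp: flat_def power_add power2_eq_square field_simps
          power_eq_if[of y i])
    then show ?thesis
      by (rule has_field_derivative_transform_within_open[of _ _ _ "{0<..}"]) (use True in \<open>auto simp: flat_def\<close>)
  next
    case False': False
    have "((\<lambda>y. 0) has_real_derivative A * flat A (i + 2) y - i * flat A (i + 1) y) (at y)"
      using False' by (simp add: flat_def)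
    then show ?thesis
      by (rule has_field_derivative_transform_within_open[of _ _ _ "{..<0}"])
        (use False False' in \<open>auto simp: flat_def\<close>)
  qed
qed

text \<open>This family is closed under differentiation, which is all that \<^const>\<open>Ck\<close> asks for.\<close>

definition bump_family :: "real \<Rightarrow> real \<Rightarrow> real \<Rightarrow> (real \<Rightarrow> real) set" where
  "bump_family A c d = {f. \<exists>i P. f = (\<lambda>x. flat A i ((x - c) * (d - x)) * poly P x)}"

lemma bump_family_derivative:
  assumes A: "0 < A" and f: "f \<in> bump_family A c d"
  obtains f' where "f' \<in> bump_family A c d" "\<And>x. (f has_real_derivative f' x) (at x)"
proof -
  obtain i P where f: "f = (\<lambda>x. flat A i ((x - c) * (d - x)) * poly P x)"
    using f by (auto simp: bump_family_def)
  define q where "q x = (x - c) * (d - x)" for x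
  define p where "p = [:- c, 1:] * [:d, - 1:]"
  have q: "q x = poly p x" for x by (simp add: q_def p_def algebra_simps)
  have f: "f = (\<lambda>x. flat A i (q x) * poly P x)" by (simp add: f q_def)
  \<comment> \<open>All terms of the derivative are brought to the index \<open>i + 2\<close> by
    \<open>flat_Suc\<close>; \<open>R\<close> collects the polynomial factors.\<close>
  define R where "R = pderiv P * p * p + P * pderiv p * ([:A:] - [:real i:] * p)"
  define f' where "f' x = flat A (i + 2) (q x) * poly R x" for x
  show thesis
  proof (rule that[of f'])
    show "f' \<in> bump_family A c d" unfolding bump_family_def f'_def q_def by auto
    fix x
    have q': "(q has_real_derivative poly (pderiv p) x) (at x)"
      unfolding q[abs_def] by (rule poly_DERIV)
    have "(f has_real_derivative (A * flat A (i + 2) (q x) - i * flat A (i + 1) (q x)) * poly (pderiv p) x * poly P x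
        + poly (pderiv P) x * flat A i (q x)) (at x)"
      unfolding f by (rule DERIV_mult[OF DERIV_chain2[OF flat_has_derivative[OF A] q'] poly_DERIV])
    moreover have "flat A i (q x) = q x * q x * flat A (i + 2) (q x)" "flat A (i + 1) (q x) = q x * flat A (i + 2) (q x)"
      using flat_Suc[of "q x" A i] flat_Suc[of "q x" A "i + 1"] by (auto simp: mult.assoc)
    ultimately show "(f has_real_derivative f' x) (at x)"
      by (simp add: f'_def R_def q algebra_simps)
  qed
qed

lemma tensor_has_derivative:
  fixes f g :: "real \<Rightarrow> real"
  assumes "(f has_real_derivative f') (at (fst z))" "(g has_real_derivative g') (at (snd z))"
  shows "((\<lambda>z. f (fst z) * g (snd z)) has_derivative
      (\<lambda>h. f (fst z) * (g' * snd h) + f' * fst h * g (snd z))) (at z)"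
proof -
  have "((\<lambda>z. f (fst z)) has_derivative (\<lambda>h. f' * fst h)) (at z)"
    by (rule has_derivative_compose[OF has_derivative_fst[OF has_derivative_ident]
          assms(1)[unfolded has_field_derivative_def]])
  moreover have "((\<lambda>z. g (snd z)) has_derivative (\<lambda>h. g' * snd h)) (at z)"
    by (rule has_derivative_compose[OF has_derivative_snd[OF has_derivative_ident]
          assms(2)[unfolded has_field_derivative_def]])
  ultimately show ?thesis by (rule has_derivative_mult)
qed

lemma pd_tensor:
  fixes f g :: "real \<Rightarrow> real"
  assumes "(f has_real_derivative f') (at (fst z))" "(g has_real_derivative g') (at (snd z))"
  shows "pd (1, 0) (\<lambda>z. f (fst z) * g (snd z)) z = f' * g (snd z)"
    and "pd (0, 1) (\<lambda>z. f (fst z) * g (snd z)) z = f (fst z) * g'"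
  unfolding pd_def frechet_derivative_at[OF tensor_has_derivative[OF assms], symmetric] by auto

text \<open>A partial derivative of a product of one-variable functions differentiates one factor
  and so stays in the family, which lets the induction on \<open>k\<close> run.\<close>

lemma Ck_tensor:
  fixes S R :: "(real \<Rightarrow> real) set"
  assumes S: "\<And>f. f \<in> S \<Longrightarrow> \<exists>f'\<in>S. \<forall>x. (f has_real_derivative f' x) (at x)"
    and R: "\<And>g. g \<in> R \<Longrightarrow> \<exists>g'\<in>R. \<forall>x. (g has_real_derivative g' x) (at x)"
    and fg: "f \<in> S" "g \<in> R"
  shows "Ck k (\<lambda>z. f (fst z) * g (snd z))"
  using fg
proof (induction k arbitrary: f g)
  case (0 f g)
  then have "continuous_on UNIV f" "continuous_on UNIV g"
    using S R by (meson DERIV_isCont continuous_at_imp_continuous_on)+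
  then show ?case
    by (auto intro!: continuous_intros continuous_on_compose2[of UNIV f] continuous_on_compose2[of UNIV g])
next
  case (Suc k f g)
  obtain f' where f': "f' \<in> S" "\<And>x. (f has_real_derivative f' x) (at x)" using S Suc by meson
  obtain g' where g': "g' \<in> R" "\<And>x. (g has_real_derivative g' x) (at x)" using R Suc by meson
  have "pd (1, 0) (\<lambda>z. f (fst z) * g (snd z)) = (\<lambda>z. f' (fst z) * g (snd z))"
    "pd (0, 1) (\<lambda>z. f (fst z) * g (snd z)) = (\<lambda>z. f (fst z) * g' (snd z))"
    using pd_tensor[OF f'(2) g'(2)] by auto
  moreover have "(\<lambda>z. f (fst z) * g (snd z)) differentiable (at z)" for z
    using tensor_has_derivative[OF f'(2) g'(2)] unfolding differentiable_def by blast
  ultimately show ?case using Suc f' g' by (auto simp: Basis_prod_def)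
qed

definition bump :: "real \<Rightarrow> real \<Rightarrow> real \<Rightarrow> real \<Rightarrow> real" where
  "bump A c d x = flat A 0 ((x - c) * (d - x))"

lemma bump_in_family: "bump A c d \<in> bump_family A c d"
  unfolding bump_family_def bump_def by (auto intro!: exI[of _ 0] exI[of _ "1 :: real poly"])

lemma bump_eq_0: "x \<notin> {c<..<d} \<Longrightarrow> c \<le> d \<Longrightarrow> bump A c d x = 0"
  unfolding bump_def flat_def by (auto simp: zero_less_mult_iff)

lemma bump_bounds: "0 < A \<Longrightarrow> 0 \<le> bump A c d x \<and> bump A c d x \<le> 1"
  unfolding bump_def flat_def by auto

text \<open>Inside the interval \<open>exp (- A / y)\<close> tends to 1 as \<open>A\<close> tends to
  0. This makes integrals over boxes limits of integrals against test functions.\<close>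

lemma bump_tendsto_indicator:
  assumes "c \<le> d"
  shows "(\<lambda>k. bump (1 / real (Suc k)) c d x) \<longlonglongrightarrow> indicator {c<..<d} x"
proof (cases "x \<in> {c<..<d}")
  case True
  define y where "y = (x - c) * (d - x)"
  have y: "0 < y" using True by (simp add: y_def)
  have "(\<lambda>k. exp (- (1 / real (Suc k)) / y)) \<longlonglongrightarrow> exp (- 0 / y)"
    by (intro tendsto_intros LIMSEQ_Suc lim_1_over_n) (use y in auto)
  then show ?thesis using True y by (simp add: bump_def flat_def y_def)
next
  case False
  then show ?thesis using bump_eq_0[OF False assms] by simp
qed

lemma test_function_bump:
  assumes A: "0 < A" and cd: "c \<le> d" "c' \<le> d'" and U: "{c..d} \<times> {c'..d'} \<subseteq> U"
  shows "test_function U (\<lambda>z. bump A c d (fst z) * bump A c' d' (snd z))"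
proof -
  have "{z. bump A c d (fst z) * bump A c' d' (snd z) \<noteq> 0} \<subseteq> {c..d} \<times> {c'..d'}"
    using bump_eq_0[OF _ cd(1), of _ A] bump_eq_0[OF _ cd(2), of _ A] by force
  then have s: "supp (\<lambda>z. bump A c d (fst z) * bump A c' d' (snd z)) \<subseteq> {c..d} \<times> {c'..d'}"
    unfolding supp_def by (intro closure_minimal closed_Times) auto
  have "compact ({c..d} \<times> {c'..d'})" by (intro compact_Times) auto
  then have "compact (supp (\<lambda>z. bump A c d (fst z) * bump A c' d' (snd z)))"
    using s by (auto simp: compact_eq_bounded_closed supp_def intro: bounded_subset)
  moreover have "Ck k (\<lambda>z. bump A c d (fst z) * bump A c' d' (snd z))" for k
    using bump_in_family bump_family_derivative[OF A] by (intro Ck_tensor[of "bump_family A c d" "bump_family A c' d'"]) metis+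
  ultimately show ?thesis using s U unfolding test_function_def by blast
qed

section \<open>Weak derivatives of classically differentiable functions\<close>

lemma AE_zero_if_box_integrals_zero:
  fixes f :: "'a::euclidean_space \<Rightarrow> real"
  assumes f: "f absolutely_integrable_on cbox c d"
    and zero: "\<And>a b. cbox a b \<subseteq> cbox c d \<Longrightarrow> integral (cbox a b) f = 0"
  shows "AE x in lebesgue. x \<in> box c d \<longrightarrow> f x = 0"
proof -
  \<comment> \<open>Extension by zero gives integrability on every box, as Lebesgue's
    differentiation theorem asks. The averages over small cubes with corner \<open>x\<close> vanish
    by \<open>zero\<close>, hence so does their limit \<open>F x\<close> for almost every
    \<open>x\<close> in the box.\<close>
  define F where "F x = (if x \<in> cbox c d then f x else 0)" for x
  have "F absolutely_integrable_on UNIV"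
    unfolding F_def using f absolutely_integrable_restrict_UNIV by blast
  then have F: "F integrable_on cbox a b" for a b
    by (meson integrable_on_subcbox set_lebesgue_integral_eq_integral(1) subset_UNIV)
  obtain N where N: "negligible N" and lim: "\<And>x e. x \<notin> N \<Longrightarrow> 0 < e \<Longrightarrow>
      \<exists>d>0. \<forall>h. 0 < h \<and> h < d \<longrightarrow> norm (integral (cbox x (x + h *\<^sub>R One)) F /\<^sub>R h ^ DIM('a) - F x) < e"
    using integrable_ccontinuous_explicit[of F, OF F] by blast
  have "f x = 0" if x: "x \<notin> N" "x \<in> box c d" for x
  proof (rule ccontr)
    assume "f x \<noteq> 0"
    then have "0 < norm (F x)" using x box_subset_cbox by (auto simp: F_def)
    from lim[OF x(1) this] obtain e where e: "0 < e" and
      less: "\<And>h. 0 < h \<Longrightarrow> h < e \<Longrightarrow> norm (integral (cbox x (x + h *\<^sub>R One)) F /\<^sub>R h ^ DIM('a) - F x) < norm (F x)"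
      by blast
    have "((\<lambda>h. x + h *\<^sub>R One) \<longlongrightarrow> x + 0 *\<^sub>R One) (at_right 0)" by (intro tendsto_intros)
    then have "eventually (\<lambda>h. x + h *\<^sub>R One \<in> box c d) (at_right 0)"
      using x(2) by (intro topological_tendstoD[OF _ open_box]) auto
    moreover have "eventually (\<lambda>h. h < e \<and> 0 < h) (at_right 0)"
      using e by (auto simp: eventually_at_right_field)
    ultimately have "eventually (\<lambda>h. x + h *\<^sub>R One \<in> box c d \<and> h < e \<and> 0 < h) (at_right 0)"
      by eventually_elim auto
    then obtain h where h: "x + h *\<^sub>R One \<in> box c d" "h < e" "0 < h"
      using eventually_happens'[of "at_right (0::real)"] by auto
    have sub: "cbox x (x + h *\<^sub>R One) \<subseteq> cbox c d"
      using h(1) x(2) unfolding subset_box by (auto simp: mem_box intro: less_imp_le)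
    have "integral (cbox x (x + h *\<^sub>R One)) F = integral (cbox x (x + h *\<^sub>R One)) f"
      using sub by (intro integral_cong) (auto simp: F_def)
    then show False using less[OF h(3,2)] zero[OF sub] by simp
  qed
  then show ?thesis
    using AE_not_in[of N lebesgue] N unfolding negligible_iff_null_sets by (auto elim: eventually_mono)
qed

lemma integral_lebesgue_on_superset:
  fixes f :: "'a::euclidean_space \<Rightarrow> real"
  assumes "U \<in> sets lebesgue" "R \<in> sets lebesgue" "R \<subseteq> U" "\<And>z. z \<notin> R \<Longrightarrow> f z = 0"
  shows "(LINT z|lebesgue_on U. f z) = (LINT z|lebesgue_on R. f z)"
  using assms
  by (subst (1 2) integral_restrict_space) (auto intro!: Bochner_Integration.integral_cong simp: indicator_def)

lemma Lp_loc_1_integrable: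
  assumes "Lp_loc lebesgue U 1 f" "compact K" "K \<subseteq> U"
  shows "integrable (lebesgue_on K) f"
proof -
  have f: "f \<in> borel_measurable (lebesgue_on K)" "integrable (lebesgue_on K) (\<lambda>x. \<bar>f x\<bar> powr 1)"
    using assms unfolding Lp_loc_def Lp_def by auto
  then have "integrable (lebesgue_on K) (\<lambda>x. norm (f x))" by simp
  then show ?thesis using f integrable_norm_iff by blast
qed

lemma bump_family_eq_0:
  assumes "f \<in> bump_family A c d" "c \<le> d" "x \<notin> {c<..<d}"
  shows "f x = 0"
  using assms unfolding bump_family_def flat_def by (auto simp: zero_less_mult_iff)

text \<open>Testing with products of bumps supported in the box and integrating by parts in
  \<open>x\<close> shows that \<open>w - ux\<close> integrates to zero against each of them. The
  bumps tend to the indicator of the open box, so dominated convergence removes them.\<close>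

lemma weak_pd_eq_classical_on_box:
  fixes u w ux :: "real \<times> real \<Rightarrow> real"
  assumes wp: "weak_pd (0, 1) U u w" and U: "U \<in> sets lebesgue"
    and box: "{c..d} \<times> {c'..d'} \<subseteq> U" "c \<le> d" "c' \<le> d'"
    and cont: "continuous_on ({c..d} \<times> {c'..d'}) u" "continuous_on ({c..d} \<times> {c'..d'}) ux"
    and deriv: "\<And>t x. t \<in> {c..d} \<Longrightarrow> x \<in> {c'..d'} \<Longrightarrow> ((\<lambda>y. u (t, y)) has_real_derivative ux (t, x)) (at x)"
  shows "(\<lambda>z. w z - ux z) absolutely_integrable_on cbox (c, c') (d, d')"
    and "integral (cbox (c, c') (d, d')) (\<lambda>z. w z - ux z) = 0"
proof -
  define R where "R = cbox (c, c') (d, d')"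
  have R: "R = {c..d} \<times> {c'..d'}" unfolding R_def by auto
  have R_sets: "R \<in> sets lebesgue" by (simp add: R_def)
  have cont_int: "integrable (lebesgue_on R) f" if "continuous_on R f" for f :: "real \<times> real \<Rightarrow> real"
    using that unfolding R_def by (intro continuous_imp_integrable)
  have int_w: "integrable (lebesgue_on R) w"
    using wp box(1) by (intro Lp_loc_1_integrable[of U]) (auto simp: weak_pd_def R intro: compact_Times)
  have int_F: "integrable (lebesgue_on R) (\<lambda>z. w z - ux z)"
    using int_w cont_int[of ux] cont by (auto simp: R)
  then show abs: "(\<lambda>z. w z - ux z) absolutely_integrable_on cbox (c, c') (d, d')"
    unfolding R_def[symmetric] by (simp add: integrable_restrict_space set_integrable_def R_sets)
  define phi where "phi k z = bump (1 / real (Suc k)) c d (fst z) * bump (1 / real (Suc k)) c' d' (snd z)"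
    for k :: nat and z :: "real \<times> real"
  have zero: "(LINT z|lebesgue_on R. (w z - ux z) * phi k z) = 0" for k
  proof -
    define A where "A = 1 / real (Suc k)"
    have A: "0 < A" by (simp add: A_def)
    obtain f' where f': "f' \<in> bump_family A c d" "\<And>x. (bump A c d has_real_derivative f' x) (at x)"
      using bump_family_derivative[OF A bump_in_family] by blast
    obtain g' where g': "g' \<in> bump_family A c' d'" "\<And>x. (bump A c' d' has_real_derivative g' x) (at x)"
      using bump_family_derivative[OF A bump_in_family] by blast
    have cont_f: "continuous_on S (bump A c d)" for S
      using f'(2) by (meson DERIV_isCont continuous_at_imp_continuous_on)
    have cont_g: "continuous_on S (bump A c' d')" for S
      using g'(2) by (meson DERIV_isCont continuous_at_imp_continuous_on)
    obtain g'' where "\<And>x. (g' has_real_derivative g'' x) (at x)"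
      using bump_family_derivative[OF A g'(1)] by blast
    then have cont_g': "continuous_on S g'" for S
      by (meson DERIV_isCont continuous_at_imp_continuous_on)
    have phi: "phi k = (\<lambda>z. bump A c d (fst z) * bump A c' d' (snd z))"
      by (simp add: phi_def[abs_def] A_def)
    have cont_phi: "continuous_on R (phi k)" unfolding phi
      by (intro continuous_intros continuous_on_compose2[OF cont_f] continuous_on_compose2[OF cont_g]) auto
    define dphi where "dphi z = bump A c d (fst z) * g' (snd z)" for z
    have cont_dphi: "continuous_on R dphi" unfolding dphi_def
      by (intro continuous_intros continuous_on_compose2[OF cont_f] continuous_on_compose2[OF cont_g']) auto
    have pd: "pd (0, 1) (phi k) z = dphi z" for z
      unfolding phi dphi_def by (rule pd_tensor(2)[OF f'(2) g'(2)])
    have off: "phi k z = 0" "dphi z = 0" if "z \<notin> R" for z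
      using that bump_eq_0[OF _ box(2), of "fst z" A] bump_eq_0[OF _ box(3), of "snd z" A]
        bump_family_eq_0[OF g'(1) box(3), of "snd z"]
      unfolding phi dphi_def R by (auto simp: mem_Times_iff)
    have "test_function U (phi k)"
      unfolding phi by (rule test_function_bump[OF A box(2,3,1)])
    then have "(LINT z|lebesgue_on U. u z * pd (0, 1) (phi k) z) = - (LINT z|lebesgue_on U. w z * phi k z)"
      using wp unfolding weak_pd_def by blast
    then have 1: "(LINT z|lebesgue_on R. u z * dphi z) = - (LINT z|lebesgue_on R. w z * phi k z)"
      unfolding pd using integral_lebesgue_on_superset[OF U R_sets] box(1) off R by simp
    have cont_G: "continuous_on R (\<lambda>z. u z * dphi z + ux z * phi k z)"
      using cont cont_phi cont_dphi by (intro continuous_intros) (simp_all add: R)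
    \<comment> \<open>Fubini, then the fundamental theorem in \<open>x\<close>: the integrand is the
      \<open>x\<close>-derivative of \<open>u * phi k\<close>, which vanishes at \<open>c'\<close>
      and \<open>d'\<close>.\<close>
    have "(LINT z|lebesgue_on R. u z * dphi z + ux z * phi k z) = integral R (\<lambda>z. u z * dphi z + ux z * phi k z)"
      by (intro lebesgue_integral_eq_integral cont_int cont_G R_sets)
    also have "\<dots> = integral (cbox c d) (\<lambda>t. integral (cbox c' d') (\<lambda>x. u (t, x) * dphi (t, x) + ux (t, x) * phi k (t, x)))"
      unfolding R_def by (rule integral_prod_continuous) (use cont_G in \<open>simp add: R_def\<close>)
    also have "\<dots> = integral (cbox c d) (\<lambda>t. 0)"
    proof (rule integral_cong)
      fix t assume t: "t \<in> cbox c d"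
      have "((\<lambda>x. u (t, x) * dphi (t, x) + ux (t, x) * phi k (t, x)) has_integral
          u (t, d') * phi k (t, d') - u (t, c') * phi k (t, c')) {c'..d'}"
      proof (rule fundamental_theorem_of_calculus[OF box(3)])
        fix x assume x: "x \<in> {c'..d'}"
        have "((\<lambda>x. u (t, x) * phi k (t, x)) has_real_derivative
            u (t, x) * dphi (t, x) + ux (t, x) * phi k (t, x)) (at x)"
          unfolding phi dphi_def
          by (auto intro!: derivative_eq_intros deriv g'(2) simp: algebra_simps) (use t x in auto)
        then show "((\<lambda>x. u (t, x) * phi k (t, x)) has_vector_derivative
            u (t, x) * dphi (t, x) + ux (t, x) * phi k (t, x)) (at x within {c'..d'})"
          by (simp add: has_real_derivative_iff_has_vector_derivative has_vector_derivative_at_within)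
      qed
      moreover have "phi k (t, d') = 0" "phi k (t, c') = 0"
        unfolding phi using bump_eq_0[OF _ box(3)] by auto
      ultimately show "integral (cbox c' d') (\<lambda>x. u (t, x) * dphi (t, x) + ux (t, x) * phi k (t, x)) = 0"
        by (simp add: integral_unique)
    qed
    finally have 2: "(LINT z|lebesgue_on R. u z * dphi z + ux z * phi k z) = 0" by simp
    have int1: "integrable (lebesgue_on R) (\<lambda>z. u z * dphi z)" "integrable (lebesgue_on R) (\<lambda>z. ux z * phi k z)"
      using cont cont_phi cont_dphi by (intro cont_int continuous_intros; simp add: R)+
    have int2: "integrable (lebesgue_on R) (\<lambda>z. w z * phi k z)"
    proof (rule Bochner_Integration.integrable_bound[OF int_w])
      show "(\<lambda>z. w z * phi k z) \<in> borel_measurable (lebesgue_on R)"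
        using borel_measurable_integrable[OF int_w] borel_measurable_integrable[OF cont_int[OF cont_phi]] by simp
      have "\<bar>phi k z\<bar> \<le> 1" for z
        using bump_bounds[OF A, of c d "fst z"] bump_bounds[OF A, of c' d' "snd z"]
        unfolding phi by (auto simp: abs_mult intro!: mult_le_one)
      then show "AE z in lebesgue_on R. norm (w z * phi k z) \<le> norm (w z)"
        by (intro AE_I2) (auto simp: abs_mult intro!: mult_left_le)
    qed
    show ?thesis
      using 1 2 int1 int2 by (simp add: left_diff_distrib)
  qed
  have "(\<lambda>k. LINT z|lebesgue_on R. (w z - ux z) * phi k z) \<longlonglongrightarrow>
      (LINT z|lebesgue_on R. (w z - ux z) * indicator (box (c, c') (d, d')) z)"
  proof (rule integral_dominated_convergence[where w="\<lambda>z. norm (w z - ux z)"])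
    have [measurable]: "(\<lambda>z. w z - ux z) \<in> borel_measurable (lebesgue_on R)"
      using int_F by auto
    have cont_bump: "continuous_on UNIV (bump (1 / real (Suc k)) c d)" for k c d
    proof -
      obtain f' where "\<And>x. (bump (1 / real (Suc k)) c d has_real_derivative f' x) (at x)"
        using bump_family_derivative[OF _ bump_in_family, of "1 / real (Suc k)" c d] by auto
      then show ?thesis by (meson DERIV_isCont continuous_at_imp_continuous_on)
    qed
    have "continuous_on R (phi k)" for k unfolding phi_def
      by (intro continuous_intros continuous_on_compose2[OF cont_bump]) auto
    then have [measurable]: "phi k \<in> borel_measurable (lebesgue_on R)" for k
      using cont_int by blast
    show "(\<lambda>z. (w z - ux z) * phi k z) \<in> borel_measurable (lebesgue_on R)" for k by measurable
    have "(\<lambda>z. indicator (box (c, c') (d, d')) z :: real) \<in> borel_measurable (lebesgue_on R)"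
      by (intro measurable_restrict_space1 borel_measurable_indicator) simp
    then show "(\<lambda>z. (w z - ux z) * indicator (box (c, c') (d, d')) z) \<in> borel_measurable (lebesgue_on R)"
      by measurable
    show "integrable (lebesgue_on R) (\<lambda>z. norm (w z - ux z))" using int_F by simp
    have "(\<lambda>k. phi k z) \<longlonglongrightarrow> indicator {c<..<d} (fst z) * indicator {c'<..<d'} (snd z)" for z
      unfolding phi_def by (intro tendsto_mult bump_tendsto_indicator box)
    moreover have "indicator {c<..<d} (fst z) * indicator {c'<..<d'} (snd z) =
        (indicator (box (c, c') (d, d')) z :: real)" for z
      by (cases z) (auto simp: indicator_def mem_box Basis_prod_def)
    ultimately have "(\<lambda>k. phi k z) \<longlonglongrightarrow> indicator (box (c, c') (d, d')) z" for z by simp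
    then show "AE z in lebesgue_on R. (\<lambda>k. (w z - ux z) * phi k z) \<longlonglongrightarrow> (w z - ux z) * indicator (box (c, c') (d, d')) z"
      by (intro AE_I2 tendsto_mult tendsto_const)
    have "\<bar>phi k z\<bar> \<le> 1" for k z
      using bump_bounds[of "1 / real (Suc k)" c d "fst z"] bump_bounds[of "1 / real (Suc k)" c' d' "snd z"]
      unfolding phi_def by (auto simp: abs_mult intro!: mult_le_one)
    then show "AE z in lebesgue_on R. norm ((w z - ux z) * phi k z) \<le> norm (w z - ux z)" for k
      by (intro AE_I2) (auto simp: abs_mult intro!: mult_left_le)
  qed
  then have "(LINT z|lebesgue_on R. (w z - ux z) * indicator (box (c, c') (d, d')) z) = 0"
    unfolding zero by (simp add: LIMSEQ_const_iff)
  moreover have "(LINT z|lebesgue_on R. (w z - ux z) * indicator (box (c, c') (d, d')) z) =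
      (LINT z|lebesgue_on (box (c, c') (d, d')). (w z - ux z) * indicator (box (c, c') (d, d')) z)"
    unfolding R_def by (rule integral_lebesgue_on_superset) (auto simp: box_subset_cbox)
  moreover have "\<dots> = (LINT z|lebesgue_on (box (c, c') (d, d')). w z - ux z)"
    by (rule Bochner_Integration.integral_cong) auto
  moreover have "\<dots> = integral (box (c, c') (d, d')) (\<lambda>z. w z - ux z)"
  proof (rule lebesgue_integral_eq_integral)
    have "(\<lambda>z. w z - ux z) absolutely_integrable_on box (c, c') (d, d')"
      by (rule set_integrable_subset[OF abs]) (auto simp: box_subset_cbox)
    then show "integrable (lebesgue_on (box (c, c') (d, d'))) (\<lambda>z. w z - ux z)"
      by (simp add: integrable_restrict_space set_integrable_def)
  qed simp
  ultimately show "integral (cbox (c, c') (d, d')) (\<lambda>z. w z - ux z) = 0"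
    by (simp add: integral_open_interval)
qed

text \<open>Integrability of \<open>w\<close> is available on compact sets, so the open rectangle is
  exhausted by closed boxes with margin \<open>e k\<close>. Every subbox of these is again a closed
  box in \<open>U\<close>, so all box integrals of \<open>w - ux\<close> vanish.\<close>

lemma weak_pd_eq_classical:
  fixes u w ux :: "real \<times> real \<Rightarrow> real"
  assumes wp: "weak_pd (0, 1) U u w" and U: "U \<in> sets lebesgue"
    and box: "{t1<..<t2} \<times> {a<..<b} \<subseteq> U"
    and cont: "continuous_on ({t1<..<t2} \<times> {a<..<b}) u" "continuous_on ({t1<..<t2} \<times> {a<..<b}) ux"
    and deriv: "\<And>t x. t \<in> {t1<..<t2} \<Longrightarrow> x \<in> {a<..<b} \<Longrightarrow>
      ((\<lambda>y. u (t, y)) has_real_derivative ux (t, x)) (at x)"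
  shows "AE z in lebesgue. z \<in> {t1<..<t2} \<times> {a<..<b} \<longrightarrow> w z = ux z"
proof -
  define e where "e k = 1 / real (Suc k)" for k
  have e: "0 < e k" for k by (simp add: e_def)
  define c where "c k = (t1 + e k, a + e k)" for k
  define d where "d k = (t2 - e k, b - e k)" for k
  have "AE z in lebesgue. z \<in> box (c k) (d k) \<longrightarrow> w z - ux z = 0" for k
  proof (cases "cbox (c k) (d k) = {}")
    case True
    then show ?thesis using box_subset_cbox by fastforce
  next
    case False
    have sub: "cbox (c k) (d k) \<subseteq> {t1<..<t2} \<times> {a<..<b}"
      using e[of k] by (auto simp: c_def d_def)
    have main: "(\<lambda>z. w z - ux z) absolutely_integrable_on cbox p q \<and> integral (cbox p q) (\<lambda>z. w z - ux z) = 0"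
      if pq: "cbox p q \<subseteq> cbox (c k) (d k)" "cbox p q \<noteq> {}" for p q
    proof -
      have p: "{fst p..fst q} \<times> {snd p..snd q} = cbox p q" by (cases p, cases q) auto
      have le: "fst p \<le> fst q" "snd p \<le> snd q"
        using pq(2) unfolding p[symmetric] by auto
      have sub': "cbox p q \<subseteq> {t1<..<t2} \<times> {a<..<b}" using pq sub by blast
      have "(\<lambda>z. w z - ux z) absolutely_integrable_on cbox (fst p, snd p) (fst q, snd q)"
        "integral (cbox (fst p, snd p) (fst q, snd q)) (\<lambda>z. w z - ux z) = 0"
        by (rule weak_pd_eq_classical_on_box[OF wp U];
            use sub' box le in \<open>auto simp: p intro!: deriv continuous_on_subset[OF cont(1)] continuous_on_subset[OF cont(2)]\<close>;
            use sub' in \<open>force simp flip: p\<close>)+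
      then show ?thesis by simp
    qed
    show ?thesis
    proof (rule AE_zero_if_box_integrals_zero)
      show "(\<lambda>z. w z - ux z) absolutely_integrable_on cbox (c k) (d k)" using main False by blast
      show "integral (cbox p q) (\<lambda>z. w z - ux z) = 0" if "cbox p q \<subseteq> cbox (c k) (d k)" for p q
        using main[OF that] by (cases "cbox p q = {}") auto
    qed
  qed
  then have "AE z in lebesgue. \<forall>k. z \<in> box (c k) (d k) \<longrightarrow> w z - ux z = 0"
    by (subst AE_all_countable) blast
  then show ?thesis
  proof (rule eventually_mono, intro impI)
    fix z assume z: "\<forall>k. z \<in> box (c k) (d k) \<longrightarrow> w z - ux z = 0" and in_box: "z \<in> {t1<..<t2} \<times> {a<..<b}"
    obtain t x where tx: "z = (t, x)" by fastforce
    have "0 < Min {t - t1, t2 - t, x - a, b - x}" using in_box tx by auto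
    then obtain k where "inverse (real (Suc k)) < Min {t - t1, t2 - t, x - a, b - x}"
      using reals_Archimedean by blast
    then have "z \<in> box (c k) (d k)"
      unfolding tx c_def d_def e_def by (auto simp: mem_box Basis_prod_def inverse_eq_divide)
    then show "w z = ux z" using z by auto
  qed
qed


section \<open>Passage to the limit\<close>

text \<open>If no point qualified, the empty set would be a closed set containing almost every point
  of \<open>S\<close>, hence all of \<open>S\<close>.\<close>

lemma AE_lebesgue_ex:
  assumes "AE x in lebesgue. P x" "open S" "S \<noteq> {}"
  obtains x where "x \<in> S" "P x"
proof (rule ccontr)
  assume "\<not> thesis"
  then have "AE x\<in>S in lebesgue. x \<in> {}"
    using assms(1) that by (auto elim!: eventually_mono)
  then show False using mem_closed_if_AE_lebesgue_open[OF assms(2) closed_empty] assms(3) by blast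
qed

text \<open>Lebesgue measure on the plane is a completion; the slices are taken for the Borel
  product, where almost everywhere statements agree with those of the completion.\<close>

lemma AE_lebesgue_slices:
  fixes P :: "real \<times> real \<Rightarrow> bool"
  assumes "AE z in lebesgue. P z"
  shows "AE t in lebesgue. AE x in lebesgue. P (t, x)"
proof -
  have "AE z in lborel \<Otimes>\<^sub>M lborel. P z" using assms unfolding lborel_prod AE_completion_iff .
  then have "AE t in lborel. AE x in lborel. P (t, x)" by (rule lborel_pair.AE_pair)
  then show ?thesis by (simp add: AE_completion_iff)
qed

text \<open>Chebyshev's argument: on the interval the density \<open>1 / rho l x\<close> is at least
  \<open>1 / rho l p2\<close>. If \<open>f\<close> exceeded the bound at every point satisfying
  \<open>P\<close>, its weighted integral would be at least \<open>C + 1\<close>.\<close>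

lemma exists_below_average:
  fixes f :: "real \<Rightarrow> real"
  assumes l: "0 \<le> l" and p: "0 < p1" "p1 < p2"
    and f: "Lp (nu l) 1 f" "(LINT x|nu l. \<bar>f x\<bar> powr 1) \<le> C"
    and P: "AE x in lebesgue. 0 < x \<longrightarrow> P x"
  obtains x where "x \<in> {p1<..<p2}" "P x" "f x \<le> (C + 1) * rho l p2 / (p2 - p1)"
proof (rule ccontr)
  assume no: "\<not> thesis"
  define B where "B = (C + 1) * rho l p2 / (p2 - p1)"
  have rho2: "0 < rho l p2" using rho_pos[OF l, of p2] p by auto
  have meas: "(\<lambda>x. 1 / rho l x) \<in> borel_measurable (lebesgue_on Omega)"
    unfolding rho_def by (intro measurable_restrict_space1 measurable_completion) measurable
  have pos: "AE x in lebesgue_on Omega. 0 \<le> 1 / rho l x"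
    by (intro AE_I2) (use rho_pos[OF l] in \<open>auto simp: Omega_def less_imp_le\<close>)
  have fm: "f \<in> borel_measurable (lebesgue_on Omega)"
    using f(1) unfolding Lp_def nu_def by simp
  have intg: "integrable (nu l) (\<lambda>x. \<bar>f x\<bar>)" using f(1) by (simp add: Lp_def)
  then have int: "integrable (lebesgue_on Omega) (\<lambda>x. 1 / rho l x * \<bar>f x\<bar>)"
    unfolding nu_def using fm meas pos by (subst (asm) integrable_density) auto
  have eq: "(LINT x|nu l. \<bar>f x\<bar> powr 1) = (LINT x|lebesgue_on Omega. 1 / rho l x * \<bar>f x\<bar>)"
    unfolding nu_def using fm meas pos by (subst integral_density) auto
  have C: "0 \<le> C" using f(2) by (rule order_trans[rotated]) simp
  define I where "I = {p1<..<p2}"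
  have I: "I \<in> sets lebesgue" "I \<subseteq> Omega" "measure lebesgue I = p2 - p1" "emeasure lebesgue I < \<infinity>"
    using p by (auto simp: I_def Omega_def)
  have Om: "Omega \<in> sets lebesgue" by (simp add: Omega_def)
  have large: "AE x in lebesgue. x \<in> I \<longrightarrow> B < f x"
    using P by (rule eventually_mono) (use no that p in \<open>force simp: I_def B_def not_le\<close>)
  have ind: "integrable lebesgue (\<lambda>x. indicator Omega x *\<^sub>R (1 / rho l x * \<bar>f x\<bar>))"
    using int Om by (simp add: integrable_restrict_space)
  have "(\<integral>x. indicator I x *\<^sub>R (B / rho l p2) \<partial>lebesgue) \<le> (\<integral>x. indicator Omega x *\<^sub>R (1 / rho l x * \<bar>f x\<bar>) \<partial>lebesgue)"
  proof (rule integral_mono_AE[OF _ ind])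
    show "integrable lebesgue (\<lambda>x. indicator I x *\<^sub>R (B / rho l p2))"
      using I by simp
    have key: "B / rho l p2 < 1 / rho l x * \<bar>f x\<bar>" if "x \<in> I" "B < f x" for x
    proof -
      have r: "0 < rho l x" "rho l x \<le> rho l p2"
        using that rho_pos[OF l, of x] rho_mono[OF l, of x p2] p by (auto simp: I_def)
      have "0 \<le> B" using C rho2 p by (simp add: B_def)
      then have "B / rho l p2 \<le> B / rho l x" using r rho2 by (intro divide_left_mono) auto
      also have "\<dots> < \<bar>f x\<bar> / rho l x" using that r \<open>0 \<le> B\<close> by (intro divide_strict_right_mono) auto
      finally show ?thesis by simp
    qed
    show "AE x in lebesgue. indicator I x *\<^sub>R (B / rho l p2) \<le> indicator Omega x *\<^sub>R (1 / rho l x * \<bar>f x\<bar>)"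
      using large
    proof (rule eventually_mono)
      fix x assume "x \<in> I \<longrightarrow> B < f x"
      then show "indicator I x *\<^sub>R (B / rho l p2) \<le> indicator Omega x *\<^sub>R (1 / rho l x * \<bar>f x\<bar>)"
        using key[of x] I rho_pos[OF l, of x] by (auto simp: indicator_def Omega_def less_imp_le)
    qed
  qed
  moreover have "(\<integral>x. indicator I x *\<^sub>R (B / rho l p2) \<partial>lebesgue) = C + 1"
    using I rho2 p by (simp add: B_def)
  moreover have "(LINT x|lebesgue_on Omega. 1 / rho l x * \<bar>f x\<bar>) = (\<integral>x. indicator Omega x *\<^sub>R (1 / rho l x * \<bar>f x\<bar>) \<partial>lebesgue)"
    using Om by (subst integral_restrict_space) auto
  ultimately show False using f(2) eq by simp
qed

text \<open>Adding \<open>1 / n\<close> keeps all derivatives and turns the zero lateral data into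
  \<open>eps\<close>; \<open>v0 \<ge> 0\<close> gives the initial bound. One-sided derivatives
  become two-sided at interior points. The continuity facts serve the later comparison of
  \<open>wx\<close> with the weak derivative.\<close>

lemma regularized_solution_classical:
  assumes sol: "regularized_solution l T n a b \<beta> v0 h v"
    and l: "0 \<le> l" and n: "1 \<le> n" and M: "0 < M" and a: "0 < a"
    and h: "\<And>x. x \<in> {a<..<b} \<Longrightarrow> \<bar>rho l x * h x\<bar> < M"
    and v0: "\<And>x. 0 \<le> v0 x"
  obtains wt wx wxx where "positive_classical_solution l M T (1 / real n) a b h (\<lambda>z. v z + 1 / real n) wt wx wxx"
    and "continuous_on ({0..T} \<times> {a..b}) v" "continuous_on ({0..T} \<times> {a..b}) wx"
proof -
  obtain vt vx vxx where par: "parabolic_C2_beta \<beta> T a b v vt vx vxx"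
    and pde: "\<And>t x. t \<in> {0<..<T} \<Longrightarrow> x \<in> {a<..<b} \<Longrightarrow>
      vt (t, x) = rho l x * (v (t, x) + 1 / real n) * vxx (t, x) + rho l x * h x * (v (t, x) + 1 / real n)"
    and init: "\<And>x. x \<in> {a..b} \<Longrightarrow> v (0, x) = v0 x"
    and lat: "\<And>t. t \<in> {0..T} \<Longrightarrow> v (t, a) = 0 \<and> v (t, b) = 0"
    using sol unfolding regularized_solution_def by blast
  have cont: "continuous_on ({0..T} \<times> {a..b}) v" "continuous_on ({0..T} \<times> {a..b}) vx"
    using par unfolding parabolic_C2_beta_def by auto
  have at: "((\<lambda>s. v (s, x)) has_real_derivative vt (t, x)) (at t)"
    "((\<lambda>y. v (t, y)) has_real_derivative vx (t, x)) (at x)"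
    "((\<lambda>y. vx (t, y)) has_real_derivative vxx (t, x)) (at x)"
    if "t \<in> {0<..<T}" "x \<in> {a<..<b}" for t x
  proof -
    have "((\<lambda>s. v (s, x)) has_real_derivative vt (t, x)) (at t within {0..T}) \<and>
        ((\<lambda>y. v (t, y)) has_real_derivative vx (t, x)) (at x within {a..b}) \<and>
        ((\<lambda>y. vx (t, y)) has_real_derivative vxx (t, x)) (at x within {a..b})"
      using par that unfolding parabolic_C2_beta_def by auto
    then show "((\<lambda>s. v (s, x)) has_real_derivative vt (t, x)) (at t)"
      "((\<lambda>y. v (t, y)) has_real_derivative vx (t, x)) (at x)"
      "((\<lambda>y. vx (t, y)) has_real_derivative vxx (t, x)) (at x)"
      using that by (auto simp: at_within_Icc_at)
  qed
  show thesis
  proof (rule that[OF _ cont])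
    show "positive_classical_solution l M T (1 / real n) a b h (\<lambda>z. v z + 1 / real n) vt vx vxx"
    proof
      show "0 < 1 / real n" using n by simp
      show "continuous_on ({0..T} \<times> {a..b}) (\<lambda>z. v z + 1 / real n)" by (intro continuous_intros cont)
      fix t x assume tx: "t \<in> {0<..<T}" "x \<in> {a<..<b}"
      show "((\<lambda>s. v (s, x) + 1 / real n) has_real_derivative vt (t, x)) (at t)"
        "((\<lambda>y. v (t, y) + 1 / real n) has_real_derivative vx (t, x)) (at x)"
        "((\<lambda>y. vx (t, y)) has_real_derivative vxx (t, x)) (at x)"
        using at[OF tx] by (auto intro!: derivative_eq_intros)
      show "vt (t, x) = rho l x * (v (t, x) + 1 / real n) * vxx (t, x) + rho l x * h x * (v (t, x) + 1 / real n)"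
        by (rule pde[OF tx])
    qed (use l M a h init lat v0 in auto)
  qed
qed

text \<open>The index \<open>k\<close> runs along the convergent subsequence and \<open>w k\<close>
  is the regularized solution raised by \<open>e k\<close>; \<open>conv\<close> refers to the raised
  functions. \<open>mass\<close> supplies the bounds that are uniform in time up to
  \<open>T\<close>.\<close>

locale approximation =
  fixes l M T C0 :: real and e aa bb :: "nat \<Rightarrow> real" and h :: "nat \<Rightarrow> real \<Rightarrow> real"
    and w wt wx wxx :: "nat \<Rightarrow> real \<times> real \<Rightarrow> real" and u :: "real \<times> real \<Rightarrow> real"
  assumes l: "0 \<le> l" and M: "0 < M" and T: "0 < T"
    and sol: "\<And>k. positive_classical_solution l M T (e k) (aa k) (bb k) (h k) (w k) (wt k) (wx k) (wxx k)"
    and aa: "aa \<longlonglongrightarrow> 0" and bb: "filterlim bb at_top sequentially"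
    and conv: "AE z in lebesgue. z \<in> Q T \<longrightarrow> (\<lambda>k. w k z) \<longlonglongrightarrow> u z"
    and mass: "AE t in lebesgue. t \<in> {0<..<T} \<longrightarrow>
      Lp (nu l) 1 (\<lambda>x. u (t, x)) \<and> (LINT x|nu l. \<bar>u (t, x)\<bar> powr 1) \<le> C0"
begin

lemma eventually_inside: "0 < p \<Longrightarrow> eventually (\<lambda>k. aa k < p \<and> q < bb k) sequentially"
  using order_tendstoD(2)[OF aa, of p] filterlim_at_top_dense[THEN iffD1, OF bb, rule_format, of q]
  by (intro eventually_conj)

text \<open>Almost every time slice has convergence at almost every \<open>x\<close> and mass at
  most \<open>C0\<close>, so a point below the average can be chosen among the convergence points.
  The point depends on \<open>t\<close>, the bound does not.\<close>

lemma bounded_convergence_point: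
  assumes "0 < p1" "p1 < p2"
  shows "AE t in lebesgue. t \<in> {0<..<T} \<longrightarrow>
    (\<exists>x\<in>{p1<..<p2}. (\<lambda>k. w k (t, x)) \<longlonglongrightarrow> u (t, x) \<and> u (t, x) \<le> (C0 + 1) * rho l p2 / (p2 - p1))"
  using AE_lebesgue_slices[OF conv] mass
proof eventually_elim
  case (elim t)
  show ?case
  proof
    assume t: "t \<in> {0<..<T}"
    have P: "AE x in lebesgue. 0 < x \<longrightarrow> (\<lambda>k. w k (t, x)) \<longlonglongrightarrow> u (t, x)"
      using elim(1) by (rule eventually_mono) (use t in \<open>auto simp: Q_def Omega_def\<close>)
    have "Lp (nu l) 1 (\<lambda>x. u (t, x))" "(LINT x|nu l. \<bar>u (t, x)\<bar> powr 1) \<le> C0" using elim(2) t by auto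
    from exists_below_average[OF l assms this P]
    show "\<exists>x\<in>{p1<..<p2}. (\<lambda>k. w k (t, x)) \<longlonglongrightarrow> u (t, x) \<and> u (t, x) \<le> (C0 + 1) * rho l p2 / (p2 - p1)"
      by blast
  qed
qed

text \<open>The bound does not depend on \<open>s\<close>; only the index from which on it holds does.\<close>

lemma eventually_bounded_at_endpoints:
  assumes t0: "0 < t0" and pq: "0 < p" "p \<le> q"
  obtains B where "\<And>s. t0 \<le> s \<Longrightarrow> s < T \<Longrightarrow>
    eventually (\<lambda>k. aa k < p \<and> q < bb k \<and> w k (s, p) \<le> B \<and> w k (s, q) \<le> B) sequentially"
proof -
  \<comment> \<open>The intervals \<open>(p / 3, p / 2)\<close> and \<open>(2 * q, 3 * q)\<close>
    flank \<open>[p, q]\<close>, and the dependence on the unknown points \<open>x1\<close>,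
    \<open>x2\<close> in them is absorbed by the values \<open>p / 3\<close> and
    \<open>3 * q\<close>. The summand 1 in \<open>B3\<close> pays for passing from the limit
    \<open>u\<close> back to \<open>w k\<close>.\<close>
  define B1 where "B1 = (C0 + 1) * rho l (p / 2) / (p / 2 - p / 3)"
  define B2 where "B2 = (C0 + 1) * rho l (3 * q) / (3 * q - 2 * q)"
  define B3 where "B3 = max B1 B2 + 1 + (2 * M + 1 / t0) / rho l (p / 3) * (3 * q)\<^sup>2"
  define B where "B = exp ((M + 1 / t0) * T) * B3"
  show thesis
  proof (rule that[of B])
    fix s assume s: "t0 \<le> s" "s < T"
    have I: "0 < p / 3" "p / 3 < p / 2" "0 < 2 * q" "2 * q < 3 * q" using pq by auto
    \<comment> \<open>Good times have full measure but need not include \<open>s\<close>. A strictly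
      later one is chosen, and almost monotonicity carries the bound back to \<open>s\<close> at the
      price of \<open>exp ((M + 1 / t0) * T)\<close>.\<close>
    have "open {s<..<T}" "{s<..<T} \<noteq> {}" using s by auto
    from AE_lebesgue_ex[OF eventually_conj[OF bounded_convergence_point[OF I(1,2)] bounded_convergence_point[OF I(3,4)]] this]
    obtain s' where s': "s' \<in> {s<..<T}"
      and good: "s' \<in> {0<..<T} \<longrightarrow>
      (\<exists>x\<in>{p / 3<..<p / 2}. (\<lambda>k. w k (s', x)) \<longlonglongrightarrow> u (s', x) \<and> u (s', x) \<le> B1)"
      "s' \<in> {0<..<T} \<longrightarrow>
      (\<exists>x\<in>{2 * q<..<3 * q}. (\<lambda>k. w k (s', x)) \<longlonglongrightarrow> u (s', x) \<and> u (s', x) \<le> B2)"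
      unfolding B1_def B2_def by blast
    have s'T: "s' \<in> {0<..<T}" using s' s t0 by auto
    obtain x1 where x1: "x1 \<in> {p / 3<..<p / 2}" "(\<lambda>k. w k (s', x1)) \<longlonglongrightarrow> u (s', x1)" "u (s', x1) \<le> B1"
      using good(1) s'T by blast
    obtain x2 where x2: "x2 \<in> {2 * q<..<3 * q}" "(\<lambda>k. w k (s', x2)) \<longlonglongrightarrow> u (s', x2)" "u (s', x2) \<le> B2"
      using good(2) s'T by blast
    have "eventually (\<lambda>k. w k (s', x1) < max B1 B2 + 1) sequentially"
      "eventually (\<lambda>k. w k (s', x2) < max B1 B2 + 1) sequentially"
      using order_tendstoD(2)[OF x1(2), of "max B1 B2 + 1"] order_tendstoD(2)[OF x2(2), of "max B1 B2 + 1"]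
        x1(3) x2(3) by auto
    moreover have "eventually (\<lambda>k. aa k < x1 \<and> x2 < bb k) sequentially"
      using eventually_inside[of x1 x2] x1 pq by auto
    ultimately show "eventually (\<lambda>k. aa k < p \<and> q < bb k \<and> w k (s, p) \<le> B \<and> w k (s, q) \<le> B) sequentially"
    proof eventually_elim
      case (elim k)
      interpret positive_classical_solution l M T "e k" "aa k" "bb k" "h k" "w k" "wt k" "wx k" "wxx k"
        by (rule sol)
      have ab: "aa k < p" "q < bb k" using elim x1 x2 pq by auto
      have bound: "w k (s, z) \<le> B" if z: "z \<in> {p..q}" for z
      proof -
        have zab: "z \<in> {aa k<..<bb k}" using z ab by auto
        have "w k (s', z) \<le> max B1 B2 + 1 + (2 * M + 1 / t0) / rho l x1 * x2\<^sup>2"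
          by (rule upper_bound_from_endpoints) (use t0 s s' elim z x1 x2 pq in auto)
        also have "\<dots> \<le> B3"
          unfolding B3_def
        proof (intro add_left_mono mult_mono divide_left_mono)
          show "rho l (p / 3) \<le> rho l x1" using rho_mono[OF l, of "p / 3" x1] x1 pq by auto
          show "0 < rho l x1 * rho l (p / 3)" using rho_pos[OF l, of x1] rho_pos[OF l, of "p / 3"] x1 pq by auto
          show "x2\<^sup>2 \<le> (3 * q)\<^sup>2" using x2 pq by (intro power_mono) auto
          show "0 \<le> (2 * M + 1 / t0) / rho l (p / 3)" using M t0 rho_pos[OF l, of "p / 3"] pq by auto
        qed (use M t0 in auto)
        finally have le: "w k (s', z) \<le> B3" .
        have pos': "0 < w k (s', z)" using pos[of s' z] s'T zab by auto
        have "w k (s, z) \<le> exp ((M + 1 / t0) * (s' - s)) * w k (s', z)"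
          using almost_monotone[of t0 s s' z] t0 s s' zab by auto
        also have "(M + 1 / t0) * (s' - s) \<le> (M + 1 / t0) * T"
          using M t0 s s' by (intro mult_left_mono) auto
        then have "exp ((M + 1 / t0) * (s' - s)) * w k (s', z) \<le> exp ((M + 1 / t0) * T) * B3"
          using le pos' by (intro mult_mono) auto
        finally show ?thesis by (simp add: B_def)
      qed
      show ?case using ab bound pq by auto
    qed
  qed
qed

text \<open>Endpoint bounds at \<open>p / 2\<close> and \<open>q + 1\<close> feed the interior
  estimate on \<open>[p, q]\<close>. That \<open>C\<close> precedes \<open>s\<close> lets the limit
  inherit it on all of \<open>[t0, T)\<close>.\<close>

lemma eventually_interior_estimate:
  assumes t0: "0 < t0" and pq: "0 < p" "p \<le> q"
  obtains C where "0 \<le> C"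
    and "\<And>s. t0 \<le> s \<Longrightarrow> s < T \<Longrightarrow> eventually (\<lambda>k. aa k < p \<and> q < bb k \<and>
      (\<forall>t\<in>{t0..s}. \<forall>x\<in>{p..q}. \<bar>w k (t, x)\<bar> \<le> C \<and> \<bar>wx k (t, x)\<bar> \<le> C) \<and>
      (\<forall>t1\<in>{t0..s}. \<forall>t2\<in>{t0..s}. \<forall>x\<in>{p..q}. \<forall>y\<in>{p..q}.
        \<bar>w k (t1, x) - w k (t2, y)\<bar> \<le> C * (\<bar>x - y\<bar> + sqrt \<bar>t1 - t2\<bar>))) sequentially"
proof -
  obtain B where B: "\<And>s. t0 \<le> s \<Longrightarrow> s < T \<Longrightarrow>
    eventually (\<lambda>k. aa k < p / 2 \<and> q + 1 < bb k \<and> w k (s, p / 2) \<le> B \<and> w k (s, q + 1) \<le> B) sequentially"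
    using eventually_bounded_at_endpoints[of t0 "p / 2" "q + 1"] assms by auto
  have half: "0 < p / 2" "p / 2 < p" "p \<le> q" "q < q + 1" using pq by auto
  show thesis
  proof (rule interior_estimate[OF l M t0 half, where B=B and T=T], goal_cases)
    case main: (1 C)
    show thesis
    proof (rule that[OF main(1)])
      fix s assume s: "t0 \<le> s" "s < T"
      from B[OF s] show "eventually (\<lambda>k. aa k < p \<and> q < bb k \<and>
        (\<forall>t\<in>{t0..s}. \<forall>x\<in>{p..q}. \<bar>w k (t, x)\<bar> \<le> C \<and> \<bar>wx k (t, x)\<bar> \<le> C) \<and>
        (\<forall>t1\<in>{t0..s}. \<forall>t2\<in>{t0..s}. \<forall>x\<in>{p..q}. \<forall>y\<in>{p..q}.
          \<bar>w k (t1, x) - w k (t2, y)\<bar> \<le> C * (\<bar>x - y\<bar> + sqrt \<bar>t1 - t2\<bar>))) sequentially"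
      proof eventually_elim
        case (elim k)
        have ab: "aa k < p / 2" "q + 1 < bb k" "w k (s, p / 2) \<le> B" "w k (s, q + 1) \<le> B"
          using elim by auto
        show ?case
          using main(2)[OF sol ab(1,2) s(2) ab(3,4)] main(3)[OF sol ab(1,2) s(2) ab(3,4)] ab pq by auto
      qed
    qed
  qed
qed

text \<open>Equicontinuity upgrades almost everywhere convergence: \<open>w k z\<close> is compared
  with its value at a nearby point of convergence, uniformly in large \<open>k\<close>.\<close>

lemma convergent_everywhere:
  assumes z: "z \<in> Q T"
  shows "convergent (\<lambda>k. w k z)"
proof -
  obtain t x where tx: "z = (t, x)" "0 < t" "t < T" "0 < x" using z by (auto simp: Q_def Omega_def)
  define s where "s = (t + T) / 2"
  have s: "t < s" "s < T" using tx by (auto simp: s_def)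
  have x2: "x \<le> 2 * x" using tx by simp
  obtain C where C: "0 \<le> C" and est0: "\<And>s. t \<le> s \<Longrightarrow> s < T \<Longrightarrow> eventually (\<lambda>k. aa k < x \<and> 2 * x < bb k \<and>
      (\<forall>r\<in>{t..s}. \<forall>y\<in>{x..2 * x}. \<bar>w k (r, y)\<bar> \<le> C \<and> \<bar>wx k (r, y)\<bar> \<le> C) \<and>
      (\<forall>t1\<in>{t..s}. \<forall>t2\<in>{t..s}. \<forall>y\<in>{x..2 * x}. \<forall>z\<in>{x..2 * x}.
        \<bar>w k (t1, y) - w k (t2, z)\<bar> \<le> C * (\<bar>y - z\<bar> + sqrt \<bar>t1 - t2\<bar>))) sequentially"
    apply (rule eventually_interior_estimate[OF tx(2,4) x2])
    subgoal premises prems for C by (rule prems(1)[of C]) (fact prems)+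
    done
  have est: "eventually (\<lambda>k. \<forall>t1\<in>{t..s}. \<forall>t2\<in>{t..s}. \<forall>y\<in>{x..2 * x}. \<forall>z\<in>{x..2 * x}.
        \<bar>w k (t1, y) - w k (t2, z)\<bar> \<le> C * (\<bar>y - z\<bar> + sqrt \<bar>t1 - t2\<bar>)) sequentially"
    by (rule eventually_mono[OF est0[OF less_imp_le[OF s(1)] s(2)]]) blast
  have "Cauchy (\<lambda>k. w k z)"
  proof (rule metric_CauchyI)
    fix \<epsilon> :: real assume \<epsilon>: "0 < \<epsilon>"
    define \<delta> where "\<delta> = \<epsilon> / (8 * (C + 1))"
    have \<delta>: "0 < \<delta>" "C * (\<delta> + \<delta>) < \<epsilon> / 3"
    proof -
      show "0 < \<delta>" using \<epsilon> C by (simp add: \<delta>_def)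
      have "C * (\<delta> + \<delta>) \<le> (C + 1) * (\<delta> + \<delta>)" using \<open>0 < \<delta>\<close> by (intro mult_right_mono) auto
      also have "\<dots> = \<epsilon> / 4" using C by (simp add: \<delta>_def divide_simps)
      finally show "C * (\<delta> + \<delta>) < \<epsilon> / 3" using \<epsilon> by simp
    qed
    \<comment> \<open>Times within \<open>\<delta>\<^sup>2\<close> and points within
      \<open>\<delta>\<close> keep \<open>\<bar>x - y\<bar> + sqrt \<bar>t - t'\<bar>\<close> below
      \<open>2 * \<delta>\<close>. The box lies in \<open>[t, s] \<times> [x, 2 * x]\<close>, where
      \<open>est\<close> applies.\<close>
    define S where "S = {t<..<min s (t + \<delta>\<^sup>2)} \<times> {x<..<min (2 * x) (x + \<delta>)}"
    have "(t + min s (t + \<delta>\<^sup>2)) / 2 \<in> {t<..<min s (t + \<delta>\<^sup>2)}" "(x + min (2 * x) (x + \<delta>)) / 2 \<in> {x<..<min (2 * x) (x + \<delta>)}"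
      using \<delta> s tx by (auto simp: min_def)
    then have "S \<noteq> {}" unfolding S_def by blast
    moreover have "open S" unfolding S_def by (intro open_Times) auto
    ultimately obtain z' where z': "z' \<in> S" "z' \<in> Q T \<longrightarrow> (\<lambda>k. w k z') \<longlonglongrightarrow> u z'"
      using AE_lebesgue_ex[OF conv] by blast
    obtain t' y where ty: "z' = (t', y)" by fastforce
    have t': "t < t'" "t' < s" "t' - t < \<delta>\<^sup>2" and y: "x < y" "y < 2 * x" "y - x < \<delta>"
      using z'(1) by (auto simp: S_def ty)
    have "z' \<in> Q T" using t' y s tx by (auto simp: ty Q_def Omega_def)
    then have "Cauchy (\<lambda>k. w k z')" using z'(2) by (auto intro: LIMSEQ_imp_Cauchy)
    then obtain N1 where N1: "\<And>m n. N1 \<le> m \<Longrightarrow> N1 \<le> n \<Longrightarrow> dist (w m z') (w n z') < \<epsilon> / 3"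
      using metric_CauchyD[of "\<lambda>k. w k z'" "\<epsilon> / 3"] \<epsilon> by auto
    have "sqrt (t' - t) < \<delta>" using t' \<delta> by (intro real_less_lsqrt) auto
    then have "\<bar>x - y\<bar> + sqrt \<bar>t - t'\<bar> \<le> \<delta> + \<delta>" using t' y by (auto simp: abs_minus_commute[of t])
    then have small: "C * (\<bar>x - y\<bar> + sqrt \<bar>t - t'\<bar>) < \<epsilon> / 3"
      using mult_left_mono[OF _ C] \<delta>(2) by fastforce
    have "eventually (\<lambda>k. \<bar>w k z - w k z'\<bar> < \<epsilon> / 3) sequentially"
      using est
    proof eventually_elim
      case (elim k)
      have "\<bar>w k (t, x) - w k (t', y)\<bar> \<le> C * (\<bar>x - y\<bar> + sqrt \<bar>t - t'\<bar>)"
        by (rule elim[rule_format]) (use t' y s in auto)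
      then show ?case using small by (simp add: tx ty)
    qed
    then obtain N2 where N2: "\<And>k. N2 \<le> k \<Longrightarrow> \<bar>w k z - w k z'\<bar> < \<epsilon> / 3"
      unfolding eventually_sequentially by blast
    have "dist (w m z) (w n z) < \<epsilon>" if "max N1 N2 \<le> m" "max N1 N2 \<le> n" for m n
      using N1[of m n] N2[of m] N2[of n] that unfolding dist_real_def by (auto simp: abs_if split: if_splits)
    then show "\<exists>N. \<forall>m\<ge>N. \<forall>n\<ge>N. dist (w m z) (w n z) < \<epsilon>" by blast
  qed
  then show ?thesis by (rule Cauchy_convergent)
qed

definition v :: "real \<times> real \<Rightarrow> real" where
  "v z = lim (\<lambda>k. w k z)"

lemma w_tendsto: "z \<in> Q T \<Longrightarrow> (\<lambda>k. w k z) \<longlonglongrightarrow> v z"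
  unfolding v_def using convergent_everywhere convergent_LIMSEQ_iff by blast

lemma v_eq_u: "AE z in lebesgue. z \<in> Q T \<longrightarrow> v z = u z"
  using conv by (rule eventually_mono) (use w_tendsto LIMSEQ_unique in blast)

text \<open>For given times below \<open>T\<close> the eventual estimate is used with
  \<open>s\<close> the latest of them, and weak inequalities survive the limit. The gradient bound
  stays with \<open>wx k\<close>, since \<open>v\<close> is not known to be differentiable.\<close>

lemma limit_estimate:
  assumes t0: "0 < t0" and pq: "0 < p" "p \<le> q"
  obtains C where "0 \<le> C"
    and "\<And>t x. t \<in> {t0..<T} \<Longrightarrow> x \<in> {p..q} \<Longrightarrow> \<bar>v (t, x)\<bar> \<le> C"
    and "\<And>t1 t2 x y. t1 \<in> {t0..<T} \<Longrightarrow> t2 \<in> {t0..<T} \<Longrightarrow> x \<in> {p..q} \<Longrightarrow> y \<in> {p..q} \<Longrightarrow>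
      \<bar>v (t1, x) - v (t2, y)\<bar> \<le> C * (\<bar>x - y\<bar> + sqrt \<bar>t1 - t2\<bar>)"
    and "\<And>t x. t \<in> {t0..<T} \<Longrightarrow> x \<in> {p..q} \<Longrightarrow>
      eventually (\<lambda>k. aa k < x \<and> x < bb k \<and> \<bar>wx k (t, x)\<bar> \<le> C) sequentially"
proof -
  obtain C where C: "0 \<le> C"
    and ev: "\<And>s. t0 \<le> s \<Longrightarrow> s < T \<Longrightarrow> eventually (\<lambda>k. aa k < p \<and> q < bb k \<and>
      (\<forall>t\<in>{t0..s}. \<forall>x\<in>{p..q}. \<bar>w k (t, x)\<bar> \<le> C \<and> \<bar>wx k (t, x)\<bar> \<le> C) \<and>
      (\<forall>t1\<in>{t0..s}. \<forall>t2\<in>{t0..s}. \<forall>x\<in>{p..q}. \<forall>y\<in>{p..q}.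
        \<bar>w k (t1, x) - w k (t2, y)\<bar> \<le> C * (\<bar>x - y\<bar> + sqrt \<bar>t1 - t2\<bar>))) sequentially"
    apply (rule eventually_interior_estimate[OF assms])
    subgoal premises prems for C by (rule prems(1)[of C]) (fact prems)+
    done
  have inQ: "(t, x) \<in> Q T" if "t \<in> {t0..<T}" "x \<in> {p..q}" for t x
    using that assms by (auto simp: Q_def Omega_def)
  show thesis
  proof (rule that[OF C])
    fix t x assume t: "t \<in> {t0..<T}" and x: "x \<in> {p..q}"
    have ev': "eventually (\<lambda>k. aa k < x \<and> x < bb k \<and> \<bar>w k (t, x)\<bar> \<le> C \<and> \<bar>wx k (t, x)\<bar> \<le> C) sequentially"
    proof -
      have "t0 \<le> t" "t < T" using t by auto
      from ev[OF this] show ?thesis by (rule eventually_mono) (use t x in auto)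
    qed
    then show "eventually (\<lambda>k. aa k < x \<and> x < bb k \<and> \<bar>wx k (t, x)\<bar> \<le> C) sequentially"
      by (rule eventually_mono) auto
    show "\<bar>v (t, x)\<bar> \<le> C"
      by (rule tendsto_upperbound[OF tendsto_rabs[OF w_tendsto[OF inQ[OF t x]]]])
        (use ev' in \<open>auto elim!: eventually_mono\<close>)
  next
    fix t1 t2 x y assume t: "t1 \<in> {t0..<T}" "t2 \<in> {t0..<T}" and x: "x \<in> {p..q}" "y \<in> {p..q}"
    show "\<bar>v (t1, x) - v (t2, y)\<bar> \<le> C * (\<bar>x - y\<bar> + sqrt \<bar>t1 - t2\<bar>)"
    proof (rule tendsto_upperbound[OF tendsto_rabs[OF tendsto_diff[OF w_tendsto w_tendsto]]])
      show "eventually (\<lambda>k. \<bar>w k (t1, x) - w k (t2, y)\<bar> \<le> C * (\<bar>x - y\<bar> + sqrt \<bar>t1 - t2\<bar>)) sequentially"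
      proof -
        have m: "t0 \<le> max t1 t2" "max t1 t2 < T" using t by auto
        show ?thesis by (rule eventually_mono[OF ev[OF m]]) (use t x in auto)
      qed
    qed (use inQ t x in auto)
  qed
qed

text \<open>The representative is also needed at \<open>t = T\<close>, which lies outside \<open>Q\<^sub>T\<close>.\<close>

definition time_seq :: "nat \<Rightarrow> real \<Rightarrow> real" where
  "time_seq j t = (if t < T then t else T - T / real (j + 2))"

text \<open>For \<open>t < T\<close> the sequence of times is constant and the value is that of
  \<open>v\<close>; at \<open>t = T\<close> it is the limit along times in
  \<open>[T / 2, T)\<close>, the shift by 2 in \<open>time_seq\<close> keeping them
  positive.\<close>

definition extended :: "real \<times> real \<Rightarrow> real" where
  "extended z = lim (\<lambda>j. v (time_seq j (fst z), snd z))"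

lemma time_seq_tendsto: "t \<le> T \<Longrightarrow> (\<lambda>j. time_seq j t) \<longlonglongrightarrow> t"
proof (cases "t < T")
  case False
  assume "t \<le> T"
  have "(\<lambda>j. T - T * (1 / real (j + 2))) \<longlonglongrightarrow> T - T * 0"
    by (intro tendsto_intros LIMSEQ_ignore_initial_segment lim_1_over_n)
  then show ?thesis using False \<open>t \<le> T\<close> by (simp add: time_seq_def)
qed (simp add: time_seq_def)

lemma time_seq_less: "t \<le> T \<Longrightarrow> time_seq j t < T"
  using T by (simp add: time_seq_def)

lemma extended_eq: "z \<in> Q T \<Longrightarrow> extended z = v z"
  by (auto simp: extended_def time_seq_def Q_def)

text \<open>At \<open>t = T\<close> the values form a Cauchy sequence because the Hoelder constant
  of \<open>v\<close> in time does not deteriorate towards \<open>T\<close>.\<close>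

lemma extended_tendsto:
  assumes t: "0 < t" "t \<le> T" and x: "0 < x"
  shows "(\<lambda>j. v (time_seq j t, x)) \<longlonglongrightarrow> extended (t, x)"
proof (cases "t < T")
  case False
  define t0 where "t0 = t / 2"
  have t0: "0 < t0" "t0 < t" using t by (auto simp: t0_def)
  obtain C where C: "0 \<le> C" and est: "\<And>t1 t2. t1 \<in> {t0..<T} \<Longrightarrow> t2 \<in> {t0..<T} \<Longrightarrow>
      \<bar>v (t1, x) - v (t2, x)\<bar> \<le> C * sqrt \<bar>t1 - t2\<bar>"
  proof (rule limit_estimate[OF t0(1) x order_refl])
    fix C assume "0 \<le> C" and "\<And>t1 t2 y z. t1 \<in> {t0..<T} \<Longrightarrow> t2 \<in> {t0..<T} \<Longrightarrow> y \<in> {x..x} \<Longrightarrow> z \<in> {x..x} \<Longrightarrow>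
      \<bar>v (t1, y) - v (t2, z)\<bar> \<le> C * (\<bar>y - z\<bar> + sqrt \<bar>t1 - t2\<bar>)"
    from this(1) this(2)[of _ _ x x] show thesis by (intro that[of C]) auto
  qed
  have in_range: "time_seq j t \<in> {t0..<T}" for j
  proof -
    have "T / real (j + 2) \<le> T / 2" using T by (intro divide_left_mono) auto
    then show ?thesis using False t T by (auto simp: time_seq_def t0_def)
  qed
  have "Cauchy (\<lambda>j. v (time_seq j t, x))"
  proof (rule metric_CauchyI)
    fix \<epsilon> :: real assume \<epsilon>: "0 < \<epsilon>"
    define \<delta> where "\<delta> = \<epsilon> / (C + 1)"
    have \<delta>: "0 < \<delta>" using \<epsilon> C by (simp add: \<delta>_def)
    have "Cauchy (\<lambda>j. time_seq j t)" using time_seq_tendsto[OF t(2)] by (rule LIMSEQ_imp_Cauchy)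
    then obtain N where N: "\<And>m n. N \<le> m \<Longrightarrow> N \<le> n \<Longrightarrow> dist (time_seq m t) (time_seq n t) < \<delta>\<^sup>2"
      using metric_CauchyD[of "\<lambda>j. time_seq j t" "\<delta>\<^sup>2"] \<delta> by auto
    have "dist (v (time_seq m t, x)) (v (time_seq n t, x)) < \<epsilon>" if "N \<le> m" "N \<le> n" for m n
    proof -
      have "sqrt \<bar>time_seq m t - time_seq n t\<bar> < \<delta>"
        using N[OF that] \<delta> by (intro real_less_lsqrt) (auto simp: dist_real_def)
      then have "C * sqrt \<bar>time_seq m t - time_seq n t\<bar> \<le> C * \<delta>" using C by (intro mult_left_mono) auto
      also have "\<dots> < \<epsilon>" using \<epsilon> C by (simp add: \<delta>_def field_simps)
      finally show ?thesis using est[OF in_range in_range, of m n] by (simp add: dist_real_def)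
    qed
    then show "\<exists>N. \<forall>m\<ge>N. \<forall>n\<ge>N. dist (v (time_seq m t, x)) (v (time_seq n t, x)) < \<epsilon>" by blast
  qed
  then show ?thesis
    unfolding extended_def fst_conv snd_conv using Cauchy_convergent convergent_LIMSEQ_iff by blast
qed (simp add: extended_def time_seq_def)

lemma extended_estimate:
  assumes t0: "0 < t0" and pq: "0 < p" "p \<le> q"
  obtains C where "0 \<le> C"
    and "\<And>t x. t \<in> {t0..T} \<Longrightarrow> x \<in> {p..q} \<Longrightarrow> \<bar>extended (t, x)\<bar> \<le> C"
    and "\<And>t1 t2 x y. t1 \<in> {t0..T} \<Longrightarrow> t2 \<in> {t0..T} \<Longrightarrow> x \<in> {p..q} \<Longrightarrow> y \<in> {p..q} \<Longrightarrow>
      \<bar>extended (t1, x) - extended (t2, y)\<bar> \<le> C * (\<bar>x - y\<bar> + sqrt \<bar>t1 - t2\<bar>)"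
    and "\<And>t x. t \<in> {t0..<T} \<Longrightarrow> x \<in> {p..q} \<Longrightarrow>
      eventually (\<lambda>k. aa k < x \<and> x < bb k \<and> \<bar>wx k (t, x)\<bar> \<le> C) sequentially"
proof -
  \<comment> \<open>The estimates are taken from \<open>t0 / 2\<close> on, because the times
    approximating \<open>T\<close> may fall below \<open>t0\<close>.\<close>
  obtain C where C: "0 \<le> C"
    and bound: "\<And>t x. t \<in> {t0 / 2..<T} \<Longrightarrow> x \<in> {p..q} \<Longrightarrow> \<bar>v (t, x)\<bar> \<le> C"
    and holder: "\<And>t1 t2 x y. t1 \<in> {t0 / 2..<T} \<Longrightarrow> t2 \<in> {t0 / 2..<T} \<Longrightarrow> x \<in> {p..q} \<Longrightarrow> y \<in> {p..q} \<Longrightarrow>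
      \<bar>v (t1, x) - v (t2, y)\<bar> \<le> C * (\<bar>x - y\<bar> + sqrt \<bar>t1 - t2\<bar>)"
    and grad: "\<And>t x. t \<in> {t0 / 2..<T} \<Longrightarrow> x \<in> {p..q} \<Longrightarrow>
      eventually (\<lambda>k. aa k < x \<and> x < bb k \<and> \<bar>wx k (t, x)\<bar> \<le> C) sequentially"
    apply (rule limit_estimate[OF half_gt_zero[OF t0] pq])
    subgoal premises prems for C by (rule prems(1)[of C]) (fact prems)+
    done
  have ev: "eventually (\<lambda>j. time_seq j t \<in> {t0 / 2..<T}) sequentially" if "t \<in> {t0..T}" for t
    using order_tendstoD(1)[OF time_seq_tendsto, of t "t0 / 2"] that t0 time_seq_less[of t]
    by (auto elim!: eventually_mono)
  show thesis
  proof (rule that[OF C])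
    fix t x assume t: "t \<in> {t0..T}" and x: "x \<in> {p..q}"
    show "\<bar>extended (t, x)\<bar> \<le> C"
      by (rule tendsto_upperbound[OF tendsto_rabs[OF extended_tendsto]])
        (use t x t0 pq ev[OF t] bound in \<open>auto elim!: eventually_mono\<close>)
  next
    fix t1 t2 x y assume t: "t1 \<in> {t0..T}" "t2 \<in> {t0..T}" and x: "x \<in> {p..q}" "y \<in> {p..q}"
    show "\<bar>extended (t1, x) - extended (t2, y)\<bar> \<le> C * (\<bar>x - y\<bar> + sqrt \<bar>t1 - t2\<bar>)"
    proof (rule tendsto_le[OF trivial_limit_sequentially])
      show "(\<lambda>j. C * (\<bar>x - y\<bar> + sqrt \<bar>time_seq j t1 - time_seq j t2\<bar>)) \<longlonglongrightarrow> C * (\<bar>x - y\<bar> + sqrt \<bar>t1 - t2\<bar>)"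
        by (intro tendsto_intros time_seq_tendsto) (use t in auto)
      show "(\<lambda>j. \<bar>v (time_seq j t1, x) - v (time_seq j t2, y)\<bar>) \<longlonglongrightarrow> \<bar>extended (t1, x) - extended (t2, y)\<bar>"
        by (intro tendsto_intros extended_tendsto) (use t x t0 pq in auto)
      show "eventually (\<lambda>j. \<bar>v (time_seq j t1, x) - v (time_seq j t2, y)\<bar> \<le>
          C * (\<bar>x - y\<bar> + sqrt \<bar>time_seq j t1 - time_seq j t2\<bar>)) sequentially"
        using ev[OF t(1)] ev[OF t(2)] by eventually_elim (use holder x in blast)
    qed
  next
    fix t x assume "t \<in> {t0..<T}" "x \<in> {p..q}"
    then show "eventually (\<lambda>k. aa k < x \<and> x < bb k \<and> \<bar>wx k (t, x)\<bar> \<le> C) sequentially"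
      using grad[of t x] t0 by auto
  qed
qed

end

section \<open>Hoelder norms, and invariance under changes on null sets\<close>

lemma holder_norm_finite:
  assumes S: "S \<subseteq> {t0..T} \<times> {p..q}"
    and bound: "\<And>z. z \<in> S \<Longrightarrow> \<bar>f z\<bar> \<le> C"
    and holder: "\<And>z w. z \<in> S \<Longrightarrow> w \<in> S \<Longrightarrow> \<bar>f z - f w\<bar> \<le> C * (\<bar>snd z - snd w\<bar> + sqrt \<bar>fst z - fst w\<bar>)"
    and C: "0 \<le> C"
  shows "holder_norm (1 / 2) S f < \<infinity>"
proof -
  \<comment> \<open>On a bounded set one half of each exponent can be traded for a power of the
    diameter, which weakens Lipschitz continuity in \<open>x\<close> and order 1/2 in time to the
    parabolic exponents 1/2 and 1/4.\<close>
  define K where "K = C * (sqrt (q - p) + (T - t0) powr (1 / 4))"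
  have quot: "\<bar>f z - f w\<bar> / (\<bar>snd z - snd w\<bar> powr (1 / 2) + \<bar>fst z - fst w\<bar> powr (1 / 2 / 2)) \<le> K"
    if zw: "z \<in> S" "w \<in> S" "z \<noteq> w" for z w
  proof -
    define X where "X = \<bar>snd z - snd w\<bar>"
    define Y where "Y = \<bar>fst z - fst w\<bar>"
    have z: "fst z \<in> {t0..T}" "snd z \<in> {p..q}" and w: "fst w \<in> {t0..T}" "snd w \<in> {p..q}"
      using zw S by auto
    have XY: "0 \<le> X" "X \<le> q - p" "0 \<le> Y" "Y \<le> T - t0" using z w by (auto simp: X_def Y_def)
    have "X \<noteq> 0 \<or> Y \<noteq> 0" using zw(3) by (auto simp: X_def Y_def prod_eq_iff)
    then have den: "0 < X powr (1 / 2) + Y powr (1 / 4)"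
      using XY by (auto intro: add_pos_nonneg add_nonneg_pos)
    have "X = X powr (1 / 2) * X powr (1 / 2)" using XY by (simp flip: powr_add)
    also have "\<dots> \<le> sqrt (q - p) * X powr (1 / 2)"
      using XY by (intro mult_right_mono) (auto simp: powr_half_sqrt)
    finally have 1: "X \<le> sqrt (q - p) * X powr (1 / 2)" .
    have "sqrt Y = Y powr (1 / 4) * Y powr (1 / 4)" using XY by (simp add: powr_half_sqrt flip: powr_add)
    also have "\<dots> \<le> (T - t0) powr (1 / 4) * Y powr (1 / 4)"
      using XY by (intro mult_right_mono powr_mono2) auto
    finally have 2: "sqrt Y \<le> (T - t0) powr (1 / 4) * Y powr (1 / 4)" .
    have "\<bar>f z - f w\<bar> \<le> C * (X + sqrt Y)" using holder[OF zw(1,2)] by (simp add: X_def Y_def)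
    also have "\<dots> \<le> C * ((sqrt (q - p) + (T - t0) powr (1 / 4)) * (X powr (1 / 2) + Y powr (1 / 4)))"
    proof (rule mult_left_mono[OF _ C])
      have "0 \<le> sqrt (q - p) * Y powr (1 / 4)" using XY by simp
      moreover have "0 \<le> (T - t0) powr (1 / 4) * X powr (1 / 2)" by simp
      ultimately show "X + sqrt Y \<le> (sqrt (q - p) + (T - t0) powr (1 / 4)) * (X powr (1 / 2) + Y powr (1 / 4))"
        using 1 2 unfolding distrib_left distrib_right by linarith
    qed
    finally have "\<bar>f z - f w\<bar> \<le> K * (X powr (1 / 2) + Y powr (1 / 4))" by (simp add: K_def mult.assoc)
    then show ?thesis using den by (simp add: X_def Y_def pos_divide_le_eq)
  qed
  have "(SUP z\<in>S. ennreal \<bar>f z\<bar>) \<le> ennreal C"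
    using bound by (intro SUP_least ennreal_leI) auto
  moreover have "(SUP (z, w)\<in>{(z, w). z \<in> S \<and> w \<in> S \<and> z \<noteq> w}.
        ennreal (\<bar>f z - f w\<bar> / (\<bar>snd z - snd w\<bar> powr (1 / 2) + \<bar>fst z - fst w\<bar> powr (1 / 2 / 2)))) \<le> ennreal K"
    using quot by (intro SUP_least) (auto intro!: ennreal_leI)
  ultimately have "holder_norm (1 / 2) S f \<le> ennreal C + ennreal K"
    unfolding holder_norm_def by (rule add_mono)
  also have "\<dots> < \<infinity>" by simp
  finally show ?thesis .
qed

text \<open>Completeness of \<open>lebesgue\<close> transfers measurability across almost everywhere
  equality.\<close>

lemma Lp_loc_cong_AE:
  fixes f g :: "'a::euclidean_space \<Rightarrow> real"
  assumes U: "U \<in> sets lebesgue" and eq: "AE z in lebesgue. z \<in> U \<longrightarrow> f z = g z" and f: "Lp_loc lebesgue U p f"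
  shows "Lp_loc lebesgue U p g"
  unfolding Lp_loc_def Lp_def
proof (intro allI impI)
  fix K assume K: "compact K \<and> K \<subseteq> U"
  then have Ks: "K \<in> sets lebesgue" by (simp add: borel_compact)
  have fK: "f \<in> borel_measurable (lebesgue_on K)" "integrable (lebesgue_on K) (\<lambda>x. \<bar>f x\<bar> powr p)"
    using f K unfolding Lp_loc_def Lp_def by auto
  have "(\<lambda>x. if x \<in> K then f x else 0) \<in> borel_measurable lebesgue"
    using fK(1) Ks by (simp add: borel_measurable_if)
  moreover have "AE x in lebesgue. (if x \<in> K then f x else 0) = (if x \<in> K then g x else 0)"
    using eq by (rule eventually_mono) (use K in auto)
  ultimately have "(\<lambda>x. if x \<in> K then g x else 0) \<in> borel_measurable lebesgue"
    by (rule borel_measurable_AE)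
  then have gK: "g \<in> borel_measurable (lebesgue_on K)"
    using Ks by (simp add: borel_measurable_if)
  have "AE x in lebesgue_on K. f x = g x"
    using eq Ks K by (subst AE_restrict_space_iff) (auto elim!: eventually_mono)
  then have "AE x in lebesgue_on K. \<bar>f x\<bar> powr p = \<bar>g x\<bar> powr p" by (rule eventually_mono) simp
  moreover have "(\<lambda>x. \<bar>g x\<bar> powr p) \<in> borel_measurable (lebesgue_on K)"
    using gK by measurable
  ultimately have "integrable (lebesgue_on K) (\<lambda>x. \<bar>g x\<bar> powr p)"
    using fK(2) by (subst integrable_cong_AE[symmetric]) auto
  then show "g \<in> borel_measurable (lebesgue_on K) \<and> integrable (lebesgue_on K) (\<lambda>x. \<bar>g x\<bar> powr p)"
    using gK by simp
qed

text \<open>By completeness \<open>f\<close> and \<open>g\<close> are measurable together; if they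
  are not, neither is integrable and both integrals take the default value 0.\<close>

lemma lebesgue_integral_cong_AE:
  fixes f g :: "'a::euclidean_space \<Rightarrow> real"
  assumes eq: "AE z in lebesgue. f z = g z"
  shows "(LINT z|lebesgue. f z) = (LINT z|lebesgue. g z)"
proof (cases "f \<in> borel_measurable lebesgue")
  case True
  then show ?thesis using borel_measurable_AE[OF True eq] eq by (intro integral_cong_AE)
next
  case False
  have "AE z in lebesgue. g z = f z" using eq by (auto elim!: eventually_mono)
  then have "g \<notin> borel_measurable lebesgue" using False borel_measurable_AE[of g f] by blast
  then show ?thesis using False by (metis borel_measurable_integrable not_integrable_integral_eq)
qed

lemma weak_pd_cong_AE:
  fixes f g :: "'a::euclidean_space \<Rightarrow> real"
  assumes U: "U \<in> sets lebesgue" and eq: "AE z in lebesgue. z \<in> U \<longrightarrow> f z = g z"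
  shows "weak_pd b U f w \<longleftrightarrow> weak_pd b U g w"
proof -
  have eq': "AE z in lebesgue. z \<in> U \<longrightarrow> g z = f z" using eq by (auto elim!: eventually_mono)
  have Lp: "Lp_loc lebesgue U 1 f \<longleftrightarrow> Lp_loc lebesgue U 1 g"
    using Lp_loc_cong_AE[OF U eq] Lp_loc_cong_AE[OF U eq'] by blast
  have "(LINT z|lebesgue_on U. f z * pd b \<phi> z) = (LINT z|lebesgue_on U. g z * pd b \<phi> z)" for \<phi>
    using U by (subst (1 2) integral_restrict_space)
      (auto intro!: lebesgue_integral_cong_AE eventually_mono[OF eq] simp: indicator_def)
  then show ?thesis using Lp unfolding weak_pd_def by simp
qed


text \<open>\<open>D\<close> is merely Lebesgue measurable, so it is split into a Borel set and a
  subset of a Borel null set; the product of \<open>I\<close> with the latter is null for the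
  completed plane measure.\<close>

lemma times_in_sets_lebesgue:
  fixes I :: "real set" and D :: "real set"
  assumes I: "I \<in> sets borel" and D: "D \<in> sets lebesgue"
  shows "I \<times> D \<in> sets lebesgue"
proof -
  obtain S N N' where SN: "D = S \<union> N" "N \<subseteq> N'" "N' \<in> null_sets lborel" "S \<in> sets lborel"
    using sets_completionE[OF D] by metis
  have N': "N' \<in> sets lborel" "emeasure lborel N' = 0" using SN(3) by (auto simp: null_sets_def)
  then have "emeasure (lborel \<Otimes>\<^sub>M lborel) (I \<times> N') = emeasure lborel I * emeasure lborel N'"
    using I by (intro lborel.emeasure_pair_measure_Times) auto
  then have "I \<times> N' \<in> null_sets (lborel \<Otimes>\<^sub>M lborel)"
    using I N' by (intro null_setsI pair_measureI) auto
  then have "I \<times> N' \<in> null_sets lebesgue" unfolding lborel_prod by (rule null_sets_completionI)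
  then have "I \<times> N \<in> null_sets lebesgue"
    by (rule completion.complete2[rotated]) (use SN in auto)
  moreover have "I \<times> S \<in> sets lebesgue"
    using I SN(4) by (auto intro!: borel_Times)
  ultimately have "I \<times> S \<union> I \<times> N \<in> sets lebesgue" by auto
  then show ?thesis by (simp add: SN(1) Times_Un_distrib1 Sigma_Un_distrib2)
qed

text \<open>For continuous \<open>f\<close> the bound is a closed condition; holding almost
  everywhere in an open set, it holds everywhere there. It turns the norm bounds on
  \<open>rho l x * gn n x\<close> into pointwise ones.\<close>

lemma Linf_norm_continuous_bound:
  fixes f :: "real \<Rightarrow> real"
  assumes cont: "continuous_on UNIV f" and bound: "Linf_norm (lebesgue_on Omega) f \<le> ereal C" and x: "0 < x"
  shows "\<bar>f x\<bar> \<le> C"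
proof -
  have Om: "open Omega" "Omega \<in> sets lebesgue" by (auto simp: Omega_def)
  have "AE x in lebesgue_on Omega. ereal \<bar>f x\<bar> \<le> Linf_norm (lebesgue_on Omega) f"
    unfolding Linf_norm_def by (rule esssup_AE)
  then have "AE x in lebesgue_on Omega. \<bar>f x\<bar> \<le> C"
    by (rule eventually_mono) (use bound in \<open>metis ereal_less_eq(3) order_trans\<close>)
  then have "AE x\<in>Omega in lebesgue. x \<in> {x. \<bar>f x\<bar> \<le> C}"
    using Om by (simp add: AE_restrict_space_iff)
  moreover have "closed {x. \<bar>f x\<bar> \<le> C}"
    by (intro closed_Collect_le continuous_intros cont)
  ultimately show ?thesis
    using mem_closed_if_AE_lebesgue_open[OF Om(1)] x by (force simp: Omega_def)
qed

lemma compact_in_strip: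
  fixes K :: "(real \<times> real) set"
  assumes K: "compact K" "K \<subseteq> {0<..T} \<times> Omega" "K \<noteq> {}"
  obtains t0 p q where "0 < t0" "0 < p" "p \<le> q" "K \<subseteq> {t0..T} \<times> {p..q}"
proof -
  have "continuous_on K fst" "continuous_on K snd" by (intro continuous_intros)+
  then obtain z1 z2 z3 where z: "z1 \<in> K" "z2 \<in> K" "z3 \<in> K"
    and le: "\<And>z. z \<in> K \<Longrightarrow> fst z1 \<le> fst z" "\<And>z. z \<in> K \<Longrightarrow> snd z2 \<le> snd z" "\<And>z. z \<in> K \<Longrightarrow> snd z \<le> snd z3"
    using continuous_attains_inf[OF K(1,3), of fst] continuous_attains_inf[OF K(1,3), of snd]
      continuous_attains_sup[OF K(1,3), of snd] by blast
  show thesis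
  proof (rule that[of "fst z1" "snd z2" "snd z3"])
    show "0 < fst z1" "0 < snd z2" using z K(2) by (auto simp: Omega_def)
    show "snd z2 \<le> snd z3" using le z by blast
    show "K \<subseteq> {fst z1..T} \<times> {snd z2..snd z3}" using le K(2) by fastforce
  qed
qed

section \<open>The Hoelder continuous representative\<close>

theorem theorem1p4:
  fixes l T \<delta> :: real and g u0 :: "real \<Rightarrow> real" and u :: "real \<times> real \<Rightarrow> real"
  assumes "0 \<le> l" and "0 < T"
    and "hypothesis_H l \<delta> g u0"
    and "constructed_weak_solution l T \<delta> g u0 u"
  shows "\<exists>v. (AE z in lebesgue_on (Q T). v z = u z) \<and>
     has_wdx T v \<and>
     locally_holder (1/2) ({0<..T} \<times> Omega) v \<and>
     locally_lipschitz_x ({0<..T} \<times> Omega) v \<and>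
     (\<forall>t0 D. 0 < t0 \<and> t0 < T \<and> D \<in> sets lebesgue \<and> compact (closure D) \<and> closure D \<subseteq> Omega \<longrightarrow>
        holder_norm (1/2) ({t0<..<T} \<times> D) v < \<infinity> \<and>
        Linf (lebesgue_on ({t0<..<T} \<times> D)) (wdx T v))"
proof -
  have Q: "open (Q T)" "Q T \<in> sets lebesgue"
    unfolding Q_def Omega_def by (auto intro!: open_Times borel_open lborelD)
  have Om: "Omega \<in> sets lebesgue" by (simp add: Omega_def)
  have AE_Q: "(AE z in lebesgue_on (Q T). P z) \<longleftrightarrow> (AE z in lebesgue. z \<in> Q T \<longrightarrow> P z)" for P
    using Q by (simp add: AE_restrict_space_iff)
  from assms(4) obtain a b r \<beta> u0n gn un \<sigma> where
    data: "admissible_data l \<delta> g u0 a b r \<beta> u0n gn"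
    and reg: "\<And>n. 1 \<le> n \<Longrightarrow> regularized_solution l T n (a n) (b n) (\<beta> n) (u0n n) (gn n) (un n)"
    and \<sigma>: "strict_mono \<sigma>" "\<And>k. 1 \<le> \<sigma> k"
    and wdx_un: "\<And>k. has_wdx T (un (\<sigma> k))"
    and conv: "AE z in lebesgue_on (Q T). (\<lambda>k. un (\<sigma> k) z) \<longlonglongrightarrow> u z"
    and wdx_conv: "AE z in lebesgue_on (Q T). (\<lambda>k. wdx T (un (\<sigma> k)) z) \<longlonglongrightarrow> wdx T u z"
    unfolding constructed_weak_solution_def by blast
  from assms(4) have u: "has_wdx T u" "Lp (lebesgue_on (Q T)) 2 (wdx T u)" "Linf_Lp l T 1 u"
    unfolding constructed_weak_solution_def weak_solution_def by auto
  have a_dec: "a (Suc n) < a n" if "1 \<le> n" for n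
    using data that unfolding admissible_data_def by blast
  have a_lim: "a \<longlonglongrightarrow> 0" and b_lim: "filterlim b at_top sequentially"
    using data unfolding admissible_data_def by blast+
  \<comment> \<open>The left endpoints strictly decrease to 0, so each of them is positive.\<close>
  have a_pos: "0 < a n" if n: "1 \<le> n" for n
  proof -
    have "a m \<le> a (Suc n)" if "Suc n \<le> m" for m
      using that
    proof (induction rule: dec_induct)
      case (step k)
      then show ?case using a_dec[of k] n by auto
    qed simp
    then have "0 \<le> a (Suc n)"
      by (intro LIMSEQ_le_const2[OF a_lim]) blast
    then show ?thesis using a_dec[OF n] by simp
  qed
  obtain M where M: "0 < M" "\<And>n x. 1 \<le> n \<Longrightarrow> 0 < x \<Longrightarrow> \<bar>rho l x * gn n x\<bar> < M"
  proof -
    have "Linf_norm (lebesgue_on Omega) (\<lambda>x. rho l x * g x) < \<infinity>"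
      using assms(3) unfolding hypothesis_H_def Linf_def by blast
    then obtain C where C: "Linf_norm (lebesgue_on Omega) (\<lambda>x. rho l x * g x) \<le> ereal C"
      by (cases "Linf_norm (lebesgue_on Omega) (\<lambda>x. rho l x * g x)") auto
    have bound: "\<bar>rho l x * gn n x\<bar> \<le> C" if n: "1 \<le> n" and x: "0 < x" for n x
    proof (rule Linf_norm_continuous_bound[OF _ _ x])
      have "test_function {a n<..<b n} (\<lambda>x. rho l x * gn n x)"
        using data n unfolding admissible_data_def by blast
      then have "Ck 0 (\<lambda>x. rho l x * gn n x)" unfolding test_function_def by blast
      then show "continuous_on UNIV (\<lambda>x. rho l x * gn n x)" by simp
      have "Linf_norm (lebesgue_on Omega) (\<lambda>x. rho l x * gn n x) \<le> Linf_norm (lebesgue_on Omega) (\<lambda>x. rho l x * g x)"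
        using data n unfolding admissible_data_def by blast
      then show "Linf_norm (lebesgue_on Omega) (\<lambda>x. rho l x * gn n x) \<le> ereal C"
        using C by (rule order_trans)
    qed
    show thesis
    proof (rule that[of "\<bar>C\<bar> + 1"])
      show "\<bar>rho l x * gn n x\<bar> < \<bar>C\<bar> + 1" if "1 \<le> n" "0 < x" for n x
        using bound[OF that] by linarith
    qed simp
  qed
  define e where "e k = 1 / real (\<sigma> k)" for k
  define aa where "aa k = a (\<sigma> k)" for k
  define bb where "bb k = b (\<sigma> k)" for k
  define w where "w k z = un (\<sigma> k) z + e k" for k and z :: "real \<times> real"
  have "\<exists>wt wx wxx. positive_classical_solution l M T (e k) (aa k) (bb k) (gn (\<sigma> k)) (w k) wt wx wxx \<and>
      continuous_on ({0..T} \<times> {aa k..bb k}) (un (\<sigma> k)) \<and> continuous_on ({0..T} \<times> {aa k..bb k}) wx" for k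
  proof -
    have v0: "0 \<le> u0n (\<sigma> k) x" for x using data \<sigma>(2)[of k] unfolding admissible_data_def by blast
    have h: "\<bar>rho l x * gn (\<sigma> k) x\<bar> < M" if "x \<in> {aa k<..<bb k}" for x
      using M(2)[OF \<sigma>(2)] a_pos[OF \<sigma>(2), of k] that by (auto simp: aa_def)
    obtain wt wx wxx where "positive_classical_solution l M T (1 / real (\<sigma> k)) (a (\<sigma> k)) (b (\<sigma> k)) (gn (\<sigma> k))
        (\<lambda>z. un (\<sigma> k) z + 1 / real (\<sigma> k)) wt wx wxx"
      "continuous_on ({0..T} \<times> {a (\<sigma> k)..b (\<sigma> k)}) (un (\<sigma> k))" "continuous_on ({0..T} \<times> {a (\<sigma> k)..b (\<sigma> k)}) wx"
      using regularized_solution_classical[OF reg[OF \<sigma>(2)] assms(1) \<sigma>(2) M(1) a_pos[OF \<sigma>(2)] h[unfolded aa_def bb_def] v0]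
      by blast
    then show ?thesis unfolding e_def aa_def bb_def w_def by blast
  qed
  then obtain wt wx wxx where
    sol: "\<And>k. positive_classical_solution l M T (e k) (aa k) (bb k) (gn (\<sigma> k)) (w k) (wt k) (wx k) (wxx k)"
    and cont: "\<And>k. continuous_on ({0..T} \<times> {aa k..bb k}) (un (\<sigma> k))" "\<And>k. continuous_on ({0..T} \<times> {aa k..bb k}) (wx k)"
    by metis
  have e_lim: "e \<longlonglongrightarrow> 0"
    unfolding e_def using LIMSEQ_subseq_LIMSEQ[OF lim_1_over_n \<sigma>(1)] by (simp add: o_def)
  obtain C0 where C0: "AE t in lebesgue_on {0<..<T}. Lp (nu l) 1 (\<lambda>x. u (t, x)) \<and> (LINT x|nu l. \<bar>u (t, x)\<bar> powr 1) \<le> C0"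
    using u(3) unfolding Linf_Lp_def by blast
  interpret approximation l M T C0 e aa bb "\<lambda>k. gn (\<sigma> k)" w wt wx wxx u
  proof (rule approximation.intro)
    show "aa \<longlonglongrightarrow> 0" unfolding aa_def using LIMSEQ_subseq_LIMSEQ[OF a_lim \<sigma>(1)] by (simp add: o_def)
    show "filterlim bb at_top sequentially"
      unfolding bb_def by (rule filterlim_compose[OF b_lim filterlim_subseq[OF \<sigma>(1)]])
    show "AE z in lebesgue. z \<in> Q T \<longrightarrow> (\<lambda>k. w k z) \<longlonglongrightarrow> u z"
      using conv[unfolded AE_Q]
    proof (rule eventually_mono, intro impI)
      fix z assume "z \<in> Q T \<longrightarrow> (\<lambda>k. un (\<sigma> k) z) \<longlonglongrightarrow> u z" "z \<in> Q T"
      then show "(\<lambda>k. w k z) \<longlonglongrightarrow> u z"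
        unfolding w_def using tendsto_add[OF _ e_lim, of "\<lambda>k. un (\<sigma> k) z" "u z"] by simp
    qed
    show "AE t in lebesgue. t \<in> {0<..<T} \<longrightarrow>
      Lp (nu l) 1 (\<lambda>x. u (t, x)) \<and> (LINT x|nu l. \<bar>u (t, x)\<bar> powr 1) \<le> C0"
      by (rule iffD1[OF AE_restrict_space_iff C0]) simp
  qed (rule assms M sol)+
  have eq: "AE z in lebesgue. z \<in> Q T \<longrightarrow> extended z = u z"
    using v_eq_u by (rule eventually_mono) (use extended_eq in auto)
  \<comment> \<open>Both functions have the same set of weak derivatives, so the choice in
    \<open>wpd\<close> selects the same function and \<open>wdx_eq\<close> holds without exceptional
    points.\<close>
  have weak_eq: "weak_pd (0, 1) (Q T) extended = weak_pd (0, 1) (Q T) u"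
    using weak_pd_cong_AE[OF Q(2) eq] by blast
  have wdx_eq: "wdx T extended = wdx T u" unfolding wpd_def weak_eq ..
  \<comment> \<open>The selected weak derivative of each regularized solution is tied to the
    classical \<open>wx k\<close>, which carries the gradient bound.\<close>
  have "AE z in lebesgue. z \<in> {0<..<T} \<times> {aa k<..<bb k} \<longrightarrow> wdx T (un (\<sigma> k)) z = wx k z" for k
  proof (rule weak_pd_eq_classical)
    show "weak_pd (0, 1) (Q T) (un (\<sigma> k)) (wdx T (un (\<sigma> k)))"
      using wdx_un[of k] unfolding wpd_def weakly_diff_def by (rule someI_ex)
    show "{0<..<T} \<times> {aa k<..<bb k} \<subseteq> Q T"
      using a_pos[OF \<sigma>(2), of k] by (auto simp: Q_def Omega_def aa_def)
    show "continuous_on ({0<..<T} \<times> {aa k<..<bb k}) (un (\<sigma> k))"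
      "continuous_on ({0<..<T} \<times> {aa k<..<bb k}) (wx k)"
      by (rule continuous_on_subset[OF cont(1)] continuous_on_subset[OF cont(2)]; force)+
    fix t x assume tx: "t \<in> {0<..<T}" "x \<in> {aa k<..<bb k}"
    have "((\<lambda>y. w k (t, y) - e k) has_real_derivative wx k (t, x)) (at x)"
      using positive_classical_solution.wx[OF sol tx] by (auto intro!: derivative_eq_intros)
    then show "((\<lambda>y. un (\<sigma> k) (t, y)) has_real_derivative wx k (t, x)) (at x)"
      by (simp add: w_def)
  qed (rule Q)
  then have wdx_wx: "AE z in lebesgue. \<forall>k. z \<in> {0<..<T} \<times> {aa k<..<bb k} \<longrightarrow> wdx T (un (\<sigma> k)) z = wx k z"
    by (subst AE_all_countable) blast
  \<comment> \<open>The bound passes from \<open>wx k\<close> to \<open>wdx T u\<close> through the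
    almost everywhere convergence of the gradients; the index may depend on the point.\<close>
  have wdx_bound: "AE z in lebesgue. z \<in> {t0..<T} \<times> {p..q} \<longrightarrow> \<bar>wdx T u z\<bar> \<le> C"
    if C: "\<And>t x. t \<in> {t0..<T} \<Longrightarrow> x \<in> {p..q} \<Longrightarrow>
      eventually (\<lambda>k. aa k < x \<and> x < bb k \<and> \<bar>wx k (t, x)\<bar> \<le> C) sequentially"
      and t0: "0 < t0" "0 < p" for t0 p q C
    using wdx_wx wdx_conv[unfolded AE_Q]
  proof eventually_elim
    case (elim z)
    show ?case
    proof
      assume z: "z \<in> {t0..<T} \<times> {p..q}"
      then have "z \<in> Q T" using t0 by (auto simp: Q_def Omega_def)
      then have lim: "(\<lambda>k. wdx T (un (\<sigma> k)) z) \<longlonglongrightarrow> wdx T u z" using elim by blast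
      have "eventually (\<lambda>k. \<bar>wdx T (un (\<sigma> k)) z\<bar> \<le> C) sequentially"
        using C[of "fst z" "snd z"] z t0 elim(1) by (auto elim!: eventually_mono)
      then show "\<bar>wdx T u z\<bar> \<le> C"
        by (rule tendsto_upperbound[OF tendsto_rabs[OF lim]]) simp
    qed
  qed
  show ?thesis
  proof (intro exI[of _ extended] conjI allI impI)
    show "AE z in lebesgue_on (Q T). extended z = u z" unfolding AE_Q by (rule eq)
    show "has_wdx T extended" using u(1) unfolding weakly_diff_def weak_eq .
    show "locally_holder (1 / 2) ({0<..T} \<times> Omega) extended"
      unfolding locally_holder_def
    proof (intro allI impI)
      fix K assume K: "compact K \<and> K \<subseteq> {0<..T} \<times> Omega"
      show "holder_norm (1 / 2) K extended < \<infinity>"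
      proof (cases "K = {}")
        case True
        then show ?thesis by (simp add: holder_norm_def bot_ennreal)
      next
        case False
        then obtain t0 p q where tpq: "0 < t0" "0 < p" "p \<le> q" "K \<subseteq> {t0..T} \<times> {p..q}"
          using compact_in_strip[of K T] K by blast
        obtain C where C: "0 \<le> C"
          "\<And>t x. t \<in> {t0..T} \<Longrightarrow> x \<in> {p..q} \<Longrightarrow> \<bar>extended (t, x)\<bar> \<le> C"
          "\<And>t1 t2 x y. t1 \<in> {t0..T} \<Longrightarrow> t2 \<in> {t0..T} \<Longrightarrow> x \<in> {p..q} \<Longrightarrow> y \<in> {p..q} \<Longrightarrow>
            \<bar>extended (t1, x) - extended (t2, y)\<bar> \<le> C * (\<bar>x - y\<bar> + sqrt \<bar>t1 - t2\<bar>)"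
          apply (rule extended_estimate[OF tpq(1-3)])
          subgoal premises prems for C by (rule prems(1)[of C]) (fact prems)+
          done
        show ?thesis
          proof (rule holder_norm_finite[OF tpq(4) _ _ C(1)])
          fix z assume "z \<in> K"
          then show "\<bar>extended z\<bar> \<le> C" using C(2)[of "fst z" "snd z"] subsetD[OF tpq(4), of z] by (auto simp: mem_Times_iff)
        next
          fix z w assume "z \<in> K" "w \<in> K"
          then show "\<bar>extended z - extended w\<bar> \<le> C * (\<bar>snd z - snd w\<bar> + sqrt \<bar>fst z - fst w\<bar>)"
            using C(3)[of "fst z" "fst w" "snd z" "snd w"] subsetD[OF tpq(4), of z] subsetD[OF tpq(4), of w]
            by (auto simp: mem_Times_iff)
        qed
      qed
    qed
    show "locally_lipschitz_x ({0<..T} \<times> Omega) extended"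
      unfolding locally_lipschitz_x_def
    proof (intro allI impI)
      fix K assume K: "compact K \<and> K \<subseteq> {0<..T} \<times> Omega"
      show "\<exists>L. \<forall>t x y. (t, x) \<in> K \<and> (t, y) \<in> K \<longrightarrow> \<bar>extended (t, x) - extended (t, y)\<bar> \<le> L * \<bar>x - y\<bar>"
      proof (cases "K = {}")
        case False
        then obtain t0 p q where tpq: "0 < t0" "0 < p" "p \<le> q" "K \<subseteq> {t0..T} \<times> {p..q}"
          using compact_in_strip[of K T] K by blast
        obtain C where C: "\<And>t1 t2 x y. t1 \<in> {t0..T} \<Longrightarrow> t2 \<in> {t0..T} \<Longrightarrow> x \<in> {p..q} \<Longrightarrow> y \<in> {p..q} \<Longrightarrow>
            \<bar>extended (t1, x) - extended (t2, y)\<bar> \<le> C * (\<bar>x - y\<bar> + sqrt \<bar>t1 - t2\<bar>)"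
          apply (rule extended_estimate[OF tpq(1-3)])
          subgoal premises prems for C by (rule prems(1)[of C]) (fact prems)+
          done
        have "\<bar>extended (t, x) - extended (t, y)\<bar> \<le> C * \<bar>x - y\<bar>" if "(t, x) \<in> K" "(t, y) \<in> K" for t x y
          using C[of t t x y] subsetD[OF tpq(4) that(1)] subsetD[OF tpq(4) that(2)] by (auto simp: mem_Times_iff)
        then show ?thesis by blast
      qed simp
    qed
    fix t0 D assume D: "0 < t0 \<and> t0 < T \<and> D \<in> sets lebesgue \<and> compact (closure D) \<and> closure D \<subseteq> Omega"
    \<comment> \<open>The strip lemma is applied to the slice \<open>{T} \<times> closure D\<close>;
      an empty \<open>D\<close> gets \<open>p = q = 1\<close>.\<close>
    obtain p q where pq: "0 < p" "p \<le> q" "D \<subseteq> {p..q}"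
    proof (cases "D = {}")
      case False
      have "compact ({T} \<times> closure D)" "{T} \<times> closure D \<subseteq> {0<..T} \<times> Omega" "{T} \<times> closure D \<noteq> {}"
        using D False by (auto intro: compact_Times)
      then obtain s p q where s: "0 < p" "p \<le> q" "{T} \<times> closure D \<subseteq> {s..T} \<times> {p..q}"
        using compact_in_strip by metis
      then have "D \<subseteq> {p..q}" using closure_subset by fastforce
      then show thesis using s that by blast
    qed (use that[of 1 1] in auto)
    have t0: "0 < t0" using D by simp
    obtain C where C: "0 \<le> C"
      "\<And>t x. t \<in> {t0..T} \<Longrightarrow> x \<in> {p..q} \<Longrightarrow> \<bar>extended (t, x)\<bar> \<le> C"
      "\<And>t1 t2 x y. t1 \<in> {t0..T} \<Longrightarrow> t2 \<in> {t0..T} \<Longrightarrow> x \<in> {p..q} \<Longrightarrow> y \<in> {p..q} \<Longrightarrow>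
        \<bar>extended (t1, x) - extended (t2, y)\<bar> \<le> C * (\<bar>x - y\<bar> + sqrt \<bar>t1 - t2\<bar>)"
      "\<And>t x. t \<in> {t0..<T} \<Longrightarrow> x \<in> {p..q} \<Longrightarrow>
        eventually (\<lambda>k. aa k < x \<and> x < bb k \<and> \<bar>wx k (t, x)\<bar> \<le> C) sequentially"
      apply (rule extended_estimate[OF t0 pq(1,2)])
      subgoal premises prems for C by (rule prems(1)[of C]) (fact prems)+
      done
    have sub: "{t0<..<T} \<times> D \<subseteq> {t0..T} \<times> {p..q}" using pq(3) by fastforce
    show "holder_norm (1 / 2) ({t0<..<T} \<times> D) extended < \<infinity>"
      proof (rule holder_norm_finite[OF sub _ _ C(1)])
          fix z assume "z \<in> {t0<..<T} \<times> D"
          then show "\<bar>extended z\<bar> \<le> C" using C(2)[of "fst z" "snd z"] subsetD[OF sub, of z] by (auto simp: mem_Times_iff)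
        next
          fix z w assume "z \<in> {t0<..<T} \<times> D" "w \<in> {t0<..<T} \<times> D"
          then show "\<bar>extended z - extended w\<bar> \<le> C * (\<bar>snd z - snd w\<bar> + sqrt \<bar>fst z - fst w\<bar>)"
            using C(3)[of "fst z" "fst w" "snd z" "snd w"] subsetD[OF sub, of z] subsetD[OF sub, of w]
            by (auto simp: mem_Times_iff)
        qed
    define S where "S = {t0<..<T} \<times> D"
    have S: "S \<in> sets lebesgue" unfolding S_def using D by (intro times_in_sets_lebesgue) auto
    have SQ: "S \<subseteq> Q T" using pq D by (fastforce simp: S_def Q_def Omega_def)
    have meas: "wdx T u \<in> borel_measurable (lebesgue_on S)"
      using u(2) SQ unfolding Lp_def by (blast intro: measurable_restrict_mono)
    have "S \<subseteq> {t0..<T} \<times> {p..q}" unfolding S_def using pq(3) by (intro Sigma_mono) auto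
    moreover have "AE z in lebesgue. z \<in> {t0..<T} \<times> {p..q} \<longrightarrow> \<bar>wdx T u z\<bar> \<le> C"
      by (rule wdx_bound[OF C(4) t0 pq(1)])
    ultimately have "AE z in lebesgue. z \<in> S \<longrightarrow> \<bar>wdx T u z\<bar> \<le> C"
      by (auto elim!: eventually_mono)
    then have "AE z in lebesgue_on S. ereal \<bar>wdx T u z\<bar> \<le> ereal C"
      using S by (simp add: AE_restrict_space_iff)
    then have "Linf_norm (lebesgue_on S) (wdx T u) \<le> ereal C"
      unfolding Linf_norm_def using meas by (intro esssup_I) measurable
    then show "Linf (lebesgue_on ({t0<..<T} \<times> D)) (wdx T extended)"
      unfolding Linf_def wdx_eq S_def[symmetric] using meas by (auto intro: order.strict_trans1)
  qed
qed

end
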